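(* Let $-1<q\le1$ and let $\rho_{12},\rho_{13},\rho_{23}\in(-1,1)$ satisfy $1+2\rho_{12}\rho_{13}\rho_{23}-\rho_{12}^2-\rho_{13}^2-\rho_{23}^2\ge0$; abbreviate $f_{3D}=f_{3D}(x_1,x_2,x_3|\rho_{12},\rho_{13},\rho_{23},q)$. Then: i) $\int_{S(q)^3}f_{3D}\,dx_1dx_2dx_3=1$; ii) $\int_{S(q)^2}f_{3D}\,dx_1\,dx_2=f_N(x_3|q)$, and for $n,m\ge0$ $$\int_{S(q)^3}H_n(x_1|q)H_m(x_2|q)f_{3D}\,dx_3dx_1dx_2=\begin{cases}0,&n\ne m,\\ \rho_{12}^n[n]_q!,&n=m,\end{cases}$$ and similarly for the other pairs of indices $(1,3)$ and $(2,3)$; in particular $\int_{S(q)^3}x_1f_{3D}\,dx_1dx_2dx_3=0$ and $\int_{S(q)^3}x_1^2f_{3D}\,dx_1dx_2dx_3=1$, and similarly for the indices $2$ and $3$; iii) $\int_{S(q)}f_{3D}\,dx_3=f_{CN}(x_1|x_2,\rho_{12},q)f_N(x_2|q)$; iv) if $\rho_{13}=\rho_{23}=0$, then $f_{3D}=f_{CN}(x_1|x_2,\rho_{12},q)f_N(x_2|q)f_N(x_3|q)$, and similarly for the other pairs $(1,3)$ and $(2,3)$. Here the free variables $x_i$ range over $S(q)$.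
   Context: Notation, for $-1<q\le1$: $[0]_q=0$, $[n]_q=1+q+\dots+q^{n-1}$, $[n]_q!=\prod_{i=1}^n[i]_q$, $[0]_q!=1$; for $|q|<1$, $(a)_\infty=\prod_{i\ge0}(1-aq^i)$; $S(q)=[-2/\sqrt{1-q},2/\sqrt{1-q}]$ for $|q|<1$, $S(1)=\mathbb R$. $q$-Hermite polynomials: $H_{-1}=0$, $H_0=1$, $H_{n+1}(x|q)=xH_n(x|q)-[n]_qH_{n-1}(x|q)$, $n\ge0$. Densities, for $|q|<1$, $x,y\in S(q)$, $|\rho|<1$: $$f_N(x|q)=\frac{(q)_\infty\sqrt{1-q}}{2\pi}\sqrt{4-(1-q)x^2}\prod_{k=1}^\infty\big((1+q^k)^2-(1-q)x^2q^k\big),\qquad f_{CN}(x|y,\rho,q)=f_N(x|q)\,(\rho^2)_\infty\prod_{k=0}^\infty\frac1{v_0(x,y|\rho q^k,q)},$$ where $v_0(x,y|\rho,q)=(1-\rho^2)^2-(1-q)\rho(1+\rho^2)xy+(1-q)\rho^2(x^2+y^2)$. For $q=1$: $f_N(x|1)=\frac1{\sqrt{2\pi}}e^{-x^2/2}$, $f_{CN}(x|y,\rho,1)=\frac1{\sqrt{2\pi(1-\rho^2)}}\exp\left(-\frac{(x-\rho y)^2}{2(1-\rho^2)}\right)$. $$f_{3D}(x_1,x_2,x_3|\rho_{12},\rho_{13},\rho_{23},q)=\prod_{i=1}^3f_N(x_i|q)\sum_{i,j,k\ge0}\frac{\rho_{12}^j\rho_{23}^k\rho_{13}^i}{[i]_q![j]_q![k]_q!}H_{i+j}(x_1|q)H_{j+k}(x_2|q)H_{i+k}(x_3|q)$$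 (the series is absolutely convergent for $|q|<1$; for $q=1$ it is the classical Kibble–Slepian expansion, and $f_{3D}$ is the density of the centered Gaussian distribution with unit variances and correlations $\rho_{12},\rho_{13},\rho_{23}$).
   Formalization: For q=1, f_3D is taken to be the Gaussian density; when q=1 and 1+2ρ12ρ13ρ23−ρ12²−ρ13²−ρ23²=0 no density exists (singular covariance), so i)–iii) are stated there for the singular centered Gaussian law: total mass, marginal laws, moments and joint law of (x1,x2). *)

theory Defs
  imports "HOL-Probability.Probability"
begin

section \<open>q-notation\<close>

definition qnum :: "real \<Rightarrow> nat \<Rightarrow> real" where
  "qnum q n = (\<Sum>i<n. q ^ i)"

definition qfact :: "real \<Rightarrow> nat \<Rightarrow> real" where
  "qfact q n = (\<Prod>i = 1..n. qnum q i)"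

definition qpoch_inf :: "real \<Rightarrow> real \<Rightarrow> real" where
  "qpoch_inf a q = (\<Prod>i. 1 - a * q ^ i)"

definition qsupp :: "real \<Rightarrow> real set" where
  "qsupp q = (if q = 1 then UNIV else {- 2 / sqrt (1 - q) .. 2 / sqrt (1 - q)})"

text \<open>The convention \<open>H\<^sub>-\<^sub>1 = 0\<close> of the three-term recurrence is absorbed into the second equation.\<close>

fun qHermite :: "real \<Rightarrow> nat \<Rightarrow> real \<Rightarrow> real" where
  "qHermite q 0 x = 1"
| "qHermite q (Suc 0) x = x"
| "qHermite q (Suc (Suc n)) x = x * qHermite q (Suc n) x - qnum q (Suc n) * qHermite q n x"

section \<open>One-dimensional densities\<close>

definition fN :: "real \<Rightarrow> real \<Rightarrow> real" where
  "fN q x =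
    (if q = 1 then normal_density 0 1 x
     else qpoch_inf q q * sqrt (1 - q) / (2 * pi) * sqrt (4 - (1 - q) * x\<^sup>2)
          * (\<Prod>k. (1 + q ^ Suc k)\<^sup>2 - (1 - q) * x\<^sup>2 * q ^ Suc k))"

definition v0 :: "real \<Rightarrow> real \<Rightarrow> real \<Rightarrow> real \<Rightarrow> real" where
  "v0 x y \<rho> q = (1 - \<rho>\<^sup>2)\<^sup>2 - (1 - q) * \<rho> * (1 + \<rho>\<^sup>2) * x * y + (1 - q) * \<rho>\<^sup>2 * (x\<^sup>2 + y\<^sup>2)"

text \<open>\<open>fCN q \<rho> x y\<close> is the conditional density of \<open>x\<close> given \<open>y\<close>.  The second argument of
  \<^const>\<open>normal_density\<close> is the standard deviation.\<close>

definition fCN :: "real \<Rightarrow> real \<Rightarrow> real \<Rightarrow> real \<Rightarrow> real" where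
  "fCN q \<rho> x y =
    (if q = 1 then normal_density (\<rho> * y) (sqrt (1 - \<rho>\<^sup>2)) x
     else fN q x * qpoch_inf (\<rho>\<^sup>2) q * (\<Prod>k. 1 / v0 x y (\<rho> * q ^ k) q))"

section \<open>Centred Gaussian distributions\<close>

definition centered_gaussian_density :: "real ^ 'n ^ 'n \<Rightarrow> real ^ 'n \<Rightarrow> real" where
  "centered_gaussian_density R x =
    exp (- (x \<bullet> (matrix_inv R *v x)) / 2) / sqrt ((2 * pi) ^ CARD('n) * det R)"

text \<open>The Gaussian law with a possibly singular covariance matrix, which need not have a density;
  the characteristic function determines it uniquely.\<close>

definition centered_gaussian_law :: "real ^ 'n ^ 'n \<Rightarrow> (real ^ 'n) measure \<Rightarrow> bool" where
  "centered_gaussian_law R M \<longleftrightarrow>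
    prob_space M \<and> sets M = sets borel \<and>
    (\<forall>t. (CLINT x|M. cis (t \<bullet> x)) = complex_of_real (exp (- (t \<bullet> (R *v t)) / 2)))"

definition corr_matrix3 :: "real \<Rightarrow> real \<Rightarrow> real \<Rightarrow> real ^ 3 ^ 3" where
  "corr_matrix3 \<rho>12 \<rho>13 \<rho>23 =
    vector [vector [1, \<rho>12, \<rho>13],
            vector [\<rho>12, 1, \<rho>23],
            vector [\<rho>13, \<rho>23, 1]]"

section \<open>The three-dimensional density\<close>

text \<open>For \<open>q = 1\<close> the Kibble--Slepian series is not summable for all positive definite correlation
  matrices (e.g. not when all three correlations are \<open>9/10\<close>), so there the function is taken to be
  the Gaussian density which the series expands.\<close>

definition f3D :: "real \<Rightarrow> real \<Rightarrow> real \<Rightarrow> real \<Rightarrow> real \<Rightarrow> real \<Rightarrow> real \<Rightarrow> real" where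
  "f3D q \<rho>12 \<rho>13 \<rho>23 x1 x2 x3 =
    (if q = 1 then centered_gaussian_density (corr_matrix3 \<rho>12 \<rho>13 \<rho>23) (vector [x1, x2, x3])
     else fN q x1 * fN q x2 * fN q x3 *
       infsum (\<lambda>(i, j, k). \<rho>12 ^ j * \<rho>23 ^ k * \<rho>13 ^ i / (qfact q i * qfact q j * qfact q k)
           * qHermite q (i + j) x1 * qHermite q (j + k) x2 * qHermite q (i + k) x3)
         (UNIV :: (nat \<times> nat \<times> nat) set))"

text \<open>Integrability is part of the claim, since the Bochner integral of a non-integrable
  function is \<open>0\<close>.\<close>

definition has_lebesgue_integral_on ::
    "('a::euclidean_space \<Rightarrow> real) \<Rightarrow> real \<Rightarrow> 'a set \<Rightarrow> bool" where
  "has_lebesgue_integral_on f v A \<longleftrightarrow> set_integrable lborel A f \<and> (LINT x:A|lborel. f x) = v"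

end

theory Submission
  imports Defs
begin

text \<open>
  For \<open>q < 1\<close> everything follows from two classical facts on the \<open>q\<close>-Hermite polynomials.
  They are orthogonal with respect to \<open>fN q\<close> with squared norms \<open>qfact q n\<close>
  (\<open>qHermite_orthogonal\<close>), and the Poisson--Mehler formula expands \<open>fCN q \<rho> x y / fN q x\<close> in
  products \<open>H\<^sub>n(x) H\<^sub>n(y)\<close> (\<open>poisson_mehler\<close>, \<open>fCN_series\<close>).  On the compact set \<open>S(q)\<close> the
  polynomials grow so slowly (\<open>hq_bound\<close>) that the triple series defining \<open>f3D\<close> converges uniformly
  and may be integrated term by term (\<open>has_bochner_integral_tri_series\<close>).  Integrating out \<open>x\<^sub>3\<close> kills
  every term with \<open>i + k > 0\<close>, and what remains is the Poisson--Mehler series in \<open>\<rho>\<^sub>1\<^sub>2\<close>; the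
  remaining integrals are further uses of orthogonality, and independence is the same collapse of
  the series for \<open>\<rho>\<^sub>1\<^sub>3 = \<rho>\<^sub>2\<^sub>3 = 0\<close>.

  For orthogonality, the weight is written as the limit of the semicircle density times finitely many
  quadratic factors.  The Chebyshev moments of these truncations satisfy
  a three-term relation with an explicit solution (\<open>chebyshev_functional\<close>), and letting the number of
  factors tend to infinity gives the moments \<open>(-1)^j q^(j (j + 1) / 2)\<close> of the weight itself.  From these,
  \<open>theta_recurrence\<close> computes the mean of each \<open>H\<^sub>n\<close>, and the three-term recurrence does the rest.
  The Poisson--Mehler kernel and its product form satisfy the same \<open>q\<close>-difference equation in \<open>\<rho>\<close>
  (\<open>mehler_functional_eq\<close>), which determines both.

  For \<open>q = 1\<close> and a positive determinant, the Gaussian density factors into the bivariate normal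
  density of \<open>x\<^sub>1, x\<^sub>2\<close> and a normal density in \<open>x\<^sub>3\<close> (\<open>f3D_gaussian_factor\<close>), and averaging \<open>H\<^sub>n\<close> over the
  conditional law multiplies it by \<open>\<rho>\<^sup>n\<close> (\<open>normal_hermite_mean\<close>).  When the determinant vanishes, the
  third coordinate is a linear function of the first two, and the law is an image of the bivariate
  normal law (\<open>singular_gaussian_law\<close>).  In all cases the statements are proved for one pair of
  indices; the others follow from the symmetry of \<open>f3D\<close> and of Lebesgue measure.
\<close>

section \<open>q-Hermite polynomials in the scaled variable\<close>

text \<open>Rogers' polynomials: in the variable \<open>X = sqrt (1 - q) * x\<close> the set \<open>S(q)\<close> becomes \<open>[-2, 2]\<close> for every
  \<open>q\<close>.  For \<open>q = 0\<close> these are the Chebyshev polynomials of the second kind in \<open>X / 2\<close>.\<close>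

fun hq :: "real \<Rightarrow> nat \<Rightarrow> real \<Rightarrow> real" where
  "hq q 0 X = 1"
| "hq q (Suc 0) X = X"
| "hq q (Suc (Suc n)) X = X * hq q (Suc n) X - (1 - q ^ Suc n) * hq q n X"

definition qp :: "real \<Rightarrow> nat \<Rightarrow> real" where
  "qp q n = (\<Prod>i<n. 1 - q ^ Suc i)"

lemma qp_0 [simp]: "qp q 0 = 1"
  and qp_Suc: "qp q (Suc n) = qp q n * (1 - q ^ Suc n)"
  by (simp_all add: qp_def)

lemma hq_rec: "X * hq q n X = hq q (Suc n) X + (1 - q ^ n) * hq q (n - 1) X"
  by (cases n) simp_all

lemma qHermite_rec: "x * qHermite q n x = qHermite q (Suc n) x + qnum q n * qHermite q (n - 1) x"
  by (cases n) (simp_all add: qnum_def)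

lemma qnum_closed: "q \<noteq> 1 \<Longrightarrow> qnum q n = (1 - q ^ n) / (1 - q)"
  using sum_gp_strict[of q n] by (simp add: qnum_def)

lemma qfact_Suc: "qfact q (Suc n) = qfact q n * qnum q (Suc n)"
  by (simp add: qfact_def)

lemma qfact_0 [simp]: "qfact q 0 = 1"
  by (simp add: qfact_def)

lemma qfact_closed: "q \<noteq> 1 \<Longrightarrow> qfact q n = qp q n / (1 - q) ^ n"
  by (induction n) (simp_all add: qfact_Suc qp_Suc qnum_closed)

lemma hq_qHermite:
  assumes "q < 1"
  shows "hq q n (sqrt (1 - q) * x) = sqrt (1 - q) ^ n * qHermite q n x"
proof (induction n rule: induct_nat_012)
  case (ge2 n)
  have s2: "sqrt (1 - q) * sqrt (1 - q) = 1 - q" using assms by simp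
  have qn: "(1 - q) * qnum q (Suc n) = 1 - q ^ Suc n" using assms by (simp add: qnum_closed)
  have "sqrt (1 - q) ^ Suc (Suc n) * qHermite q (Suc (Suc n)) x =
     sqrt (1 - q) * x * (sqrt (1 - q) ^ Suc n * qHermite q (Suc n) x)
     - (sqrt (1 - q) * sqrt (1 - q)) * qnum q (Suc n) * (sqrt (1 - q) ^ n * qHermite q n x)"
    by (simp add: algebra_simps)
  also have "\<dots> = sqrt (1 - q) * x * hq q (Suc n) (sqrt (1 - q) * x)
     - (1 - q ^ Suc n) * hq q n (sqrt (1 - q) * x)"
    unfolding s2 qn ge2[symmetric] by simp
  finally show ?case by simp
qed simp_all

lemma qp_pos:
  assumes "\<bar>q\<bar> < 1"
  shows "qp q n > 0"
  unfolding qp_def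
proof (rule prod_pos)
  fix i
  have "\<bar>q\<bar> * \<bar>q\<bar> ^ i \<le> \<bar>q\<bar> * 1"
    using assms by (intro mult_left_mono power_le_one) auto
  then have "\<bar>q ^ Suc i\<bar> < 1"
    using assms by (simp add: abs_mult power_abs)
  then show "0 < 1 - q ^ Suc i" by linarith
qed

lemma qpoch_convergent:
  fixes a q :: real
  assumes "\<bar>q\<bar> < 1"
  shows "convergent_prod (\<lambda>i. 1 - a * q ^ i)"
proof -
  have "summable (\<lambda>i. norm ((1 - a * q ^ i) - 1))"
    using assms by (simp add: abs_mult power_abs summable_geometric)
  then show ?thesis
    using abs_convergent_prod_conv_summable abs_convergent_prod_imp_convergent_prod by blast
qed

lemma qpoch_LIMSEQ:
  assumes "\<bar>q\<bar> < 1"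
  shows "(\<lambda>n. \<Prod>i<n. 1 - a * q ^ i) \<longlonglongrightarrow> qpoch_inf a q"
  using convergent_prod_LIMSEQ[OF qpoch_convergent[OF assms, of a]]
  unfolding qpoch_inf_def lessThan_Suc_atMost[symmetric] by (rule LIMSEQ_imp_Suc)

lemma qpoch_nonzero:
  assumes "\<bar>q\<bar> < 1" "\<bar>a\<bar> < 1"
  shows "qpoch_inf a q \<noteq> 0"
  unfolding qpoch_inf_def
proof (rule prodinf_nonzero[OF qpoch_convergent[OF assms(1)]])
  fix i
  have "\<bar>a * q ^ i\<bar> \<le> \<bar>a\<bar> * 1"
    unfolding abs_mult power_abs by (intro mult_left_mono power_le_one) (use assms in auto)
  then show "1 - a * q ^ i \<noteq> 0" using assms by auto
qed

lemma qp_LIMSEQ: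
  assumes "\<bar>q\<bar> < 1"
  shows "qp q \<longlonglongrightarrow> qpoch_inf q q"
  using qpoch_LIMSEQ[OF assms, of q] by (simp add: qp_def[abs_def])

lemma qp_lower_bound:
  assumes "\<bar>q\<bar> < 1"
  obtains c where "c > 0" "\<And>n. qp q n \<ge> c"
proof -
  have ev: "(\<lambda>n. inverse (qp q n)) \<longlonglongrightarrow> inverse (qpoch_inf q q)"
    by (intro tendsto_inverse qp_LIMSEQ qpoch_nonzero assms)
  then obtain K where K: "K > 0" "\<And>n. norm (inverse (qp q n)) \<le> K"
    using convergent_imp_Bseq[OF convergentI[OF ev]] BseqE by blast
  show ?thesis
  proof (rule that[of "inverse K"])
    show "inverse K > 0" using K(1) by simp
    fix n show "qp q n \<ge> inverse K"
      using K(2)[of n] qp_pos[OF assms, of n] K(1)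
      by (simp add: field_simps)
  qed
qed

text \<open>With \<open>X = u + 1/u\<close>, \<open>|u| = 1\<close>, the differences \<open>h\<^sub>n\<^sub>+\<^sub>1 - u h\<^sub>n\<close> satisfy a first-order recurrence
  whose only growth comes from the summable perturbation \<open>q\<^sup>n h\<^sub>n\<^sub>-\<^sub>1\<close>.\<close>

lemma hq_bound:
  assumes q: "\<bar>q\<bar> < 1"
  obtains C where "C > 0" "\<And>n X. \<bar>X\<bar> \<le> 2 \<Longrightarrow> \<bar>hq q n X\<bar> \<le> C * real (Suc n)"
proof -
  define P where "P n = (\<Prod>k<n. 1 + real (Suc k) * \<bar>q\<bar> ^ Suc k)" for n
  have P_Suc: "P (Suc n) = P n * (1 + real (Suc n) * \<bar>q\<bar> ^ Suc n)" for n
    by (simp add: P_def)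
  have P_ge: "P n \<ge> 1" for n
    unfolding P_def by (rule prod_ge_1) simp
  have P_mono: "P n \<le> P (Suc n)" for n
    unfolding P_Suc using P_ge[of n] by (simp add: mult_le_cancel_left1)
  have bound: "\<bar>hq q n X\<bar> \<le> real (Suc n) * P n" if X: "\<bar>X\<bar> \<le> 2" for n X
  proof -
    define u where "u = cis (arccos (X / 2))"
    have nu: "norm u = 1" "u \<noteq> 0" by (simp_all add: u_def)
    have Xu: "complex_of_real X = u + inverse u"
      using X by (simp add: u_def complex_eq_iff cis_inverse cos_arccos_abs)
    define h where "h n = complex_of_real (hq q n X)" for n
    have "norm (h n) \<le> real (Suc n) * P n \<and> norm (h (Suc n) - u * h n) \<le> P n"
    proof (induction n)
      case 0
      show ?case using nu Xu by (simp add: h_def P_def norm_inverse)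
    next
      case (Suc n)
      have rec: "h (Suc (Suc n)) = (u + inverse u) * h (Suc n) - (1 - of_real q ^ Suc n) * h n"
        by (simp add: h_def Xu[symmetric])
      have "h (Suc (Suc n)) - u * h (Suc n) =
          inverse u * (h (Suc n) - u * h n) + of_real q ^ Suc n * h n"
        unfolding rec using nu by (simp add: algebra_simps)
      also have "norm \<dots> \<le> norm (inverse u * (h (Suc n) - u * h n)) + norm (of_real q ^ Suc n * h n)"
        by (rule norm_triangle_ineq)
      also have "\<dots> = norm (h (Suc n) - u * h n) + \<bar>q\<bar> ^ Suc n * norm (h n)"
        by (simp only: norm_mult norm_inverse nu norm_power norm_of_real) simp
      also have "\<dots> \<le> P n + \<bar>q\<bar> ^ Suc n * (real (Suc n) * P n)"
        by (intro add_mono mult_left_mono) (use Suc in auto)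
      also have "\<dots> = P (Suc n)" by (simp add: P_Suc algebra_simps)
      finally have 1: "norm (h (Suc (Suc n)) - u * h (Suc n)) \<le> P (Suc n)" .
      have "norm (h (Suc n)) \<le> norm (h (Suc n) - u * h n) + norm (u * h n)"
        by (metis diff_add_cancel norm_triangle_ineq)
      also have "\<dots> \<le> P n + real (Suc n) * P n"
        using Suc nu by (simp add: norm_mult)
      also have "\<dots> = real (Suc (Suc n)) * P n" by (simp add: algebra_simps)
      also have "\<dots> \<le> real (Suc (Suc n)) * P (Suc n)"
        by (intro mult_left_mono P_mono) auto
      finally show ?case using 1 by blast
    qed
    then show ?thesis by (simp add: h_def)
  qed
  \<comment> \<open>\<open>P\<close> stays bounded because \<open>k |q|^k\<close> is summable\<close>
  have sm: "summable (\<lambda>k. real (Suc k) * \<bar>q\<bar> ^ Suc k)"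
  proof -
    have "summable (\<lambda>n. of_nat n * \<bar>q\<bar> ^ n)"
      using sums_summable[OF geometric_deriv_sums[of "\<bar>q\<bar>"]] q
        summable_mult[of "\<lambda>n. of_nat (Suc n) * \<bar>q\<bar> ^ n" "\<bar>q\<bar>"]
      by (subst summable_Suc_iff[symmetric]) (simp add: algebra_simps)
    then show ?thesis by (subst summable_Suc_iff)
  qed
  have P_le: "P n \<le> exp (\<Sum>k. real (Suc k) * \<bar>q\<bar> ^ Suc k)" for n
  proof -
    have "P n \<le> (\<Prod>k<n. exp (real (Suc k) * \<bar>q\<bar> ^ Suc k))"
      unfolding P_def by (intro prod_mono conjI exp_ge_add_one_self) auto
    also have "\<dots> = exp (\<Sum>k<n. real (Suc k) * \<bar>q\<bar> ^ Suc k)"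
      by (simp add: exp_sum)
    also have "\<dots> \<le> exp (\<Sum>k. real (Suc k) * \<bar>q\<bar> ^ Suc k)"
      using sum_le_suminf[OF sm, of "{..<n}"] by auto
    finally show ?thesis .
  qed
  show ?thesis
  proof (rule that)
    show "0 < exp (\<Sum>k. real (Suc k) * \<bar>q\<bar> ^ Suc k)" by simp
    fix n and X :: real assume "\<bar>X\<bar> \<le> 2"
    from bound[OF this, of n] have "\<bar>hq q n X\<bar> \<le> real (Suc n) * P n" .
    also have "\<dots> \<le> real (Suc n) * exp (\<Sum>k. real (Suc k) * \<bar>q\<bar> ^ Suc k)"
      by (intro mult_left_mono P_le) auto
    finally show "\<bar>hq q n X\<bar> \<le> exp (\<Sum>k. real (Suc k) * \<bar>q\<bar> ^ Suc k) * real (Suc n)"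
      by (simp add: mult.commute)
  qed
qed

section \<open>Semicircle moments of the truncated weight\<close>

lemma hq0_sin: "hq 0 m (2 * cos \<theta>) * sin \<theta> = sin (real (Suc m) * \<theta>)"
proof (induction m rule: induct_nat_012)
  case 1
  then show ?case by (simp add: sin_double mult.assoc mult.commute[of "cos \<theta>" "sin \<theta>"])
next
  case (ge2 m)
  have "hq 0 (Suc (Suc m)) (2 * cos \<theta>) * sin \<theta> =
     2 * cos \<theta> * (hq 0 (Suc m) (2 * cos \<theta>) * sin \<theta>) - hq 0 m (2 * cos \<theta>) * sin \<theta>"
    by (simp add: algebra_simps)
  also have "\<dots> = 2 * cos \<theta> * sin (real (Suc (Suc m)) * \<theta>) - sin (real (Suc m) * \<theta>)"
    unfolding ge2 ..
  also have "\<dots> = sin (real (Suc (Suc (Suc m))) * \<theta>)"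
  proof -
    have "real (Suc (Suc (Suc m))) * \<theta> = real (Suc (Suc m)) * \<theta> + \<theta>"
      "real (Suc m) * \<theta> = real (Suc (Suc m)) * \<theta> - \<theta>" by (simp_all add: algebra_simps)
    then show ?thesis by (simp only: sin_add sin_diff) simp
  qed
  finally show ?case .
qed simp

lemma continuous_on_hq [continuous_intros]:
  "continuous_on A f \<Longrightarrow> continuous_on A (\<lambda>x. hq q n (f x))"
  by (induction n rule: induct_nat_012) (auto intro!: continuous_intros)

text \<open>The substitution \<open>s x = 2 cos \<theta>\<close> turns the integrand into \<open>sin ((m + 1) \<theta>) sin \<theta>\<close>, so it has an
  elementary antiderivative.\<close>

lemma semicircle_integral:
  assumes s: "s > 0"
  shows "(LINT x:{- 2 / s..2 / s}|lborel. hq 0 m (s * x) * sqrt (4 - (s * x)\<^sup>2)) = (if m = 0 then 2 * pi / s else 0)"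
proof -
  define g where "g x = hq 0 m (s * x) * sqrt (4 - (s * x)\<^sup>2)" for x
  \<comment> \<open>the antiderivative in the angle; the term for \<open>m = 0\<close> is the limit of \<open>sin (m \<theta>) / m\<close>\<close>
  define B where "B \<theta> = - (2 / s) * ((if m = 0 then \<theta> else sin (real m * \<theta>) / real m) - sin (real (m + 2) * \<theta>) / real (m + 2))" for \<theta>
  have le: "- 2 / s \<le> 2 / s" using s by (simp add: field_simps)
  have B': "(B has_real_derivative - (4 / s) * (sin (real (Suc m) * \<theta>) * sin \<theta>)) (at \<theta>)" for \<theta>
  proof -
    have "sin (real (Suc m) * \<theta>) * sin \<theta> = (cos (real m * \<theta>) - cos (real (m + 2) * \<theta>)) / 2"
    proof -
      have "real m * \<theta> = real (Suc m) * \<theta> - \<theta>" "real (m + 2) * \<theta> = real (Suc m) * \<theta> + \<theta>"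
        by (simp_all add: algebra_simps)
      then show ?thesis by (simp only: cos_add cos_diff) simp
    qed
    then have e: "- (4 / s) * (sin (real (Suc m) * \<theta>) * sin \<theta>) =
        - (2 / s) * (cos (real m * \<theta>) - cos (real (m + 2) * \<theta>))" by simp
    have sc: "((\<lambda>\<theta>. sin (c * \<theta>) / c) has_real_derivative cos (c * \<theta>)) (at \<theta>)" if "c \<noteq> 0" for c
      using that by (auto intro!: derivative_eq_intros)
    have "((\<lambda>\<theta>. if m = 0 then \<theta> else sin (real m * \<theta>) / real m) has_real_derivative cos (real m * \<theta>)) (at \<theta>)"
      using sc[of "real m"] by (cases "m = 0") simp_all
    then show ?thesis unfolding B_def[abs_def] e
      by (intro DERIV_cmult DERIV_diff sc) simp_all
  qed
  have range: "- 1 \<le> s * x / 2" "s * x / 2 \<le> 1" if "x \<in> {- 2 / s..2 / s}" for x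
    using that s by (auto simp: field_simps)
  have rangei: "- 1 < s * x / 2" "s * x / 2 < 1" if "x \<in> {- 2 / s<..<2 / s}" for x
    using that s by (auto simp: field_simps)
  have contg: "continuous_on {- 2 / s..2 / s} g"
    unfolding g_def by (intro continuous_intros)
  have "(g has_integral (B (arccos (s * (2 / s) / 2)) - B (arccos (s * (- 2 / s) / 2)))) {- 2 / s..2 / s}"
  proof (rule fundamental_theorem_of_calculus_interior[OF le])
    have "continuous_on UNIV B" using B' by (meson DERIV_isCont continuous_at_imp_continuous_on)
    then show "continuous_on {- 2 / s..2 / s} (\<lambda>x. B (arccos (s * x / 2)))"
      by (rule continuous_on_compose2) (use range in \<open>auto intro!: continuous_intros\<close>)
    fix x assume x: "x \<in> {- 2 / s<..<2 / s}"
    define \<theta> where "\<theta> = arccos (s * x / 2)"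
    have c: "2 * cos \<theta> = s * x" using rangei[OF x] by (simp add: \<theta>_def)
    have pos: "sin \<theta> > 0"
      using rangei[OF x] arccos_lt_bounded[of "s * x / 2"] by (auto simp: \<theta>_def intro: sin_gt_zero)
    have sq: "sqrt (1 - (s * x / 2)\<^sup>2) = sin \<theta>"
      using rangei[OF x] by (simp add: \<theta>_def sin_arccos)
    have sq4: "sqrt (4 - (s * x)\<^sup>2) = 2 * sin \<theta>"
    proof -
      have "4 - (s * x)\<^sup>2 = 4 * (1 - (s * x / 2)\<^sup>2)" by (simp add: power2_eq_square)
      then show ?thesis using sq by (simp only: real_sqrt_mult) simp
    qed
    have "((\<lambda>x. arccos (s * x / 2)) has_real_derivative (s / 2) * inverse (- sqrt (1 - (s * x / 2)\<^sup>2))) (at x)"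
      using rangei[OF x] by (auto intro!: derivative_eq_intros)
    from DERIV_chain2[OF B' this]
    have "((\<lambda>x. B (arccos (s * x / 2))) has_real_derivative
       - (4 / s) * (sin (real (Suc m) * \<theta>) * sin \<theta>) * ((s / 2) * inverse (- sin \<theta>))) (at x)"
      unfolding sq \<theta>_def .
    moreover have "- (4 / s) * (sin (real (Suc m) * \<theta>) * sin \<theta>) * ((s / 2) * inverse (- sin \<theta>)) = g x"
      unfolding g_def sq4 hq0_sin[of m \<theta>, symmetric] c using pos s by (simp add: field_simps)
    ultimately show "((\<lambda>x. B (arccos (s * x / 2))) has_vector_derivative g x) (at x)"
      by (simp add: has_real_derivative_iff_has_vector_derivative)
  qed
  moreover have "B (arccos (s * (2 / s) / 2)) - B (arccos (s * (- 2 / s) / 2)) = (if m = 0 then 2 * pi / s else 0)"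
    using s sin_npi[of m] sin_npi[of "m + 2"] by (auto simp: B_def field_simps simp del: sin_npi)
  ultimately have "(g has_integral (if m = 0 then 2 * pi / s else 0)) {- 2 / s..2 / s}" by simp
  then have "integral {- 2 / s..2 / s} g = (if m = 0 then 2 * pi / s else 0)"
    by (rule integral_unique)
  with set_borel_integral_eq_integral(2)[OF borel_integrable_atLeastAtMost'[OF contg]]
  have "(LINT x:{- 2 / s..2 / s}|lborel. g x) = (if m = 0 then 2 * pi / s else 0)"
    by (rule trans)
  then show ?thesis unfolding g_def .
qed

text \<open>The coefficients \<open>(-1)^j q^(j (j + 1) / 2)\<close> of the theta series in the Jacobi triple product.\<close>

fun theta_coeff :: "real \<Rightarrow> nat \<Rightarrow> real" where
  "theta_coeff q 0 = 1"
| "theta_coeff q (Suc j) = - theta_coeff q j * q ^ Suc j"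

text \<open>The coefficients of the finite form of the triple product; \<open>chebyshev_functional\<close> identifies them as the
  even Chebyshev moments of the semicircle density multiplied by \<open>N\<close> factors of the weight.\<close>

definition weight_coeff :: "real \<Rightarrow> nat \<Rightarrow> nat \<Rightarrow> real" where
  "weight_coeff q N j =
    (if j \<le> N then theta_coeff q j * qp q (2 * N + 1) / (qp q (N - j) * qp q (N + 1 + j)) else 0)"

text \<open>Over a common denominator the neighbouring coefficients differ by polynomial factors in \<open>q^j\<close> and \<open>q^N\<close>, so
  that their recurrence becomes a polynomial identity.  The boundary case \<open>a = 0\<close> is covered by the
  vanishing factor \<open>1 - q^a\<close>.\<close>

lemma weight_coeff_frac:
  assumes q: "\<bar>q\<bar> < 1" and N: "N = j + a"
  defines "M \<equiv> qp q (a + 1)" and "K \<equiv> qp q (N + 2 + j)" and "P \<equiv> qp q (2 * N + 1)"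
  shows "weight_coeff q N j = theta_coeff q j * P * (1 - q ^ (a + 1)) * (1 - q ^ (N + 2 + j)) / (M * K)"
    and "weight_coeff q (Suc N) j = theta_coeff q j * P * (1 - q ^ (2 * N + 2)) * (1 - q ^ (2 * N + 3)) / (M * K)"
    and "weight_coeff q N (Suc j) = - theta_coeff q j * P * q ^ Suc j * (1 - q ^ a) * (1 - q ^ (a + 1)) / (M * K)"
    and "j = Suc i \<Longrightarrow> weight_coeff q N i = theta_coeff q i * P * (1 - q ^ (N + 1 + j)) * (1 - q ^ (N + 2 + j)) / (M * K)"
proof -
  have nz: "qp q n \<noteq> 0" for n using qp_pos[OF q, of n] by simp
  have f: "1 - q ^ Suc n \<noteq> 0" for n using nz[of "Suc n"] by (auto simp: qp_Suc simp del: power_Suc)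
  have M: "qp q (N - j) = M / (1 - q ^ (a + 1))" using f[of a] N by (simp add: M_def qp_Suc)
  have K: "qp q (N + 1 + j) = K / (1 - q ^ (N + 2 + j))" using f[of "N + 1 + j"] by (simp add: K_def qp_Suc del: power_Suc)
  show "weight_coeff q N j = theta_coeff q j * P * (1 - q ^ (a + 1)) * (1 - q ^ (N + 2 + j)) / (M * K)"
  proof -
    have "weight_coeff q N j = theta_coeff q j * P / (qp q (N - j) * qp q (N + 1 + j))"
      using N by (simp add: weight_coeff_def P_def)
    then show ?thesis unfolding M K by simp
  qed
  have P: "qp q (2 * Suc N + 1) = P * (1 - q ^ (2 * N + 2)) * (1 - q ^ (2 * N + 3))"
    by (simp add: P_def qp_Suc eval_nat_numeral)
  show "weight_coeff q (Suc N) j = theta_coeff q j * P * (1 - q ^ (2 * N + 2)) * (1 - q ^ (2 * N + 3)) / (M * K)"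
  proof -
    have "weight_coeff q (Suc N) j = theta_coeff q j * qp q (2 * Suc N + 1) / (M * K)"
      using N by (simp add: weight_coeff_def M_def K_def)
    then show ?thesis unfolding P by (simp only: mult.assoc)
  qed
  show "weight_coeff q N (Suc j) = - theta_coeff q j * P * q ^ Suc j * (1 - q ^ a) * (1 - q ^ (a + 1)) / (M * K)"
  proof (cases a)
    case 0
    then show ?thesis using N by (simp add: weight_coeff_def)
  next
    case (Suc b)
    have "M = qp q (N - Suc j) * (1 - q ^ a) * (1 - q ^ (a + 1))" using N Suc by (simp add: M_def qp_Suc)
    moreover have "1 - q ^ a \<noteq> 0" "1 - q ^ (a + 1) \<noteq> 0" using f[of b] f[of a] Suc by simp_all
    moreover have "weight_coeff q N (Suc j) = theta_coeff q (Suc j) * P / (qp q (N - Suc j) * K)"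
      using N Suc by (simp add: weight_coeff_def P_def K_def)
    ultimately show ?thesis by simp
  qed
  assume j: "j = Suc i"
  have "K = qp q (N + 1 + i) * (1 - q ^ (N + 1 + j)) * (1 - q ^ (N + 2 + j))"
    using j by (simp add: K_def qp_Suc)
  moreover have "1 - q ^ (N + 1 + j) \<noteq> 0" "1 - q ^ (N + 2 + j) \<noteq> 0"
    using f[of "N + j"] f[of "N + 1 + j"] by simp_all
  moreover have "weight_coeff q N i = theta_coeff q i * P / (M * qp q (N + 1 + i))"
    using N j by (simp add: weight_coeff_def P_def M_def)
  ultimately show "weight_coeff q N i = theta_coeff q i * P * (1 - q ^ (N + 1 + j)) * (1 - q ^ (N + 2 + j)) / (M * K)"
    by simp
qed

lemma weight_coeff_rec_0:
  assumes q: "\<bar>q\<bar> < 1"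
  shows "weight_coeff q (Suc N) 0 = (1 + q ^ Suc N + (q ^ Suc N)\<^sup>2) * weight_coeff q N 0 - q ^ Suc N * weight_coeff q N 1"
proof -
  have N: "N = 0 + N" by simp
  note w = weight_coeff_frac(1-3)[OF q N]
  define M where "M = qp q (N + 1)"
  define K where "K = qp q (N + 2 + 0)"
  define P where "P = qp q (2 * N + 1)"
  define A where "A = q ^ N"
  have pw: "q ^ (2 * N + 2) = (q * A)\<^sup>2" "q ^ (2 * N + 3) = q * (q * A)\<^sup>2" "q ^ (N + 1) = q * A" "q ^ (N + 2 + 0) = q * (q * A)" "q ^ N = A" "q ^ Suc N = q * A" "q ^ Suc 0 = q"
    "theta_coeff q 0 = 1"
    by (simp_all add: A_def power_add power_mult power2_eq_square power_mult_distrib eval_nat_numeral)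
  have e: "1 * P * (1 - (q * A)\<^sup>2) * (1 - q * (q * A)\<^sup>2) =
     (1 + q * A + (q * A)\<^sup>2) * (1 * P * (1 - q * A) * (1 - q * (q * A))) - q * A * (- 1 * P * q * (1 - A) * (1 - q * A))"
    by algebra
  have "weight_coeff q N 1 = weight_coeff q N (Suc 0)" by simp
  then show ?thesis
    unfolding w pw M_def[symmetric] K_def[symmetric] P_def[symmetric]
    by (simp only: times_divide_eq_right diff_divide_distrib[symmetric] add_divide_distrib[symmetric] e)
qed

lemma weight_coeff_rec_Suc:
  assumes q: "\<bar>q\<bar> < 1"
  shows "weight_coeff q (Suc N) (Suc i) = (1 + (q ^ Suc N)\<^sup>2) * weight_coeff q N (Suc i)
    - q ^ Suc N * (weight_coeff q N i + weight_coeff q N (Suc (Suc i)))"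
proof -
  consider "Suc i \<le> N" | "i = N" | "i > N" by linarith
  then show ?thesis
  proof cases
    case 1
    then obtain a where N: "N = Suc i + a" using le_Suc_ex by blast
    note w = weight_coeff_frac[OF q N]
    define M where "M = qp q (a + 1)"
    define K where "K = qp q (N + 2 + Suc i)"
    define P where "P = qp q (2 * N + 1)"
    define T where "T = theta_coeff q i"
    define A where "A = q ^ a" define J where "J = q ^ Suc i"
    have NJ: "q ^ N = J * A" by (simp add: N J_def A_def power_add)
    have pw: "q ^ (2 * N + 2) = (q * (J * A))\<^sup>2" "q ^ (2 * N + 3) = q * (q * (J * A))\<^sup>2" "q ^ (a + 1) = q * A"
      "q ^ (N + 2 + Suc i) = q * (q * (J * A)) * J" "q ^ (N + 1 + Suc i) = q * (J * A) * J"
      "q ^ Suc (Suc i) = q * J" "q ^ Suc N = q * (J * A)"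
      "theta_coeff q (Suc i) = - T * J"
      by (simp_all add: NJ[symmetric] power_add power_mult power2_eq_square eval_nat_numeral T_def)
         (simp_all add: J_def A_def power_add power_mult_distrib[symmetric] mult_ac)
    have e: "- T * J * P * (1 - (q * (J * A))\<^sup>2) * (1 - q * (q * (J * A))\<^sup>2) =
       (1 + (q * (J * A))\<^sup>2) * (- T * J * P * (1 - q * A) * (1 - q * (q * (J * A)) * J)) -
       q * (J * A) * (T * P * (1 - q * (J * A) * J) * (1 - q * (q * (J * A)) * J)
         + - (- T * J) * P * (q * J) * (1 - A) * (1 - q * A))"
      by algebra
    show ?thesis
      unfolding w(1-3) w(4)[OF refl] M_def[symmetric] K_def[symmetric] P_def[symmetric] pw A_def[symmetric] T_def[symmetric]
      by (simp only: times_divide_eq_right diff_divide_distrib[symmetric] add_divide_distrib[symmetric] e)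
  next
    case 2
    have z: "weight_coeff q N (Suc i) = 0" "weight_coeff q N (Suc (Suc i)) = 0"
      using 2 by (simp_all add: weight_coeff_def)
    have nz: "qp q n \<noteq> 0" for n using qp_pos[OF q, of n] by simp
    have "weight_coeff q (Suc N) (Suc i) = theta_coeff q (Suc N)"
      "weight_coeff q N i = theta_coeff q N"
      using 2 nz[of "2 * N + 1"] nz[of "2 * Suc N + 1"]
      by (simp_all add: weight_coeff_def mult_2)
    then show ?thesis unfolding z by simp
  next
    case 3
    then show ?thesis by (simp add: weight_coeff_def)
  qed
qed

lemma weight_coeff_LIMSEQ:
  assumes q: "\<bar>q\<bar> < 1"
  shows "(\<lambda>N. weight_coeff q N j) \<longlonglongrightarrow> theta_coeff q j / qpoch_inf q q"
proof -
  note nz = qpoch_nonzero[OF q q]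
  have "(\<lambda>N. qp q (2 * N + 1)) \<longlonglongrightarrow> qpoch_inf q q"
    by (rule LIMSEQ_subseq_LIMSEQ[OF qp_LIMSEQ[OF q], of "\<lambda>N. 2 * N + 1", unfolded o_def])
       (simp add: strict_mono_def)
  moreover have "(\<lambda>N. qp q (N + (1 + j + j))) \<longlonglongrightarrow> qpoch_inf q q"
    by (rule LIMSEQ_ignore_initial_segment[OF qp_LIMSEQ[OF q]])
  moreover have "(\<lambda>N. qp q (2 * (N + j) + 1)) \<longlonglongrightarrow> qpoch_inf q q"
    by (rule LIMSEQ_subseq_LIMSEQ[OF qp_LIMSEQ[OF q], of "\<lambda>N. 2 * (N + j) + 1", unfolded o_def])
       (simp add: strict_mono_def)
  ultimately have "(\<lambda>N. theta_coeff q j * qp q (2 * (N + j) + 1) / (qp q N * qp q (N + (1 + j + j))))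
      \<longlonglongrightarrow> theta_coeff q j * qpoch_inf q q / (qpoch_inf q q * qpoch_inf q q)"
    using nz qp_LIMSEQ[OF q] by (intro tendsto_intros) auto
  then have "(\<lambda>N. weight_coeff q (N + j) j) \<longlonglongrightarrow> theta_coeff q j / qpoch_inf q q"
    using nz by (simp add: weight_coeff_def add_ac)
  then show ?thesis by (rule LIMSEQ_offset)
qed

text \<open>The hypotheses describe how one more factor of the weight, which is linear in \<open>X\<^sup>2\<close>, acts on the Chebyshev
  moments, via \<open>X\<^sup>2 U\<^sub>m = U\<^sub>m\<^sub>+\<^sub>2 + 2 U\<^sub>m + U\<^sub>m\<^sub>-\<^sub>2\<close>; at \<open>m = 0\<close> and \<open>m = 1\<close> the lower terms change.\<close>

lemma chebyshev_functional:
  fixes L :: "nat \<Rightarrow> nat \<Rightarrow> real"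
  assumes q: "\<bar>q\<bar> < 1"
    and L0: "\<And>m. L 0 m = (if m = 0 then 1 else 0)"
    and L_0: "\<And>N. L (Suc N) 0 = (1 + q ^ Suc N + (q ^ Suc N)\<^sup>2) * L N 0 - q ^ Suc N * L N 2"
    and L_1: "\<And>N. L (Suc N) 1 = (1 + (q ^ Suc N)\<^sup>2) * L N 1 - q ^ Suc N * L N 3"
    and L_2: "\<And>N m. L (Suc N) (m + 2) = (1 + (q ^ Suc N)\<^sup>2) * L N (m + 2) - q ^ Suc N * (L N m + L N (m + 4))"
  shows "L N (2 * j) = weight_coeff q N j" "L N (2 * j + 1) = 0"
proof -
  have "L N (2 * j) = weight_coeff q N j \<and> L N (2 * j + 1) = 0" for j
  proof (induction N arbitrary: j)
    case 0
    have "qp q (Suc 0) \<noteq> 0" using qp_pos[OF q, of "Suc 0"] by simp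
    then show ?case by (auto simp: L0 weight_coeff_def)
  next
    case (Suc N)
    show ?case
    proof (cases j)
      case 0
      then show ?thesis
        using L_0[of N] L_1[of N] Suc[of 0] Suc[of 1] weight_coeff_rec_0[OF q, of N] by (simp add: eval_nat_numeral)
    next
      case (Suc i)
      have e: "2 * i + 2 = 2 * Suc i" "2 * i + 4 = 2 * Suc (Suc i)"
        "2 * i + 1 + 2 = 2 * Suc i + 1" "2 * i + 1 + 4 = 2 * Suc (Suc i) + 1"
        by simp_all
      have "L (Suc N) (2 * Suc i) = weight_coeff q (Suc N) (Suc i)"
        using L_2[of N "2 * i"] unfolding e by (simp only: Suc.IH weight_coeff_rec_Suc[OF q])
      moreover have "L (Suc N) (2 * Suc i + 1) = 0"
        using L_2[of N "2 * i + 1"] unfolding e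
        by (simp only: Suc.IH mult_zero_right add_0_left diff_self)
      ultimately show ?thesis using Suc by blast
    qed
  qed
  then show "L N (2 * j) = weight_coeff q N j" "L N (2 * j + 1) = 0" by blast+
qed

section \<open>Orthogonality of the q-Hermite polynomials\<close>

lemma qsupp_interval: "q < 1 \<Longrightarrow> qsupp q = {- 2 / sqrt (1 - q)..2 / sqrt (1 - q)}"
  by (simp add: qsupp_def)

lemma qsupp_scaled:
  assumes "q < 1" "x \<in> qsupp q"
  shows "\<bar>sqrt (1 - q) * x\<bar> \<le> 2" and "0 \<le> (1 - q) * x\<^sup>2" "(1 - q) * x\<^sup>2 \<le> 4"
proof -
  have s: "sqrt (1 - q) > 0" using assms by simp
  have "- 2 \<le> sqrt (1 - q) * x" "sqrt (1 - q) * x \<le> 2"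
    using assms(2) s unfolding qsupp_interval[OF assms(1)] by (simp_all add: field_simps)
  then show 1: "\<bar>sqrt (1 - q) * x\<bar> \<le> 2" by linarith
  have "(sqrt (1 - q) * x)\<^sup>2 \<le> 2\<^sup>2" using 1 by (metis abs_le_square_iff abs_numeral)
  then show "(1 - q) * x\<^sup>2 \<le> 4" using assms by (simp add: power_mult_distrib)
  show "0 \<le> (1 - q) * x\<^sup>2" using assms by simp
qed

definition weight_prod :: "real \<Rightarrow> nat \<Rightarrow> real \<Rightarrow> real" where
  "weight_prod q N x = (\<Prod>k<N. (1 + q ^ Suc k)\<^sup>2 - (1 - q) * x\<^sup>2 * q ^ Suc k)"

lemma weight_factor_bounds:
  assumes q: "\<bar>q\<bar> < 1" and x: "x \<in> qsupp q"
  shows "0 \<le> (1 + q ^ Suc k)\<^sup>2 - (1 - q) * x\<^sup>2 * q ^ Suc k"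
    and "\<bar>(1 + q ^ Suc k)\<^sup>2 - (1 - q) * x\<^sup>2 * q ^ Suc k - 1\<bar> \<le> 7 * \<bar>q\<bar> ^ Suc k"
proof -
  define p where "p = q ^ Suc k"
  define Y where "Y = (1 - q) * x\<^sup>2"
  have Y: "0 \<le> Y" "Y \<le> 4" using qsupp_scaled(2,3)[OF _ x] q by (auto simp: Y_def)
  have p1: "\<bar>p\<bar> \<le> 1" unfolding p_def power_abs using q by (intro power_le_one) auto
  have Yp: "\<bar>Y * p\<bar> \<le> 4 * \<bar>p\<bar>" unfolding abs_mult using Y by (intro mult_right_mono) auto
  have pp: "p * p \<le> \<bar>p\<bar>" using p1 by (metis abs_ge_zero abs_mult_self_eq mult_left_le)
  have "(1 + p)\<^sup>2 - Y * p - 1 = 2 * p + p * p - Y * p" by (simp add: power2_eq_square algebra_simps)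
  moreover have "0 \<le> p * p" by simp
  ultimately have "\<bar>(1 + p)\<^sup>2 - Y * p - 1\<bar> \<le> 7 * \<bar>p\<bar>" using Yp pp by linarith
  then show "\<bar>(1 + q ^ Suc k)\<^sup>2 - (1 - q) * x\<^sup>2 * q ^ Suc k - 1\<bar> \<le> 7 * \<bar>q\<bar> ^ Suc k"
    by (simp only: p_def Y_def power_abs)
  have "0 \<le> (1 + p)\<^sup>2 - Y * p"
  proof (cases "p \<ge> 0")
    case True
    have "Y * p \<le> 4 * p" using True Y by (intro mult_right_mono) auto
    moreover have "(1 + p)\<^sup>2 - 4 * p = (1 - p)\<^sup>2" by (simp add: power2_eq_square algebra_simps)
    ultimately show ?thesis by (smt (verit) zero_le_power2)
  next
    case False
    then have "Y * p \<le> 0" using Y by (simp add: mult_nonneg_nonpos)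
    then show ?thesis by (smt (verit) zero_le_power2)
  qed
  then show "0 \<le> (1 + q ^ Suc k)\<^sup>2 - (1 - q) * x\<^sup>2 * q ^ Suc k" by (simp only: p_def Y_def)
qed

lemma summable_geometric_Suc: "\<bar>q\<bar> < 1 \<Longrightarrow> summable (\<lambda>k. (c::real) * \<bar>q\<bar> ^ Suc k)"
  by (intro summable_mult) (simp add: summable_Suc_iff summable_geometric del: power_Suc)

lemma weight_prod_bounds:
  assumes q: "\<bar>q\<bar> < 1" and x: "x \<in> qsupp q"
  shows "0 \<le> weight_prod q N x" "weight_prod q N x \<le> exp (\<Sum>k. 7 * \<bar>q\<bar> ^ Suc k)"
proof -
  show "0 \<le> weight_prod q N x"
    unfolding weight_prod_def by (intro prod_nonneg ballI weight_factor_bounds q x)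
  have "weight_prod q N x \<le> (\<Prod>k<N. exp (7 * \<bar>q\<bar> ^ Suc k))"
    unfolding weight_prod_def
  proof (rule prod_mono, rule conjI)
    fix k
    show "0 \<le> (1 + q ^ Suc k)\<^sup>2 - (1 - q) * x\<^sup>2 * q ^ Suc k" by (rule weight_factor_bounds[OF q x])
    show "(1 + q ^ Suc k)\<^sup>2 - (1 - q) * x\<^sup>2 * q ^ Suc k \<le> exp (7 * \<bar>q\<bar> ^ Suc k)"
      using weight_factor_bounds(2)[OF q x, of k] exp_ge_add_one_self[of "7 * \<bar>q\<bar> ^ Suc k"] by linarith
  qed
  also have "\<dots> = exp (\<Sum>k<N. 7 * \<bar>q\<bar> ^ Suc k)" by (simp only: exp_sum finite_lessThan)
  also have "\<dots> \<le> exp (\<Sum>k. 7 * \<bar>q\<bar> ^ Suc k)"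
    using sum_le_suminf[OF summable_geometric_Suc[OF q, of 7], of "{..<N}"] by simp
  finally show "weight_prod q N x \<le> exp (\<Sum>k. 7 * \<bar>q\<bar> ^ Suc k)" .
qed

lemma weight_prod_LIMSEQ:
  assumes q: "\<bar>q\<bar> < 1" and x: "x \<in> qsupp q"
  shows "(\<lambda>N. weight_prod q N x) \<longlonglongrightarrow> (\<Prod>k. (1 + q ^ Suc k)\<^sup>2 - (1 - q) * x\<^sup>2 * q ^ Suc k)"
proof -
  have "summable (\<lambda>k. norm ((1 + q ^ Suc k)\<^sup>2 - (1 - q) * x\<^sup>2 * q ^ Suc k - 1))"
    by (rule summable_comparison_test_ev[OF always_eventually summable_geometric_Suc[OF q, of 7]])
       (use weight_factor_bounds(2)[OF q x] in simp)
  then have "convergent_prod (\<lambda>k. (1 + q ^ Suc k)\<^sup>2 - (1 - q) * x\<^sup>2 * q ^ Suc k)"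
    using abs_convergent_prod_conv_summable abs_convergent_prod_imp_convergent_prod by blast
  from convergent_prod_LIMSEQ[OF this] show ?thesis
    unfolding weight_prod_def lessThan_Suc_atMost[symmetric] by (rule LIMSEQ_imp_Suc)
qed

definition qweight :: "real \<Rightarrow> real \<Rightarrow> real" where
  "qweight q x = indicator (qsupp q) x * fN q x"

lemma set_integral_lincomb3:
  fixes f g h :: "real \<Rightarrow> real"
  assumes "set_integrable M A f" "set_integrable M A g" "set_integrable M A h"
  shows "(LINT x:A|M. a * f x + b * g x + c * h x)
    = a * (LINT x:A|M. f x) + b * (LINT x:A|M. g x) + c * (LINT x:A|M. h x)"
  using assms by (simp add: set_integral_add set_integrable_mult_right)

lemma integral_lincomb2:
  fixes f g :: "'a \<Rightarrow> real"
  assumes "integrable M f" "integrable M g"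
  shows "integral\<^sup>L M f + c * integral\<^sup>L M g = (LINT x|M. f x + c * g x)"
  using assms by simp

lemma weight_moment_rec:
  fixes q :: real
  assumes q: "\<bar>q\<bar> < 1"
  defines "L \<equiv> \<lambda>N m. sqrt (1 - q) / (2 * pi) *
     (LINT x:qsupp q|lborel. hq 0 m (sqrt (1 - q) * x) * sqrt (4 - (1 - q) * x\<^sup>2) * weight_prod q N x)"
  shows "L N (2 * j) = weight_coeff q N j" "L N (2 * j + 1) = 0"
proof -
  define s where "s = sqrt (1 - q)"
  have s: "s > 0" "s\<^sup>2 = 1 - q" using q by (auto simp: s_def)
  have q1: "q < 1" using q by simp
  define g where "g N m x = hq 0 m (s * x) * sqrt (4 - (1 - q) * x\<^sup>2) * weight_prod q N x" for N m x
  have S: "qsupp q = {- 2 / s..2 / s}" unfolding s_def by (rule qsupp_interval[OF q1])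
  have int: "set_integrable lborel (qsupp q) (g N m)" for N m
    unfolding S g_def[abs_def] weight_prod_def
    by (intro borel_integrable_atLeastAtMost' continuous_intros)
  have L: "L N m = s / (2 * pi) * (LINT x:qsupp q|lborel. g N m x)" for N m
    by (simp add: L_def g_def s_def)
  have lin: "L (Suc N) m = a * L N i + b * L N j + c * L N k"
    if "\<And>x. g (Suc N) m x = a * g N i x + b * g N j x + c * g N k x" for N m i j k a b c
    unfolding L that set_integral_lincomb3[OF int int int] by (simp add: algebra_simps)
  have gS: "g (Suc N) m x = ((1 + q ^ Suc N)\<^sup>2 * hq 0 m (s * x) - q ^ Suc N * ((s * x) * ((s * x) * hq 0 m (s * x))))
      * (sqrt (4 - (1 - q) * x\<^sup>2) * weight_prod q N x)" for N m x
    unfolding g_def weight_prod_def s(2)[symmetric] by (simp add: algebra_simps power2_eq_square)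
  have gR: "g N m x = hq 0 m (s * x) * (sqrt (4 - (1 - q) * x\<^sup>2) * weight_prod q N x)" for N m x
    by (simp add: g_def)
  have XU: "X * hq 0 0 X = hq 0 1 X" "X * hq 0 1 X = hq 0 2 X + hq 0 0 X" "X * hq 0 (Suc (Suc m)) X = hq 0 (m + 3) X + hq 0 (m + 1) X"
    "X * hq 0 (Suc m) X = hq 0 (m + 2) X + hq 0 m X" for X m
    by (simp_all add: eval_nat_numeral)
  have X3: "X * hq 0 (m + 3) X = hq 0 (m + 4) X + hq 0 (m + 2) X" for X m
    by (simp add: eval_nat_numeral)
  have L0: "L 0 m = (if m = 0 then 1 else 0)" for m
    using semicircle_integral[OF s(1), of m] s
    unfolding L g_def S by (simp add: weight_prod_def power_mult_distrib)
  have L_0: "L (Suc N) 0 = (1 + q ^ Suc N + (q ^ Suc N)\<^sup>2) * L N 0 - q ^ Suc N * L N 2" for N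
  proof -
    have "L (Suc N) 0 = (1 + q ^ Suc N + (q ^ Suc N)\<^sup>2) * L N 0 + (- (q ^ Suc N)) * L N 2 + 0 * L N 0"
      by (rule lin, unfold gS XU, unfold g_def, simp only: hq.simps) (simp add: algebra_simps power2_eq_square)
    then show ?thesis by simp
  qed
  have L_1: "L (Suc N) 1 = (1 + (q ^ Suc N)\<^sup>2) * L N 1 - q ^ Suc N * L N 3" for N
  proof -
    have "X * (X * hq 0 1 X) = hq 0 3 X + 2 * hq 0 1 X" for X by (simp add: eval_nat_numeral algebra_simps)
    note e = this[of "s * x" for x]
    have alg: "((1 + Q)\<^sup>2 * h1 - Q * (h3 + 2 * h1)) * R = (1 + Q\<^sup>2) * (h1 * R) + - Q * (h3 * R) + 0 * (h0 * R)"
      for Q h1 h3 R h0 :: real by algebra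
    have "L (Suc N) 1 = (1 + (q ^ Suc N)\<^sup>2) * L N 1 + (- (q ^ Suc N)) * L N 3 + 0 * L N 0"
      by (rule lin) (subst gS, unfold e gR, rule alg)
    then show ?thesis by simp
  qed
  have L_2: "L (Suc N) (m + 2) = (1 + (q ^ Suc N)\<^sup>2) * L N (m + 2) - q ^ Suc N * (L N m + L N (m + 4))" for N m
  proof -
    have "X * (X * hq 0 (m + 2) X) = hq 0 (m + 4) X + 2 * hq 0 (m + 2) X + hq 0 m X" for X
    proof -
      have "X * hq 0 (m + 2) X = hq 0 (m + 3) X + hq 0 (m + 1) X" using XU(3)[of X m] by simp
      moreover have "X * hq 0 (m + 1) X = hq 0 (m + 2) X + hq 0 m X" using XU(4)[of X m] by simp
      ultimately show ?thesis using X3[of X m] by (simp add: distrib_left del: hq.simps)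
    qed
    note e = this[of "s * x" for x]
    have alg: "((1 + Q)\<^sup>2 * h1 - Q * (h3 + 2 * h1 + h0)) * R = (1 + Q\<^sup>2) * (h1 * R) + - Q * (h0 * R) + - Q * (h3 * R)"
      for Q h1 h3 R h0 :: real by algebra
    have "L (Suc N) (m + 2) = (1 + (q ^ Suc N)\<^sup>2) * L N (m + 2) + (- (q ^ Suc N)) * L N m + (- (q ^ Suc N)) * L N (m + 4)"
      by (rule lin) (subst gS, unfold e gR, rule alg)
    then show ?thesis by (simp add: algebra_simps)
  qed
  show "L N (2 * j) = weight_coeff q N j" "L N (2 * j + 1) = 0"
    by (rule chebyshev_functional[of q L, OF q L0 L_0 L_1 L_2])+
qed

text \<open>Dominated convergence transfers the moments of the truncated weights to the infinite product.\<close>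

lemma qweight_chebyshev:
  assumes q: "\<bar>q\<bar> < 1"
  shows "has_bochner_integral lborel (\<lambda>x. qweight q x * hq 0 m (sqrt (1 - q) * x))
     (if even m then theta_coeff q (m div 2) else 0)"
proof -
  define s where "s = sqrt (1 - q)"
  have q1: "q < 1" using q by simp
  have sp: "s > 0" using q1 by (simp add: s_def)
  define w where "w x = (\<Prod>k. (1 + q ^ Suc k)\<^sup>2 - (1 - q) * x\<^sup>2 * q ^ Suc k)" for x
  define g where "g N x = hq 0 m (s * x) * sqrt (4 - (1 - q) * x\<^sup>2) * weight_prod q N x" for N x
  define f where "f x = indicator (qsupp q) x * (hq 0 m (s * x) * sqrt (4 - (1 - q) * x\<^sup>2) * w x)" for x
  define E where "E = exp (\<Sum>k. 7 * \<bar>q\<bar> ^ Suc k)"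
  obtain C where C: "C > 0" "\<And>n X. \<bar>X\<bar> \<le> 2 \<Longrightarrow> \<bar>hq 0 n X\<bar> \<le> C * real (Suc n)"
    using hq_bound[of 0] by auto
  have S: "qsupp q = {- 2 / s..2 / s}" unfolding s_def by (rule qsupp_interval[OF q1])
  have cont: "continuous_on A (g N)" for N A
    unfolding g_def[abs_def] weight_prod_def by (intro continuous_intros)
  have meas: "(\<lambda>x. indicator (qsupp q) x * g N x) \<in> borel_measurable lborel" for N
    unfolding S using borel_measurable_continuous_onI[OF cont] by measurable
  have lim: "(\<lambda>N. indicator (qsupp q) x * g N x) \<longlonglongrightarrow> f x" for x
  proof (cases "x \<in> qsupp q")
    case True
    show ?thesis unfolding f_def g_def w_def
      by (intro tendsto_mult_left weight_prod_LIMSEQ[OF q True])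
  qed (simp add: f_def)
  have measf: "f \<in> borel_measurable lborel"
    by (rule borel_measurable_LIMSEQ_real[OF lim meas])
  have bnd: "norm (indicator (qsupp q) x * g N x) \<le> indicator (qsupp q) x * (C * real (Suc m) * 2 * E)" for N x
  proof (cases "x \<in> qsupp q")
    case True
    note b = qsupp_scaled[OF q1 True]
    have "\<bar>g N x\<bar> = \<bar>hq 0 m (s * x)\<bar> * \<bar>sqrt (4 - (1 - q) * x\<^sup>2)\<bar> * \<bar>weight_prod q N x\<bar>"
      by (simp add: g_def abs_mult)
    also have "\<dots> \<le> (C * real (Suc m)) * 2 * E"
    proof (intro mult_mono)
      show "\<bar>hq 0 m (s * x)\<bar> \<le> C * real (Suc m)" by (rule C(2)) (use b in \<open>simp add: s_def\<close>)
      show "\<bar>sqrt (4 - (1 - q) * x\<^sup>2)\<bar> \<le> 2"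
        using b real_sqrt_le_mono[of "4 - (1 - q) * x\<^sup>2" 4] by simp
      show "\<bar>weight_prod q N x\<bar> \<le> E" using weight_prod_bounds[OF q True, of N] by (simp add: E_def)
    qed (use C in auto)
    finally show ?thesis using True by simp
  qed simp
  have int: "integrable lborel (\<lambda>x. indicator (qsupp q) x * (C * real (Suc m) * 2 * E))"
    unfolding S by (intro integrable_mult_left integrable_real_indicator) (auto simp: emeasure_lborel_Icc_eq)
  have If: "integrable lborel f"
    by (rule integrable_dominated_convergence[where s = "\<lambda>N x. indicator (qsupp q) x * g N x", OF measf meas int]) (intro AE_I2 lim bnd)+
  have "(\<lambda>N. LINT x|lborel. indicator (qsupp q) x * g N x) \<longlonglongrightarrow> integral\<^sup>L lborel f"
    by (rule integral_dominated_convergence[where s = "\<lambda>N x. indicator (qsupp q) x * g N x", OF measf meas int]) (intro AE_I2 lim bnd)+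
  then have "(\<lambda>N. s / (2 * pi) * (LINT x|lborel. indicator (qsupp q) x * g N x)) \<longlonglongrightarrow> s / (2 * pi) * integral\<^sup>L lborel f"
    by (rule tendsto_mult_left)
  moreover have "s / (2 * pi) * (LINT x|lborel. indicator (qsupp q) x * g N x) = (if even m then weight_coeff q N (m div 2) else 0)" for N
    using weight_moment_rec[OF q, where N = N and j = "m div 2"]
    by (auto simp: g_def s_def set_lebesgue_integral_def elim!: evenE oddE)
  ultimately have 1: "(\<lambda>N. if even m then weight_coeff q N (m div 2) else 0) \<longlonglongrightarrow> s / (2 * pi) * integral\<^sup>L lborel f"
    by simp
  have "(\<lambda>N. if even m then weight_coeff q N (m div 2) else 0) \<longlonglongrightarrow> (if even m then theta_coeff q (m div 2) / qpoch_inf q q else 0)"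
    using weight_coeff_LIMSEQ[OF q] by auto
  from LIMSEQ_unique[OF 1 this]
  have 2: "qpoch_inf q q * (s / (2 * pi) * integral\<^sup>L lborel f) = (if even m then theta_coeff q (m div 2) else 0)"
    using qpoch_nonzero[OF q q] by auto
  have "has_bochner_integral lborel (\<lambda>x. qpoch_inf q q * (s / (2 * pi)) * f x) (qpoch_inf q q * (s / (2 * pi)) * integral\<^sup>L lborel f)"
    by (intro has_bochner_integral_mult_right has_bochner_integral_integrable If)
  moreover have "qweight q x * hq 0 m (sqrt (1 - q) * x) = qpoch_inf q q * (s / (2 * pi)) * f x" for x
    using q1 by (simp add: qweight_def fN_def f_def w_def s_def)
  ultimately show ?thesis using 2 by (simp add: mult.assoc)
qed

lemma integrable_qweight:
  assumes q: "\<bar>q\<bar> < 1" and p: "continuous_on UNIV p"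
  shows "integrable lborel (\<lambda>x. qweight q x * p x)"
proof -
  have int1: "integrable lborel (qweight q)"
    using qweight_chebyshev[OF q, of 0]
    by (simp add: has_bochner_integral_iff)
  have "compact (p ` qsupp q)"
    using q by (intro compact_continuous_image continuous_on_subset[OF p]) (auto simp: qsupp_interval)
  from compact_imp_bounded[OF this]
  obtain K where "\<forall>y\<in>p ` qsupp q. norm y \<le> K" unfolding bounded_iff by blast
  then have K: "\<bar>p x\<bar> \<le> K" if "x \<in> qsupp q" for x using that by simp
  have "integrable lborel (\<lambda>x. K * qweight q x)" using int1 by simp
  then show ?thesis
  proof (rule Bochner_Integration.integrable_bound)
    show "(\<lambda>x. qweight q x * p x) \<in> borel_measurable lborel"
      using int1 borel_measurable_continuous_onI[OF p] by (intro borel_measurable_times) auto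
    show "AE x in lborel. norm (qweight q x * p x) \<le> norm (K * qweight q x)"
    proof (intro always_eventually allI)
      fix x
      show "norm (qweight q x * p x) \<le> norm (K * qweight q x)"
      proof (cases "x \<in> qsupp q")
        case True
        from K[OF this] have "\<bar>p x\<bar> \<le> \<bar>K\<bar>" by linarith
        then show ?thesis by (simp add: abs_mult mult.commute mult_right_mono)
      qed (simp add: qweight_def)
    qed
  qed
qed

text \<open>Here \<open>G n m\<close> stands for the integral of \<open>h\<^sub>n U\<^sub>m\<close> against the weight.  Expanding \<open>X h\<^sub>n U\<^sub>m\<close> in two ways lowers
  the first index at the cost of the second, and the resulting closed form vanishes for \<open>m < n\<close>.\<close>

lemma theta_recurrence:
  fixes G :: "nat \<Rightarrow> nat \<Rightarrow> real"
  assumes q: "\<bar>q\<bar> < 1"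
    and G0: "\<And>m. G 0 m = (if even m then theta_coeff q (m div 2) else 0)"
    and rec: "\<And>n m. G (Suc n) m + (1 - q ^ n) * G (n - 1) m = G n (Suc m) + (1 - 0 ^ m) * G n (m - 1)"
  shows "G n 0 = (if n = 0 then 1 else 0)"
proof -
  have nz: "qp q n \<noteq> 0" for n using qp_pos[OF q, of n] by simp
  have f: "1 - q ^ Suc n \<noteq> 0" for n using nz[of "Suc n"] by (auto simp: qp_Suc simp del: power_Suc)
  have "(\<forall>m. G n m = (if m < n \<or> odd (m - n) then 0 else theta_coeff q ((m - n) div 2) * qp q (n + (m - n) div 2) / qp q ((m - n) div 2)))"
  proof (induction n rule: less_induct)
    case (less n)
    show ?case
    proof (cases n)
      case 0
      then show ?thesis using G0 nz by simp
    next
      case (Suc p)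
      define g where "g n m = (if m < n \<or> odd (m - n) then 0 else theta_coeff q ((m - n) div 2) * qp q (n + (m - n) div 2) / qp q ((m - n) div 2))" for n m
      have IH: "G p m = g p m" for m using less[of p] Suc by (simp add: g_def)
      have IH': "(1 - q ^ p) * G (p - 1) m = (if p = 0 then 0 else (1 - q ^ p) * g (p - 1) m)" for m
        using less[of "p - 1"] Suc by (cases p) (simp_all add: g_def)
      have G: "G n m = g p (Suc m) + (1 - 0 ^ m) * g p (m - 1) - (if p = 0 then 0 else (1 - q ^ p) * g (p - 1) m)" for m
        using rec[of p m] unfolding IH IH' Suc by simp
      have gev: "g n (n + 2 * k) = theta_coeff q k * qp q (n + k) / qp q k" for n k by (simp add: g_def)
      have gz: "g n m = 0" if "m < n \<or> odd (m - n)" for n m using that by (auto simp: g_def)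
      have "G n m = g n m" for m
      proof -
        \<comment> \<open>\<open>m + 2 = n\<close> is the one case in which two nonzero terms cancel below the diagonal\<close>
        consider k where "m = n + 2 * k" | "m + 2 = n" | "m + 2 < n" | d where "n = m + 2 * d + 1" | d where "m = n + 2 * d + 1"
        proof -
          show thesis
          proof (cases "m < n")
            case True
            show thesis
            proof (cases "even (n - m)")
              case ev: True
              then obtain c where c: "n - m = 2 * c" by (elim evenE)
              then have "m + 2 = n \<or> m + 2 < n" using True by (cases "c = 1") auto
              then show thesis using that(2,3) by blast
            next
              case False
              then obtain d where "n - m = 2 * d + 1" by (elim oddE)
              then have "n = m + 2 * d + 1" using True by simp
              then show thesis by (rule that(4))
            qed
          next
            case False
            show thesis
            proof (cases "even (m - n)")
              case True
              then obtain c where "m - n = 2 * c" by (elim evenE)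
              then have "m = n + 2 * c" using False by simp
              then show thesis by (rule that(1))
            next
              case odd: False
              then obtain d where "m - n = 2 * d + 1" by (elim oddE)
              then have "m = n + 2 * d + 1" by simp
              then show thesis by (rule that(5))
            qed
          qed
        qed
        then show ?thesis
        proof cases
          case (1 k)
          have e: "Suc m = p + 2 * Suc k" "m - 1 = p + 2 * k" "m \<noteq> 0" using 1 Suc by simp_all
          have e': "m = (p - 1) + 2 * Suc k" if "p \<noteq> 0" using 1 Suc that by simp
          have l: "(if p = 0 then 0 else (1 - q ^ p) * g (p - 1) m) = (1 - q ^ p) * (theta_coeff q (Suc k) * qp q (p + k) / qp q (Suc k))"
            using gev[of "p - 1" "Suc k"] e' by (cases p) auto
          define P where "P = qp q (p + k)" define T where "T = theta_coeff q k"
          define M where "M = qp q (Suc k)"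
          define z where "z = q ^ Suc k" define y where "y = q ^ p"
          have pw: "qp q (p + Suc k) = P * (1 - y * z)" "theta_coeff q (Suc k) = - T * z" "qp q k = M / (1 - z)"
            "qp q (Suc p + k) = P * (1 - y * z)"
            using f[of k] by (simp_all add: P_def T_def M_def z_def y_def qp_Suc power_add mult_ac)
          have nz': "M \<noteq> 0" "1 - z \<noteq> 0" using nz f by (simp_all add: M_def z_def del: power_Suc)
          have "G n m = (- T * z) * (P * (1 - y * z)) / M + T * P / (M / (1 - z)) - (1 - y) * ((- T * z) * P / M)"
            unfolding G e(1,2) gev l unfolding pw P_def[symmetric] M_def[symmetric] T_def[symmetric] y_def[symmetric] using e(3) by simp
          also have "\<dots> = ((- T * z) * (P * (1 - y * z)) + T * P * (1 - z) - (1 - y) * ((- T * z) * P)) / M"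
            by (simp add: diff_divide_distrib add_divide_distrib)
          also have "(- T * z) * (P * (1 - y * z)) + T * P * (1 - z) - (1 - y) * ((- T * z) * P) = T * (P * (1 - y * z)) * (1 - z)"
            by algebra
          also have "\<dots> / M = g n m"
            unfolding 1 gev unfolding Suc pw T_def[symmetric] using nz' by simp
          finally show ?thesis .
        next
          case 2
          then have p: "p = Suc m" using Suc by simp
          have "g n m = 0" "g p (m - 1) = 0" using 2 p by (simp_all add: g_def)
          moreover have "g p (Suc m) = qp q p" "g (p - 1) m = qp q m" using p by (simp_all add: g_def)
          ultimately show ?thesis unfolding G using p by (simp add: qp_Suc)
        next
          case 3
          have "g n m = 0" "g p (Suc m) = 0" "g (p - 1) m = 0" "g p (m - 1) = 0"
            by (rule gz, rule disjI1, use 3 Suc in linarith)+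
          then show ?thesis unfolding G by simp
        next
          case (4 d)
          have p: "p = m + 2 * d" using 4 Suc by simp
          have "g n m = 0" by (rule gz) (simp add: 4)
          moreover have "g p (Suc m) = 0" by (rule gz) (cases d; simp add: p)
          moreover have "g (p - 1) m = 0" if "p \<noteq> 0"
            by (rule gz) (use p that in \<open>cases d; simp; arith?\<close>)
          moreover have "g p (m - 1) = 0" if "m \<noteq> 0" by (rule gz, rule disjI1) (use p that in simp)
          ultimately show ?thesis unfolding G by (cases "m = 0"; cases "p = 0") simp_all
        next
          case (5 d)
          have "g n m = 0" by (rule gz, rule disjI2) (simp add: 5)
          moreover have "g p (Suc m) = 0" by (rule gz, rule disjI2) (simp add: 5 Suc)
          moreover have "g (p - 1) m = 0" if "p \<noteq> 0"
            by (rule gz, rule disjI2) (use that in \<open>cases p; simp add: 5 Suc\<close>)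
          moreover have "g p (m - 1) = 0" by (rule gz, rule disjI2) (simp add: 5 Suc)
          ultimately show ?thesis unfolding G by (cases "p = 0") simp_all
        qed
      qed
      then show ?thesis by (simp add: g_def)
    qed
  qed
  then show ?thesis using nz[of 0] by simp
qed

text \<open>Favard's argument: a functional annihilating all \<open>H\<^sub>n\<close> with \<open>n > 0\<close> makes the \<open>H\<^sub>n\<close> orthogonal, since
  multiplication by \<open>x\<close> is symmetric.\<close>

lemma favard:
  fixes G :: "nat \<Rightarrow> nat \<Rightarrow> real"
  assumes G0: "\<And>n. G n 0 = (if n = 0 then 1 else 0)"
    and rec: "\<And>n m. G (Suc n) m + qnum q n * G (n - 1) m = G n (Suc m) + qnum q m * G n (m - 1)"
  shows "G n m = (if n = m then qfact q n else 0)"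
proof (induction m arbitrary: n rule: less_induct)
  case (less m)
  show ?case
  proof (cases m)
    case 0
    then show ?thesis by (simp only: G0) simp
  next
    case (Suc k)
    have "G n (Suc k) = G (Suc n) k + qnum q n * G (n - 1) k - qnum q k * G n (k - 1)"
      using rec[of n k] by linarith
    moreover have "G (Suc n) k = (if Suc n = k then qfact q (Suc n) else 0)"
      by (rule less) (simp add: Suc)
    moreover have "qnum q n * G (n - 1) k = (if n = Suc k then qfact q n else 0)"
    proof (cases n)
      case 0
      then show ?thesis by (simp add: qnum_def)
    next
      case (Suc p)
      have "G p k = (if p = k then qfact q p else 0)" by (rule less) (simp add: \<open>m = Suc k\<close>)
      then show ?thesis by (simp add: Suc qfact_Suc mult.commute)
    qed
    moreover have "qnum q k * G n (k - 1) = (if Suc n = k then qfact q (Suc n) else 0)"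
    proof (cases k)
      case 0
      then show ?thesis by (simp add: qnum_def)
    next
      case (Suc p)
      have "G n p = (if n = p then qfact q n else 0)" by (rule less) (simp add: \<open>m = Suc k\<close> Suc)
      then show ?thesis by (simp add: Suc qfact_Suc mult.commute)
    qed
    ultimately show ?thesis using \<open>m = Suc k\<close> by auto
  qed
qed

lemma continuous_on_qHermite [continuous_intros]:
  "continuous_on A f \<Longrightarrow> continuous_on A (\<lambda>x. qHermite q n (f x))"
  by (induction n rule: induct_nat_012) (auto intro!: continuous_intros)

lemma qHermite_orthogonalI:
  assumes int: "\<And>n m. integrable M (\<lambda>x. w x * (qHermite q n x * qHermite q m x))"
    and mean: "\<And>n. (LINT x|M. w x * qHermite q n x) = (if n = 0 then 1 else 0)"
  shows "has_bochner_integral M (\<lambda>x. w x * (qHermite q n x * qHermite q m x)) (if n = m then qfact q n else 0)"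
proof -
  define K where "K n m = (LINT x|M. w x * (qHermite q n x * qHermite q m x))" for n m
  have "K n m = (if n = m then qfact q n else 0)"
  proof (rule favard[of K q])
    show "K n 0 = (if n = 0 then 1 else 0)" for n
      using mean[of n] by (simp add: K_def)
    fix n m
    have "K (Suc n) m + qnum q n * K (n - 1) m = (LINT x|M. w x * ((x * qHermite q n x) * qHermite q m x))"
      unfolding K_def integral_lincomb2[OF int int]
      by (rule Bochner_Integration.integral_cong[OF refl], subst qHermite_rec) (simp only: ring_distribs mult_ac)
    also have "\<dots> = (LINT x|M. w x * (qHermite q n x * (x * qHermite q m x)))"
      by (simp add: mult_ac)
    also have "\<dots> = K n (Suc m) + qnum q m * K n (m - 1)"
      unfolding K_def integral_lincomb2[OF int int]
      by (rule Bochner_Integration.integral_cong[OF refl], subst qHermite_rec) (simp only: ring_distribs mult_ac)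
    finally show "K (Suc n) m + qnum q n * K (n - 1) m = K n (Suc m) + qnum q m * K n (m - 1)" .
  qed
  then show ?thesis using int[of n m] by (simp add: K_def has_bochner_integral_iff)
qed

theorem qHermite_orthogonal:
  assumes q: "\<bar>q\<bar> < 1"
  shows "has_bochner_integral lborel (\<lambda>x. qweight q x * (qHermite q n x * qHermite q m x))
     (if n = m then qfact q n else 0)"
proof -
  define s where "s = sqrt (1 - q)"
  have q1: "q < 1" using q by simp
  have sp: "s > 0" using q1 by (simp add: s_def)
  have int: "integrable lborel (\<lambda>x. qweight q x * (hq q n (s * x) * hq 0 m (s * x)))" for n m
    by (intro integrable_qweight q continuous_intros)
  have intH: "integrable lborel (\<lambda>x. qweight q x * (qHermite q n x * qHermite q m x))" for n m
    by (intro integrable_qweight q continuous_intros)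
  define G where "G n m = (LINT x|lborel. qweight q x * (hq q n (s * x) * hq 0 m (s * x)))" for n m
  have zero: "G n 0 = (if n = 0 then 1 else 0)" for n
  proof (rule theta_recurrence[OF q])
    show "G 0 m = (if even m then theta_coeff q (m div 2) else 0)" for m
      using qweight_chebyshev[OF q, of m] by (simp add: G_def s_def has_bochner_integral_iff)
    fix n m
    have "G (Suc n) m + (1 - q ^ n) * G (n - 1) m =
       (LINT x|lborel. qweight q x * ((s * x * hq q n (s * x)) * hq 0 m (s * x)))"
      unfolding G_def integral_lincomb2[OF int int]
      by (rule Bochner_Integration.integral_cong[OF refl], subst hq_rec) (simp only: ring_distribs mult_ac)
    also have "\<dots> = (LINT x|lborel. qweight q x * (hq q n (s * x) * (s * x * hq 0 m (s * x))))"
      by (simp add: mult_ac)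
    also have "\<dots> = G n (Suc m) + (1 - 0 ^ m) * G n (m - 1)"
      unfolding G_def integral_lincomb2[OF int int]
      by (rule Bochner_Integration.integral_cong[OF refl], subst hq_rec) (simp only: ring_distribs mult_ac)
    finally show "G (Suc n) m + (1 - q ^ n) * G (n - 1) m = G n (Suc m) + (1 - 0 ^ m) * G n (m - 1)" .
  qed
  have hH: "hq q n (s * x) = s ^ n * qHermite q n x" for n x
    unfolding s_def by (rule hq_qHermite[OF q1])
  have "(LINT x|lborel. qweight q x * qHermite q n x) = (if n = 0 then 1 else 0)" for n
  proof -
    have "G n 0 = (LINT x|lborel. s ^ n * (qweight q x * qHermite q n x))"
      unfolding G_def by (rule Bochner_Integration.integral_cong[OF refl], subst hH) (simp only: hq.simps mult_ac mult_1)
    then have "G n 0 = s ^ n * (LINT x|lborel. qweight q x * qHermite q n x)"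
      by (simp only: Bochner_Integration.integral_mult_right_zero)
    then show ?thesis using zero[of n] sp by (auto split: if_splits)
  qed
  with intH show ?thesis by (rule qHermite_orthogonalI)
qed

section \<open>The Poisson--Mehler formula\<close>

lemma v0_scale: "q \<le> 1 \<Longrightarrow> v0 x y t q = v0 (sqrt (1 - q) * x) (sqrt (1 - q) * y) t 0"
proof -
  assume "q \<le> 1"
  then have "sqrt (1 - q) * sqrt (1 - q) = 1 - q" by simp
  moreover have "sqrt (1 - q) * x * (sqrt (1 - q) * y) = (sqrt (1 - q) * sqrt (1 - q)) * (x * y)"
    by simp
  ultimately show ?thesis
    by (simp add: v0_def power2_eq_square) (simp add: algebra_simps)
qed

text \<open>After completing the square in \<open>X\<close>, both summands are nonnegative and they cannot vanish together.\<close>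

lemma v0_pos:
  assumes "\<bar>X\<bar> \<le> 2" "\<bar>Y\<bar> \<le> 2" "\<bar>t\<bar> < 1"
  shows "v0 X Y t 0 > 0"
proof -
  have eq: "v0 X Y t 0 = (t * X - (1 + t\<^sup>2) * Y / 2)\<^sup>2 + (1 - t\<^sup>2)\<^sup>2 * (1 - (Y / 2)\<^sup>2)"
    by (simp add: v0_def power2_eq_square field_simps)
  have t2: "t\<^sup>2 < 1" using assms(3) by (simp add: abs_square_less_1)
  have Y2: "(Y / 2)\<^sup>2 \<le> 1" using assms(2) by (simp add: abs_square_le_1)
  show ?thesis
  proof (cases "(Y / 2)\<^sup>2 = 1")
    case False
    then have "(1 - t\<^sup>2)\<^sup>2 * (1 - (Y / 2)\<^sup>2) > 0" using Y2 t2 by simp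
    then show ?thesis unfolding eq by (smt (verit) zero_le_power2)
  next
    case True
    then have "\<bar>Y / 2\<bar> = 1" by (simp only: abs_square_eq_1)
    then have Y: "\<bar>Y\<bar> = 2" by simp
    have "\<bar>t * X\<bar> \<le> \<bar>t\<bar> * 2" unfolding abs_mult using assms by (intro mult_left_mono) auto
    also have "\<dots> < 1 + t\<^sup>2"
    proof -
      have "0 < (1 - \<bar>t\<bar>)\<^sup>2" using assms(3) by simp
      then show ?thesis by (simp add: power2_eq_square algebra_simps abs_mult_self_eq)
    qed
    also have "\<dots> = \<bar>(1 + t\<^sup>2) * Y / 2\<bar>" using Y by (simp add: abs_mult)
    finally have "t * X - (1 + t\<^sup>2) * Y / 2 \<noteq> 0" by auto
    then show ?thesis unfolding eq using True by simp
  qed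
qed

definition mehler_coeff :: "real \<Rightarrow> real \<Rightarrow> real \<Rightarrow> nat \<Rightarrow> real" where
  "mehler_coeff q X Y n = hq q n X * hq q n Y / qp q n"

lemma summable_square_geometric:
  fixes r :: real
  assumes "0 \<le> r" "r < 1"
  shows "summable (\<lambda>n. (real (Suc n))\<^sup>2 * r ^ n)"
proof -
  define f where "f n = real (Suc n) * sqrt r ^ n" for n
  have sr: "norm (sqrt r) < 1" using assms by simp
  have sf: "summable f"
    using sums_summable[OF geometric_deriv_sums[OF sr]] by (simp add: f_def[abs_def])
  have "f \<longlonglongrightarrow> 0" by (rule summable_LIMSEQ_zero[OF sf])
  then have ev: "eventually (\<lambda>n. f n < 1) sequentially" by (rule order_tendstoD) simp
  have f0: "f n \<ge> 0" for n using assms by (simp add: f_def)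
  have "summable (\<lambda>n. f n * f n)"
    by (rule summable_comparison_test_ev[OF _ sf], rule eventually_mono[OF ev])
       (use f0 in \<open>simp add: mult_left_le\<close>)
  moreover have "f n * f n = (real (Suc n))\<^sup>2 * r ^ n" for n
  proof -
    have "f n * f n = (real (Suc n))\<^sup>2 * (sqrt r * sqrt r) ^ n"
      by (simp only: f_def power_mult_distrib power2_eq_square) (simp only: mult_ac)
    then show ?thesis using assms by simp
  qed
  ultimately show ?thesis by simp
qed

lemma mehler_summable:
  assumes q: "\<bar>q\<bar> < 1" and X: "\<bar>X\<bar> \<le> 2" and Y: "\<bar>Y\<bar> \<le> 2" and t: "\<bar>t\<bar> < 1"
  shows "summable (\<lambda>n. norm (mehler_coeff q X Y n * t ^ n))"
proof -
  obtain c where c: "c > 0" "\<And>n. qp q n \<ge> c" using qp_lower_bound[OF q] by blast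
  obtain C where C: "C > 0" "\<And>n X. \<bar>X\<bar> \<le> 2 \<Longrightarrow> \<bar>hq q n X\<bar> \<le> C * real (Suc n)"
    using hq_bound[OF q] by blast
  have "summable (\<lambda>n. C\<^sup>2 / c * ((real (Suc n))\<^sup>2 * \<bar>t\<bar> ^ n))"
    using t by (intro summable_mult summable_square_geometric) auto
  then show ?thesis
  proof (rule summable_comparison_test_ev[rotated], intro always_eventually allI)
    fix n
    have "\<bar>hq q n X * hq q n Y\<bar> \<le> (C * real (Suc n)) * (C * real (Suc n))"
      unfolding abs_mult using C(1) by (intro mult_mono C(2) X Y) auto
    then have "\<bar>hq q n X * hq q n Y\<bar> / qp q n \<le> ((C * real (Suc n)) * (C * real (Suc n))) / c"
      using c qp_pos[OF q, of n] by (intro frac_le) auto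
    then have "\<bar>mehler_coeff q X Y n\<bar> \<le> C\<^sup>2 / c * (real (Suc n))\<^sup>2"
      using qp_pos[OF q, of n]
      by (simp add: mehler_coeff_def abs_mult power2_eq_square mult_ac)
    then have "\<bar>mehler_coeff q X Y n\<bar> * \<bar>t\<bar> ^ n \<le> C\<^sup>2 / c * (real (Suc n))\<^sup>2 * \<bar>t\<bar> ^ n"
      by (intro mult_right_mono) auto
    then show "norm (norm (mehler_coeff q X Y n * t ^ n)) \<le> C\<^sup>2 / c * ((real (Suc n))\<^sup>2 * \<bar>t\<bar> ^ n)"
      by (simp add: abs_mult power_abs mult_ac)
  qed
qed

text \<open>The polynomial \<open>v0 X Y t 0\<close> has degree four in \<open>t\<close>, so the functional equation of the Mehler kernel amounts to
  a recurrence over five consecutive coefficients.  It follows from the recurrence of the \<open>h\<^sub>n\<close>: eliminating the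
  terms from the top, each step cancels one factor of the denominator.\<close>

lemma mehler_coeff_rec:
  fixes q X Y :: real
  assumes q: "\<bar>q\<bar> < 1"
  defines "a \<equiv> mehler_coeff q X Y"
  shows "(1 - q ^ (n+4)) * a (n+4) - X * Y * a (n+3) + (X\<^sup>2 + Y\<^sup>2 - 2 + (1 + q) * q ^ (n+2)) * a (n+2)
      - X * Y * a (n+1) + (1 - q ^ (n+1)) * a n = 0"
proof -
  define P where "P = qp q n"
  define z where "z = q ^ n"
  define x0 where "x0 = hq q n X"  define x1 where "x1 = hq q (n+1) X"
  define y0 where "y0 = hq q n Y"  define y1 where "y1 = hq q (n+1) Y"
  define d1 where "d1 = 1 - q * z" define d2 where "d2 = 1 - q^2 * z"
  define d3 where "d3 = 1 - q^3 * z" define d4 where "d4 = 1 - q^4 * z"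
  have nz: "P > 0" "P * d1 > 0" "P * d1 * d2 > 0" "P * d1 * d2 * d3 > 0" "P * d1 * d2 * d3 * d4 > 0"
    using qp_pos[OF q, of n] qp_pos[OF q, of "Suc n"] qp_pos[OF q, of "Suc (Suc n)"]
     qp_pos[OF q, of "Suc (Suc (Suc n))"]  qp_pos[OF q, of "Suc (Suc (Suc (Suc n)))"]
    by (simp_all add: qp_Suc P_def z_def d1_def d2_def d3_def d4_def eval_nat_numeral mult_ac)
  then have nz': "P \<noteq> 0" "d1 \<noteq> 0" "d2 \<noteq> 0" "d3 \<noteq> 0" "d4 \<noteq> 0" by auto
  define x2 where "x2 = X * x1 - d1 * x0" define y2 where "y2 = Y * y1 - d1 * y0"
  define x3 where "x3 = X * x2 - d2 * x1" define y3 where "y3 = Y * y2 - d2 * y1"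
  have a0: "a n = x0 * y0 / P" by (simp add: a_def mehler_coeff_def x0_def y0_def P_def)
  have a1: "a (n+1) = x1 * y1 / (P * d1)"
    by (simp add: a_def mehler_coeff_def x1_def y1_def P_def qp_Suc d1_def z_def)
  have a2: "a (n+2) = x2 * y2 / (P * d1 * d2)"
    by (simp add: a_def mehler_coeff_def x0_def y0_def x1_def y1_def x2_def y2_def P_def qp_Suc d1_def d2_def z_def eval_nat_numeral mult_ac)
  have a3: "a (n+3) = x3 * y3 / (P * d1 * d2 * d3)"
    by (simp add: a_def mehler_coeff_def x0_def y0_def x1_def y1_def x2_def y2_def x3_def y3_def P_def qp_Suc d1_def d2_def d3_def z_def eval_nat_numeral mult_ac)
  have a4: "a (n+4) = (X * x3 - d3 * x2) * (Y * y3 - d3 * y2) / (P * d1 * d2 * d3 * d4)"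
    by (simp add: a_def mehler_coeff_def x0_def y0_def x1_def y1_def x2_def y2_def x3_def y3_def P_def qp_Suc d1_def d2_def d3_def d4_def z_def eval_nat_numeral mult_ac)
  have pw: "1 - q ^ (n+4) = d4" "1 - q ^ (n+1) = d1" "(1 + q) * q ^ (n+2) = (1 - d2) + (1 - d3)"
    by (simp_all add: d1_def d2_def d3_def d4_def z_def power_add eval_nat_numeral algebra_simps)
  have "d1 * x0 = X * x1 - x2" "d1 * y0 = Y * y1 - y2" by (simp_all add: x2_def y2_def)
  moreover have "d1 * (x0 * y0 / P) = (d1 * x0) * (d1 * y0) / (P * d1)"
    using nz' by (simp add: field_simps)
  ultimately have b0: "d1 * (x0 * y0 / P) = (X * x1 - x2) * (Y * y1 - y2) / (P * d1)"
    by simp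
  have e4: "d4 * ((X * x3 - d3 * x2) * (Y * y3 - d3 * y2) / (P * d1 * d2 * d3 * d4)) =
     (X * x3 - d3 * x2) * (Y * y3 - d3 * y2) / (P * d1 * d2 * d3)"
    using nz' by (simp add: field_simps)
  have "(X * x3 - d3 * x2) * (Y * y3 - d3 * y2) - X * Y * (x3 * y3)
       = d3 * (d3 * x2 * y2 - X * x3 * y2 - Y * x2 * y3)"
    by (simp add: algebra_simps)
  then have e3: "(X * x3 - d3 * x2) * (Y * y3 - d3 * y2) / (P * d1 * d2 * d3) - X * Y * (x3 * y3 / (P * d1 * d2 * d3))
       = (d3 * x2 * y2 - X * x3 * y2 - Y * x2 * y3) / (P * d1 * d2)"
    using nz' by (simp add: diff_divide_distrib[symmetric])
  have "(d3 * x2 * y2 - X * x3 * y2 - Y * x2 * y3) + (X\<^sup>2 + Y\<^sup>2 - 2 + ((1 - d2) + (1 - d3))) * (x2 * y2)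
       = d2 * (X * x1 * y2 + Y * x2 * y1 - x2 * y2)"
    by (simp add: x3_def y3_def algebra_simps power2_eq_square)
  then have e2: "(d3 * x2 * y2 - X * x3 * y2 - Y * x2 * y3) / (P * d1 * d2) + (X\<^sup>2 + Y\<^sup>2 - 2 + ((1 - d2) + (1 - d3))) * (x2 * y2 / (P * d1 * d2))
       = (X * x1 * y2 + Y * x2 * y1 - x2 * y2) / (P * d1)"
    using nz' by (simp add: add_divide_distrib[symmetric])
  have e1: "(X * x1 * y2 + Y * x2 * y1 - x2 * y2) / (P * d1) - X * Y * (x1 * y1 / (P * d1)) + (X * x1 - x2) * (Y * y1 - y2) / (P * d1) = 0"
    using nz' by (simp add: field_simps)
  show ?thesis
    unfolding a0 a1 a2 a3 a4 pw e4 e3 e2 b0 e1 ..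
qed

lemma mehler_functional_eq:
  fixes q X Y t :: real
  assumes q: "\<bar>q\<bar> < 1" and X: "\<bar>X\<bar> \<le> 2" and Y: "\<bar>Y\<bar> \<le> 2" and t: "\<bar>t\<bar> < 1"
  defines "F \<equiv> \<lambda>t. \<Sum>n. mehler_coeff q X Y n * t ^ n"
  shows "v0 X Y t 0 * F t = (1 - t\<^sup>2) * (1 - q * t\<^sup>2) * F (q * t)"
proof -
  define a where "a = mehler_coeff q X Y"
  have qt: "\<bar>q * t\<bar> < 1" unfolding abs_mult using q t by (metis abs_ge_zero mult_strict_mono' mult_1)
  \<comment> \<open>the coefficients of \<open>t^k F t\<close>\<close>
  define A where "A k n = (if n < k then 0 else a (n - k))" for k n
  have shift: "(\<lambda>n. A k n * u ^ n) sums (u ^ k * F u)" if "\<bar>u\<bar> < 1" for u k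
  proof -
    have "(\<lambda>n. a n * u ^ n) sums F u"
      unfolding F_def a_def using summable_sums[OF summable_norm_cancel[OF mehler_summable[OF q X Y that]]] .
    then have "(\<lambda>n. u ^ k * (a n * u ^ n)) sums (u ^ k * F u)" by (rule sums_mult)
    then have "(\<lambda>n. A k (n + k) * u ^ (n + k)) sums (u ^ k * F u)"
      by (simp add: A_def power_add mult_ac)
    then show ?thesis
      by (subst (asm) sums_zero_iff_shift) (simp_all add: A_def)
  qed
  have L: "(\<lambda>n. A 0 n * t ^ n - X * Y * (A 1 n * t ^ n) + (X\<^sup>2 + Y\<^sup>2 - 2) * (A 2 n * t ^ n)
      - X * Y * (A 3 n * t ^ n) + A 4 n * t ^ n) sums
     (t ^ 0 * F t - X * Y * (t ^ 1 * F t) + (X\<^sup>2 + Y\<^sup>2 - 2) * (t ^ 2 * F t) - X * Y * (t ^ 3 * F t) + t ^ 4 * F t)"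
    by (intro sums_add sums_diff sums_mult shift t)
  have B: "(\<lambda>n. t ^ k * (A 0 n * (q * t) ^ n)) sums (t ^ k * F (q * t))" for k
    using sums_mult[OF shift[OF qt, of 0], of "t ^ k"] by simp
  have B': "(\<lambda>n. (if n < k then 0 else a (n - k) * q ^ (n - k)) * t ^ n) sums (t ^ k * F (q * t))" for k
  proof -
    have "(\<lambda>n. (if n + k < k then 0 else a (n + k - k) * q ^ (n + k - k)) * t ^ (n + k)) sums (t ^ k * F (q * t))"
      using B[of k] by (simp add: A_def power_add power_mult_distrib mult_ac)
    then show ?thesis by (subst (asm) sums_zero_iff_shift) simp_all
  qed
  have R: "(\<lambda>n. (if n < 0 then 0 else a (n - 0) * q ^ (n - 0)) * t ^ n
        - (1 + q) * ((if n < 2 then 0 else a (n - 2) * q ^ (n - 2)) * t ^ n)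
        + q * ((if n < 4 then 0 else a (n - 4) * q ^ (n - 4)) * t ^ n)) sums
      (t ^ 0 * F (q * t) - (1 + q) * (t ^ 2 * F (q * t)) + q * (t ^ 4 * F (q * t)))"
    by (intro sums_add sums_diff sums_mult B')
  have coeff: "A 0 n - X * Y * A 1 n + (X\<^sup>2 + Y\<^sup>2 - 2) * A 2 n - X * Y * A 3 n + A 4 n =
     a n * q ^ n - (1 + q) * (if n < 2 then 0 else a (n - 2) * q ^ (n - 2))
       + q * (if n < 4 then 0 else a (n - 4) * q ^ (n - 4))" for n
  proof -
    consider "n = 0" | "n = 1" | "n = 2" | "n = 3" | m where "n = m + 4"
    proof -
      have "n = 0 \<or> n = 1 \<or> n = 2 \<or> n = 3 \<or> n = (n - 4) + 4" by arith
      then show thesis using that by blast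
    qed
    then show ?thesis
    proof cases
      case 2
      have "1 - q \<noteq> 0" using q by auto
      then show ?thesis using 2 by (simp add: A_def a_def mehler_coeff_def qp_Suc field_simps)
    next
      case 3
      have "1 - q \<noteq> 0" "1 - q\<^sup>2 \<noteq> 0" using qp_pos[OF q, of 2] by (auto simp: qp_Suc eval_nat_numeral)
      then show ?thesis using 3
        apply (simp add: A_def a_def mehler_coeff_def qp_Suc eval_nat_numeral divide_simps)
        apply (simp add: algebra_simps)
        done
    next
      case 4
      have "1 - q \<noteq> 0" "1 - q*q \<noteq> 0" "1 - q*(q*q) \<noteq> 0" using qp_pos[OF q, of 3] by (auto simp: qp_Suc eval_nat_numeral)
      then show ?thesis using 4
        apply (simp add: A_def a_def mehler_coeff_def qp_Suc eval_nat_numeral divide_simps)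
        apply (simp add: algebra_simps)
        done
    next
      case 5
      show ?thesis using mehler_coeff_rec[OF q, of m X Y]
        by (simp add: 5 A_def a_def[symmetric] algebra_simps power_add eval_nat_numeral)
    qed (simp add: A_def)
  qed
  have "t ^ 0 * F t - X * Y * (t ^ 1 * F t) + (X\<^sup>2 + Y\<^sup>2 - 2) * (t ^ 2 * F t) - X * Y * (t ^ 3 * F t) + t ^ 4 * F t
     = t ^ 0 * F (q * t) - (1 + q) * (t ^ 2 * F (q * t)) + q * (t ^ 4 * F (q * t))"
  proof (rule sums_unique2[OF L], rule sums_cong[THEN iffD2, OF _ R])
    fix n
    show "A 0 n * t ^ n - X * Y * (A 1 n * t ^ n) + (X\<^sup>2 + Y\<^sup>2 - 2) * (A 2 n * t ^ n)
      - X * Y * (A 3 n * t ^ n) + A 4 n * t ^ n =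
      (if n < 0 then 0 else a (n - 0) * q ^ (n - 0)) * t ^ n
        - (1 + q) * ((if n < 2 then 0 else a (n - 2) * q ^ (n - 2)) * t ^ n)
        + q * ((if n < 4 then 0 else a (n - 4) * q ^ (n - 4)) * t ^ n)"
      using arg_cong[OF coeff[of n], of "\<lambda>x. x * t ^ n"] by (simp add: algebra_simps)
  qed
  then show ?thesis by (simp add: v0_def algebra_simps eval_nat_numeral)
qed

lemma v0_prod_convergent:
  assumes q: "\<bar>q\<bar> < 1" and X: "\<bar>X\<bar> \<le> 2" and Y: "\<bar>Y\<bar> \<le> 2" and t: "\<bar>t\<bar> < 1"
  shows "convergent_prod (\<lambda>k. 1 / v0 X Y (t * q ^ k) 0)"
proof -
  have "summable (\<lambda>k. norm (v0 X Y (t * q ^ k) 0 - 1))"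
  proof (rule summable_comparison_test_ev[OF always_eventually])
    show "summable (\<lambda>k. 20 * \<bar>q\<bar> ^ k)" using q by (intro summable_mult summable_geometric) auto
    show "\<forall>k. norm (norm (v0 X Y (t * q ^ k) 0 - 1)) \<le> 20 * \<bar>q\<bar> ^ k"
    proof
      fix k
      define u where "u = t * q ^ k"
      have uq: "\<bar>u\<bar> \<le> \<bar>q\<bar> ^ k" unfolding u_def abs_mult power_abs using t by (intro mult_left_le_one_le) auto
      also have "\<dots> \<le> 1" using q by (intro power_le_one) auto
      finally have u1: "\<bar>u\<bar> \<le> 1" .
      have un: "\<bar>u ^ Suc n\<bar> \<le> \<bar>u\<bar>" for n
        unfolding power_abs power_Suc abs_mult using u1 by (intro mult_left_le power_le_one) auto
      have XY: "\<bar>X * Y\<bar> \<le> 4" unfolding abs_mult using mult_mono[OF X Y] by simp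
      have X2: "\<bar>X\<^sup>2\<bar> \<le> 4" "\<bar>Y\<^sup>2\<bar> \<le> 4"
        using mult_mono[OF X X] mult_mono[OF Y Y] by (simp_all add: power2_eq_square)
      have m: "\<bar>c * d\<bar> \<le> K * \<bar>u\<bar>" if "\<bar>c\<bar> \<le> K" "\<bar>d\<bar> \<le> \<bar>u\<bar>" for c d K :: real
        unfolding abs_mult using that by (intro mult_mono) auto
      have "v0 X Y u 0 - 1 = (u ^ 4 - X * Y * u - X * Y * u ^ 3) + (X\<^sup>2 * u ^ 2 + Y\<^sup>2 * u ^ 2 + (- 2) * u ^ 2)"
        by (simp add: v0_def power2_eq_square algebra_simps eval_nat_numeral)
      moreover have "\<bar>u ^ 4\<bar> \<le> \<bar>u\<bar>" "\<bar>X * Y * u\<bar> \<le> 4 * \<bar>u\<bar>" "\<bar>X * Y * u ^ 3\<bar> \<le> 4 * \<bar>u\<bar>"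
        "\<bar>X\<^sup>2 * u ^ 2\<bar> \<le> 4 * \<bar>u\<bar>" "\<bar>Y\<^sup>2 * u ^ 2\<bar> \<le> 4 * \<bar>u\<bar>" "\<bar>(- 2) * u ^ 2\<bar> \<le> 2 * \<bar>u\<bar>"
        using un[of 3] un[of 2] un[of 1] un[of 0] XY X2
        by (auto intro!: m simp: numeral_eq_Suc simp del: power_Suc)
      ultimately have "\<bar>v0 X Y u 0 - 1\<bar> \<le> 20 * \<bar>u\<bar>" by linarith
      then show "norm (norm (v0 X Y (t * q ^ k) 0 - 1)) \<le> 20 * \<bar>q\<bar> ^ k"
        using uq by (simp add: u_def)
    qed
  qed
  then have "convergent_prod (\<lambda>k. v0 X Y (t * q ^ k) 0)"
    using abs_convergent_prod_conv_summable abs_convergent_prod_imp_convergent_prod by blast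
  then show ?thesis
    using convergent_prod_inverse by (fastforce simp: inverse_eq_divide)
qed

lemma abs_mult_pow_less_1: "\<bar>t\<bar> < 1 \<Longrightarrow> \<bar>q\<bar> < 1 \<Longrightarrow> \<bar>t * q ^ k\<bar> < (1::real)"
proof -
  assume a: "\<bar>t\<bar> < 1" "\<bar>q\<bar> < 1"
  have "\<bar>t * q ^ k\<bar> \<le> \<bar>t\<bar> * 1" unfolding abs_mult power_abs using a by (intro mult_left_mono power_le_one) auto
  then show ?thesis using a by simp
qed

text \<open>Iterating the functional equation moves the argument to \<open>t q\<^sup>N\<close>, where the kernel tends to its value \<open>1\<close> at \<open>0\<close>.\<close>

theorem poisson_mehler:
  assumes q: "\<bar>q\<bar> < 1" and X: "\<bar>X\<bar> \<le> 2" and Y: "\<bar>Y\<bar> \<le> 2" and t: "\<bar>t\<bar> < 1"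
  shows "(\<Sum>n. mehler_coeff q X Y n * t ^ n) = qpoch_inf (t\<^sup>2) q * (\<Prod>k. 1 / v0 X Y (t * q ^ k) 0)"
proof -
  define F where "F t = (\<Sum>n. mehler_coeff q X Y n * t ^ n)" for t
  note tk = abs_mult_pow_less_1[OF t q]
  have vp: "v0 X Y (t * q ^ k) 0 > 0" for k by (rule v0_pos[OF X Y tk])
  have iter: "F t = (\<Prod>k<2*N. 1 - t\<^sup>2 * q ^ k) * (\<Prod>k<N. 1 / v0 X Y (t * q ^ k) 0) * F (t * q ^ N)" for N
  proof (induction N)
    case (Suc N)
    have "v0 X Y (t * q ^ N) 0 * F (t * q ^ N) =
       (1 - (t * q ^ N)\<^sup>2) * (1 - q * (t * q ^ N)\<^sup>2) * F (q * (t * q ^ N))"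
      unfolding F_def by (rule mehler_functional_eq[OF q X Y tk])
    then have "F (t * q ^ N) = (1 - t\<^sup>2 * q ^ (2 * N)) * (1 - t\<^sup>2 * q ^ Suc (2 * N)) * (1 / v0 X Y (t * q ^ N) 0) * F (t * q ^ Suc N)"
      using vp[of N] by (simp add: field_simps power_mult_distrib power_mult power2_eq_square)
    with Suc show ?case by (simp add: mult_ac)
  qed simp
  have sm: "summable (\<lambda>n. mehler_coeff q X Y n * (1/2) ^ n)"
    by (rule summable_norm_cancel, rule mehler_summable[OF q X Y]) simp
  have "isCont F 0" unfolding F_def[abs_def] by (rule isCont_powser[OF sm]) simp
  moreover have "(\<lambda>N. t * q ^ N) \<longlonglongrightarrow> 0"
    using q by (intro tendsto_mult_right_zero LIMSEQ_power_zero) auto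
  ultimately have "(\<lambda>N. F (t * q ^ N)) \<longlonglongrightarrow> F 0" by (rule isCont_tendsto_compose)
  moreover have "F 0 = 1" using powser_zero[of "mehler_coeff q X Y"] by (simp add: F_def mehler_coeff_def)
  moreover have "(\<lambda>N. \<Prod>k<2*N. 1 - t\<^sup>2 * q ^ k) \<longlonglongrightarrow> qpoch_inf (t\<^sup>2) q"
    by (rule LIMSEQ_subseq_LIMSEQ[OF qpoch_LIMSEQ[OF q], of "\<lambda>N. 2 * N", unfolded o_def])
       (simp add: strict_mono_def)
  moreover have "(\<lambda>N. \<Prod>k<N. 1 / v0 X Y (t * q ^ k) 0) \<longlonglongrightarrow> (\<Prod>k. 1 / v0 X Y (t * q ^ k) 0)"
    using convergent_prod_LIMSEQ[OF v0_prod_convergent[OF q X Y t]]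
    unfolding lessThan_Suc_atMost[symmetric] by (rule LIMSEQ_imp_Suc)
  ultimately have "(\<lambda>N. (\<Prod>k<2*N. 1 - t\<^sup>2 * q ^ k) * (\<Prod>k<N. 1 / v0 X Y (t * q ^ k) 0) * F (t * q ^ N))
      \<longlonglongrightarrow> qpoch_inf (t\<^sup>2) q * (\<Prod>k. 1 / v0 X Y (t * q ^ k) 0) * 1"
    by (intro tendsto_mult) simp_all
  then have "(\<lambda>N. F t) \<longlonglongrightarrow> qpoch_inf (t\<^sup>2) q * (\<Prod>k. 1 / v0 X Y (t * q ^ k) 0) * 1"
    unfolding iter[symmetric] .
  then have "F t = qpoch_inf (t\<^sup>2) q * (\<Prod>k. 1 / v0 X Y (t * q ^ k) 0) * 1"
    by (rule LIMSEQ_unique[OF tendsto_const])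
  then show ?thesis by (simp add: F_def)
qed

section \<open>Termwise integration of the triple series\<close>

lemma has_lebesgue_integral_on_iff:
  "has_lebesgue_integral_on f v A \<longleftrightarrow> has_bochner_integral lborel (\<lambda>x. indicator A x * f x) v"
  unfolding has_lebesgue_integral_on_def set_integrable_def set_lebesgue_integral_def has_bochner_integral_iff
  by simp

lemma has_bochner_integral_lborel_times:
  fixes f :: "'a::euclidean_space \<Rightarrow> real" and g :: "'b::euclidean_space \<Rightarrow> real"
  assumes f: "has_bochner_integral lborel f a" and g: "has_bochner_integral lborel g b"
  shows "has_bochner_integral lborel (\<lambda>(x, y). f x * g y) (a * b)"
proof -
  have [measurable]: "f \<in> borel_measurable lborel" "g \<in> borel_measurable lborel"
    using f g by (auto simp: has_bochner_integral_iff)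
  have int: "integrable (lborel \<Otimes>\<^sub>M lborel) (\<lambda>(x, y). f x * g y)"
    by (rule lborel_pair.Fubini_integrable)
       (use f g in \<open>auto simp: has_bochner_integral_iff abs_mult\<close>)
  moreover have "(\<integral>x. \<integral>y. f x * g y \<partial>lborel \<partial>lborel) = a * b"
    using f g by (simp add: has_bochner_integral_iff)
  ultimately show ?thesis
    using lborel_pair.integral_fst'[OF int] unfolding lborel_prod by (simp add: has_bochner_integral_iff)
qed

lemma has_bochner_integral_infsum:
  fixes f :: "'i::countable \<Rightarrow> 'a \<Rightarrow> real"
  assumes inf: "infinite (UNIV :: 'i set)"
    and f: "\<And>p. has_bochner_integral M (f p) (v p)"
    and le: "\<And>p x. \<bar>f p x\<bar> \<le> B p * g x"
    and g: "integrable M g" and B: "B summable_on UNIV"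
  shows "has_bochner_integral M (\<lambda>x. \<Sum>\<^sub>\<infinity>p. f p x) (\<Sum>\<^sub>\<infinity>p. v p)"
proof -
  obtain e0 :: "'i \<Rightarrow> nat" where "bij_betw e0 UNIV UNIV"
    using countableE_infinite[OF countableI_type inf] by blast
  then obtain e :: "nat \<Rightarrow> 'i" where e: "bij_betw e UNIV UNIV" using bij_betw_inv by blast
  have sB: "summable (\<lambda>n. B (e n))"
    using summable_on_reindex_bij_betw[OF e, of B] B by (intro summable_on_imp_summable) simp
  have sf: "summable (\<lambda>n. norm (f (e n) x))" for x
    by (rule summable_comparison_test_ev[OF always_eventually summable_mult2[OF sB]])
       (use le in auto)
  have int: "integrable M (f p)" and v: "integral\<^sup>L M (f p) = v p" for p
    using f by (auto simp: has_bochner_integral_iff)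
  have bv: "(\<integral>x. norm (f p x) \<partial>M) \<le> B p * integral\<^sup>L M g" for p
  proof -
    have "(\<integral>x. norm (f p x) \<partial>M) \<le> (\<integral>x. B p * g x \<partial>M)"
      using int g le by (intro integral_mono) auto
    then show ?thesis by simp
  qed
  have sI: "summable (\<lambda>n. \<integral>x. norm (f (e n) x) \<partial>M)"
    by (rule summable_comparison_test_ev[OF always_eventually summable_mult2[OF sB]])
       (use bv in auto)
  have eqf: "(\<Sum>\<^sub>\<infinity>p. f p x) = (\<Sum>n. f (e n) x)" for x
    using infsum_reindex_bij_betw[OF e, of "\<lambda>p. f p x"] norm_summable_imp_has_sum[OF sf summable_sums[OF summable_norm_cancel[OF sf]], of x]
    by (simp add: infsumI)
  have "summable (\<lambda>n. norm (v (e n)))"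
  proof (rule summable_comparison_test_ev[OF always_eventually sI], rule allI)
    fix n show "norm (norm (v (e n))) \<le> (\<integral>x. norm (f (e n) x) \<partial>M)"
      using integral_norm_bound[of M "f (e n)"] by (simp add: v)
  qed
  then have eqv: "(\<Sum>\<^sub>\<infinity>p. v p) = (\<Sum>n. v (e n))"
    using infsum_reindex_bij_betw[OF e, of v] norm_summable_imp_has_sum[OF _ summable_sums[OF summable_norm_cancel]]
    by (metis infsumI)
  show ?thesis
    unfolding eqf eqv has_bochner_integral_iff
    using integrable_suminf[where f = "\<lambda>n. f (e n)", OF int _ sI] integral_suminf[where f = "\<lambda>n. f (e n)", OF int _ sI] sf
    by (simp add: v)
qed

lemma summable_on_times:
  fixes f :: "'a \<Rightarrow> real" and g :: "'b \<Rightarrow> real"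
  assumes "f summable_on UNIV" "g summable_on UNIV" "\<And>x. 0 \<le> f x" "\<And>y. 0 \<le> g y"
  shows "(\<lambda>(x, y). f x * g y) summable_on UNIV"
proof -
  have "(\<lambda>(x, y). f x * g y) summable_on (SIGMA x:UNIV. UNIV)"
  proof (rule summable_on_SigmaI)
    show "((\<lambda>y. case (x, y) of (x, y) \<Rightarrow> f x * g y) has_sum f x * infsum g UNIV) UNIV" for x
      using has_sum_cmult_right[OF has_sum_infsum[OF assms(2)]] by simp
    show "(\<lambda>x. f x * infsum g UNIV) summable_on UNIV"
      by (rule summable_on_cmult_left[OF assms(1)])
  qed (use assms in auto)
  then show ?thesis by simp
qed

definition tri_coeff :: "real \<Rightarrow> real \<Rightarrow> real \<Rightarrow> real \<Rightarrow> nat \<times> nat \<times> nat \<Rightarrow> real" where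
  "tri_coeff q r12 r13 r23 = (\<lambda>(i, j, k). r12 ^ j * r23 ^ k * r13 ^ i / (qfact q i * qfact q j * qfact q k))"

definition tri_poly :: "real \<Rightarrow> nat \<times> nat \<times> nat \<Rightarrow> real \<Rightarrow> real \<Rightarrow> real \<Rightarrow> real" where
  "tri_poly q = (\<lambda>(i, j, k) x1 x2 x3. qHermite q (i + j) x1 * qHermite q (j + k) x2 * qHermite q (i + k) x3)"

lemma f3D_series:
  assumes "q < 1"
  shows "f3D q r12 r13 r23 x1 x2 x3 =
    fN q x1 * fN q x2 * fN q x3 * (\<Sum>\<^sub>\<infinity>p. tri_coeff q r12 r13 r23 p * tri_poly q p x1 x2 x3)"
  using assms by (simp add: f3D_def tri_coeff_def tri_poly_def case_prod_unfold mult.assoc)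

text \<open>The factor \<open>(1 - q)^(i + j + k)\<close> from the factorials cancels the scaling of the three polynomials, whose
  linear growth is then beaten by the geometric decay in the correlations.\<close>

lemma tri_term_bound:
  assumes q: "\<bar>q\<bar> < 1" and r: "\<bar>r12\<bar> < 1" "\<bar>r13\<bar> < 1" "\<bar>r23\<bar> < 1"
  obtains B where "B summable_on UNIV" "\<And>p. 0 \<le> B p"
    "\<And>p x1 x2 x3. x1 \<in> qsupp q \<Longrightarrow> x2 \<in> qsupp q \<Longrightarrow> x3 \<in> qsupp q \<Longrightarrow>
      \<bar>tri_coeff q r12 r13 r23 p * tri_poly q p x1 x2 x3\<bar> \<le> B p"
proof -
  obtain c where c: "c > 0" "\<And>n. qp q n \<ge> c" using qp_lower_bound[OF q] by blast
  obtain C where C: "C > 0" "\<And>n X. \<bar>X\<bar> \<le> 2 \<Longrightarrow> \<bar>hq q n X\<bar> \<le> C * real (Suc n)"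
    using hq_bound[OF q] by blast
  define s where "s = sqrt (1 - q)"
  have q1: "q < 1" using q by simp
  have s: "s > 0" "s * s = 1 - q" using q1 by (simp_all add: s_def)
  define b where "b r n = (real (Suc n))\<^sup>2 * \<bar>r\<bar> ^ n" for r n
  have b: "b r summable_on UNIV" if "\<bar>r\<bar> < 1" for r
    unfolding b_def by (rule norm_summable_imp_summable_on) (use summable_square_geometric[of "\<bar>r\<bar>"] that in \<open>simp add: abs_mult\<close>)
  have b0: "0 \<le> b r n" for r n by (simp add: b_def)
  define K where "K = (C / c) ^ 3"
  define B where "B = (\<lambda>(i, j, k). K * (b r13 i * (b r12 j * b r23 k)))"
  have "(\<lambda>(i, jk). b r13 i * (case jk of (j, k) \<Rightarrow> b r12 j * b r23 k)) summable_on UNIV"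
    by (intro summable_on_times b r) (auto simp: b0)
  from summable_on_cmult_right[OF this, of K]
  have "B summable_on UNIV" by (simp add: B_def case_prod_unfold)
  moreover have "0 \<le> B p" for p using b0 C c by (auto simp: B_def K_def split: prod.split)
  moreover have "\<bar>tri_coeff q r12 r13 r23 p * tri_poly q p x1 x2 x3\<bar> \<le> B p"
    if x: "x1 \<in> qsupp q" "x2 \<in> qsupp q" "x3 \<in> qsupp q" for p x1 x2 x3
  proof -
    obtain i j k where p: "p = (i, j, k)" by (cases p) auto
    have H: "\<bar>qHermite q n x\<bar> \<le> C * real (Suc n) / s ^ n" if "x \<in> qsupp q" for n x
    proof -
      have "qHermite q n x = hq q n (s * x) / s ^ n" using hq_qHermite[OF q1, of n x] s by (simp add: s_def)
      then show ?thesis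
        using C(2)[of "s * x" n] qsupp_scaled(1)[OF q1 that] s by (simp add: s_def divide_right_mono)
    qed
    have F: "\<bar>1 / qfact q n\<bar> \<le> s ^ n * s ^ n / c" for n
    proof -
      have "qfact q n = qp q n / (s ^ n * s ^ n)"
        using qfact_closed[of q n] q1 by (simp add: power_mult_distrib[symmetric] s)
      then show ?thesis using c qp_pos[OF q, of n] s by (simp add: frac_le)
    qed
    have "\<bar>tri_coeff q r12 r13 r23 p * tri_poly q p x1 x2 x3\<bar> =
       (\<bar>r12\<bar> ^ j * \<bar>r23\<bar> ^ k * \<bar>r13\<bar> ^ i) * (\<bar>1 / qfact q i\<bar> * \<bar>1 / qfact q j\<bar> * \<bar>1 / qfact q k\<bar>) *
        (\<bar>qHermite q (i + j) x1\<bar> * \<bar>qHermite q (j + k) x2\<bar> * \<bar>qHermite q (i + k) x3\<bar>)"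
      by (simp add: p tri_coeff_def tri_poly_def abs_mult power_abs)
    also have "\<dots> \<le> (\<bar>r12\<bar> ^ j * \<bar>r23\<bar> ^ k * \<bar>r13\<bar> ^ i) * ((s ^ i * s ^ i / c) * (s ^ j * s ^ j / c) * (s ^ k * s ^ k / c)) *
        ((C * real (Suc (i + j)) / s ^ (i + j)) * (C * real (Suc (j + k)) / s ^ (j + k)) * (C * real (Suc (i + k)) / s ^ (i + k)))"
      using C(1) c s by (intro mult_mono mult_nonneg_nonneg order_refl H F x) auto
    also have "\<dots> = K * ((\<bar>r12\<bar> ^ j * \<bar>r23\<bar> ^ k * \<bar>r13\<bar> ^ i) * (real (Suc (i + j)) * real (Suc (j + k)) * real (Suc (i + k))))"
    proof -
      have "(R * ((a1 * a1 / c) * (a2 * a2 / c) * (a3 * a3 / c)) * ((C * n1 / (a1 * a2)) * (C * n2 / (a2 * a3)) * (C * n3 / (a1 * a3))))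
          = K * (R * (n1 * n2 * n3))" if "a1 > 0" "a2 > 0" "a3 > 0" for R a1 a2 a3 n1 n2 n3 :: real
        unfolding K_def using that c(1) by (simp add: field_simps eval_nat_numeral)
      from this[of "s ^ i" "s ^ j" "s ^ k"] show ?thesis using s by (simp only: power_add zero_less_power)
    qed
    also have "\<dots> \<le> K * ((\<bar>r12\<bar> ^ j * \<bar>r23\<bar> ^ k * \<bar>r13\<bar> ^ i) * ((real (Suc i) * real (Suc j)) * (real (Suc j) * real (Suc k)) * (real (Suc i) * real (Suc k))))"
    proof -
      have l: "real (Suc (a + b)) \<le> real (Suc a) * real (Suc b)" for a b
        by (simp add: algebra_simps)
      show ?thesis using C c by (intro mult_left_mono mult_mono mult_nonneg_nonneg l) (auto simp: K_def)
    qed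
    also have "\<dots> = B p" by (simp add: p B_def b_def power2_eq_square mult_ac)
    finally show ?thesis .
  qed
  ultimately show ?thesis using that by blast
qed

text \<open>Common form of the partial integrations: \<open>X\<close>, \<open>Y\<close>, \<open>Z\<close> are either coordinates that are integrated or
  constants, and \<open>W\<close> collects the weights and the test polynomials.\<close>

lemma has_bochner_integral_tri_series:
  fixes X Y Z W :: "'a \<Rightarrow> real"
  assumes q: "\<bar>q\<bar> < 1" and r: "\<bar>r12\<bar> < 1" "\<bar>r13\<bar> < 1" "\<bar>r23\<bar> < 1"
    and W: "integrable M W"
    and supp: "\<And>x. W x \<noteq> 0 \<Longrightarrow> X x \<in> qsupp q \<and> Y x \<in> qsupp q \<and> Z x \<in> qsupp q"
    and v: "\<And>i j k. has_bochner_integral M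
      (\<lambda>x. tri_coeff q r12 r13 r23 (i, j, k) * tri_poly q (i, j, k) (X x) (Y x) (Z x) * W x) (v (i, j, k))"
  shows "has_bochner_integral M
    (\<lambda>x. (\<Sum>\<^sub>\<infinity>p. tri_coeff q r12 r13 r23 p * tri_poly q p (X x) (Y x) (Z x)) * W x) (\<Sum>\<^sub>\<infinity>p. v p)"
proof -
  define f where "f p x = tri_coeff q r12 r13 r23 p * tri_poly q p (X x) (Y x) (Z x)" for p x
  obtain B where B: "B summable_on UNIV" "\<And>p. 0 \<le> B p"
    "\<And>p x1 x2 x3. x1 \<in> qsupp q \<Longrightarrow> x2 \<in> qsupp q \<Longrightarrow> x3 \<in> qsupp q \<Longrightarrow>
      \<bar>tri_coeff q r12 r13 r23 p * tri_poly q p x1 x2 x3\<bar> \<le> B p"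
    using tri_term_bound[OF q r] by blast
  have "has_bochner_integral M (\<lambda>x. \<Sum>\<^sub>\<infinity>p. f p x * W x) (\<Sum>\<^sub>\<infinity>p. v p)"
  proof (rule has_bochner_integral_infsum[OF _ _ _ _ B(1)])
    show "infinite (UNIV :: (nat \<times> nat \<times> nat) set)" by (simp add: finite_prod)
    show "has_bochner_integral M (\<lambda>x. f p x * W x) (v p)" for p
      by (cases p) (simp only: f_def v)
    show "\<bar>f p x * W x\<bar> \<le> B p * \<bar>W x\<bar>" for p x
      using B(3)[of "X x" "Y x" "Z x" p] supp[of x]
      by (cases "W x = 0") (simp_all add: f_def abs_mult mult_right_mono)
    show "integrable M (\<lambda>x. \<bar>W x\<bar>)" using W by simp
  qed
  then show ?thesis by (simp only: f_def infsum_cmult_left')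
qed

lemma qfact_pos: "\<bar>q\<bar> < 1 \<Longrightarrow> qfact q n > 0"
  using qp_pos[of q n] by (simp add: qfact_closed)

text \<open>Orthogonality leaves only the term \<open>i = k = 0\<close>, \<open>j = n = m\<close>.\<close>

lemma f3D_moment12:
  assumes q: "\<bar>q\<bar> < 1" and r: "\<bar>r12\<bar> < 1" "\<bar>r13\<bar> < 1" "\<bar>r23\<bar> < 1"
  shows "has_lebesgue_integral_on (\<lambda>(x1, x2, x3). qHermite q n x1 * qHermite q m x2 * f3D q r12 r13 r23 x1 x2 x3)
          (if n = m then r12 ^ n * qfact q n else 0) (qsupp q \<times> qsupp q \<times> qsupp q)"
proof -
  have q1: "q < 1" using q by simp
  define H where "H = qHermite q"
  define w where "w = qweight q"
  define c where "c = tri_coeff q r12 r13 r23"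
  define W where "W = (\<lambda>(x1, x2, x3). (w x1 * H n x1) * ((w x2 * H m x2) * w x3))"
  define \<delta> :: "nat \<Rightarrow> nat \<Rightarrow> real" where "\<delta> a b = (if a = b then qfact q a else 0)" for a b
  define v where "v = (\<lambda>(i, j, k). c (i, j, k) * (\<delta> (i + j) n * (\<delta> (j + k) m * \<delta> (i + k) 0)))"
  have wH: "has_bochner_integral lborel (\<lambda>x. w x * (H a x * H b x)) (\<delta> a b)" for a b
    unfolding w_def H_def \<delta>_def by (rule qHermite_orthogonal[OF q])
  have wH1: "has_bochner_integral lborel (\<lambda>x. w x * H a x) (\<delta> a 0)" for a
    using wH[of a 0] by (simp add: H_def)
  have "has_bochner_integral lborel
    (\<lambda>x. (\<Sum>\<^sub>\<infinity>p. c p * tri_poly q p (fst x) (fst (snd x)) (snd (snd x))) * W x) (\<Sum>\<^sub>\<infinity>p. v p)"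
    unfolding c_def
  proof (rule has_bochner_integral_tri_series[OF q r])
    show "integrable lborel W"
      using has_bochner_integral_lborel_times[OF wH1[of n] has_bochner_integral_lborel_times[OF wH1[of m] wH1[of 0]]]
      by (simp add: has_bochner_integral_iff W_def case_prod_unfold H_def)
    show "fst x \<in> qsupp q \<and> fst (snd x) \<in> qsupp q \<and> snd (snd x) \<in> qsupp q" if "W x \<noteq> 0" for x
      using that by (auto simp: W_def w_def qweight_def case_prod_unfold indicator_def split: if_splits)
    fix i j k
    have "has_bochner_integral lborel (\<lambda>x. c (i, j, k) * (case x of (x1, x23) \<Rightarrow> (w x1 * (H (i + j) x1 * H n x1)) *
       (case x23 of (x2, x3) \<Rightarrow> (w x2 * (H (j + k) x2 * H m x2)) * (w x3 * (H (i + k) x3 * H 0 x3)))))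
       (v (i, j, k))"
      unfolding v_def prod.case
      by (intro has_bochner_integral_mult_right has_bochner_integral_lborel_times wH)
    then show "has_bochner_integral lborel (\<lambda>x. tri_coeff q r12 r13 r23 (i, j, k) *
        tri_poly q (i, j, k) (fst x) (fst (snd x)) (snd (snd x)) * W x) (v (i, j, k))"
      by (simp add: W_def c_def tri_poly_def H_def case_prod_unfold mult_ac)
  qed
  moreover have "(\<Sum>\<^sub>\<infinity>p. c p * tri_poly q p (fst x) (fst (snd x)) (snd (snd x))) * W x =
      indicator (qsupp q \<times> qsupp q \<times> qsupp q) x *
      (case x of (x1, x2, x3) \<Rightarrow> H n x1 * H m x2 * f3D q r12 r13 r23 x1 x2 x3)" for x
    by (cases x) (simp add: W_def f3D_series[OF q1] c_def w_def qweight_def indicator_times mult_ac)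
  moreover have "(\<Sum>\<^sub>\<infinity>p. v p) = (if n = m then r12 ^ n * qfact q n else 0)"
  proof -
    have "(\<Sum>\<^sub>\<infinity>p. v p) = (\<Sum>\<^sub>\<infinity>p\<in>{(0, n, 0)}. v p)"
      by (rule infsum_cong_neutral) (auto simp: v_def \<delta>_def split: if_splits)
    also have "\<dots> = (if n = m then r12 ^ n * qfact q n else 0)"
      using qfact_pos[OF q, of n] by (simp add: v_def \<delta>_def c_def tri_coeff_def)
    finally show ?thesis .
  qed
  ultimately show ?thesis unfolding has_lebesgue_integral_on_iff H_def by simp
qed

lemma f3D_marginal3:
  assumes q: "\<bar>q\<bar> < 1" and r: "\<bar>r12\<bar> < 1" "\<bar>r13\<bar> < 1" "\<bar>r23\<bar> < 1" and x3: "x3 \<in> qsupp q"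
  shows "has_lebesgue_integral_on (\<lambda>(x1, x2). f3D q r12 r13 r23 x1 x2 x3) (fN q x3) (qsupp q \<times> qsupp q)"
proof -
  have q1: "q < 1" using q by simp
  define H where "H = qHermite q"
  define w where "w = qweight q"
  define c where "c = tri_coeff q r12 r13 r23"
  define W where "W = (\<lambda>(x1, x2). w x1 * (w x2 * fN q x3))"
  define \<delta> :: "nat \<Rightarrow> real" where "\<delta> a = (if a = 0 then 1 else 0)" for a
  define v where "v = (\<lambda>(i, j, k). c (i, j, k) * H (i + k) x3 * fN q x3 * (\<delta> (i + j) * \<delta> (j + k)))"
  have wH: "has_bochner_integral lborel (\<lambda>x. w x * H a x) (\<delta> a)" for a
    using qHermite_orthogonal[OF q, of a 0] by (simp add: w_def H_def \<delta>_def if_distrib cong: if_cong)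
  have "has_bochner_integral lborel
    (\<lambda>x. (\<Sum>\<^sub>\<infinity>p. c p * tri_poly q p (fst x) (snd x) x3) * W x) (\<Sum>\<^sub>\<infinity>p. v p)"
    unfolding c_def
  proof (rule has_bochner_integral_tri_series[OF q r])
    show "integrable lborel W"
      using has_bochner_integral_lborel_times[OF wH[of 0] has_bochner_integral_mult_left[OF wH[of 0]]]
      by (simp add: has_bochner_integral_iff W_def case_prod_unfold H_def)
    show "fst x \<in> qsupp q \<and> snd x \<in> qsupp q \<and> x3 \<in> qsupp q" if "W x \<noteq> 0" for x
      using that x3 by (auto simp: W_def w_def qweight_def case_prod_unfold indicator_def split: if_splits)
    fix i j k
    have "has_bochner_integral lborel (\<lambda>x. c (i, j, k) * H (i + k) x3 * fN q x3 *
       (case x of (x1, x2) \<Rightarrow> (w x1 * H (i + j) x1) * (w x2 * H (j + k) x2))) (v (i, j, k))"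
      unfolding v_def prod.case
      by (intro has_bochner_integral_mult_right has_bochner_integral_lborel_times wH)
    then show "has_bochner_integral lborel (\<lambda>x. tri_coeff q r12 r13 r23 (i, j, k) *
        tri_poly q (i, j, k) (fst x) (snd x) x3 * W x) (v (i, j, k))"
      by (simp add: W_def c_def tri_poly_def H_def case_prod_unfold mult_ac)
  qed
  moreover have "(\<Sum>\<^sub>\<infinity>p. c p * tri_poly q p (fst x) (snd x) x3) * W x =
      indicator (qsupp q \<times> qsupp q) x * (case x of (x1, x2) \<Rightarrow> f3D q r12 r13 r23 x1 x2 x3)" for x
    by (cases x) (simp add: W_def f3D_series[OF q1] c_def w_def qweight_def indicator_times mult_ac)
  moreover have "(\<Sum>\<^sub>\<infinity>p. v p) = fN q x3"
  proof -
    have "(\<Sum>\<^sub>\<infinity>p. v p) = (\<Sum>\<^sub>\<infinity>p\<in>{(0, 0, 0)}. v p)"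
      by (rule infsum_cong_neutral) (auto simp: v_def \<delta>_def split: if_splits)
    also have "\<dots> = fN q x3"
      by (simp add: v_def \<delta>_def c_def tri_coeff_def H_def)
    finally show ?thesis .
  qed
  ultimately show ?thesis unfolding has_lebesgue_integral_on_iff by simp
qed

lemma fCN_series:
  assumes q: "\<bar>q\<bar> < 1" and \<rho>: "\<bar>\<rho>\<bar> < 1" and x: "x \<in> qsupp q" and y: "y \<in> qsupp q"
  shows "fN q x * (\<Sum>\<^sub>\<infinity>j. \<rho> ^ j / qfact q j * (qHermite q j x * qHermite q j y)) = fCN q \<rho> x y"
proof -
  have q1: "q < 1" using q by simp
  define s where "s = sqrt (1 - q)"
  have s: "s > 0" "s * s = 1 - q" using q1 by (simp_all add: s_def)
  note X = qsupp_scaled(1)[OF q1 x, folded s_def] and Y = qsupp_scaled(1)[OF q1 y, folded s_def]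
  have eq: "\<rho> ^ j / qfact q j * (qHermite q j x * qHermite q j y) = mehler_coeff q (s * x) (s * y) j * \<rho> ^ j" for j
  proof -
    have "qfact q j = qp q j / (s ^ j * s ^ j)"
      using qfact_closed[of q j] q1 by (simp add: power_mult_distrib[symmetric] s)
    then show ?thesis using s(1)
      by (simp add: mehler_coeff_def s_def hq_qHermite[OF q1])
  qed
  have "(\<Sum>\<^sub>\<infinity>j. \<rho> ^ j / qfact q j * (qHermite q j x * qHermite q j y)) = (\<Sum>j. mehler_coeff q (s * x) (s * y) j * \<rho> ^ j)"
    unfolding eq using mehler_summable[OF q X Y \<rho>]
    by (intro infsumI norm_summable_imp_has_sum summable_sums) (auto intro: summable_norm_cancel)
  also have "\<dots> = qpoch_inf (\<rho>\<^sup>2) q * (\<Prod>k. 1 / v0 (s * x) (s * y) (\<rho> * q ^ k) 0)"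
    by (rule poisson_mehler[OF q X Y \<rho>])
  also have "\<dots> = qpoch_inf (\<rho>\<^sup>2) q * (\<Prod>k. 1 / v0 x y (\<rho> * q ^ k) q)"
    using v0_scale[of q x y] q1 by (simp add: s_def)
  finally show ?thesis using q1 by (simp add: fCN_def)
qed

lemma infsum_tri_diagonal:
  "(\<Sum>\<^sub>\<infinity>p. case p of (i::nat, j, k::nat) \<Rightarrow> if i = 0 \<and> k = 0 then a j else (0::real)) = (\<Sum>\<^sub>\<infinity>j::nat. a j)"
proof -
  have inj: "inj_on (\<lambda>j::nat. (0::nat, j, 0::nat)) UNIV" by (simp add: inj_on_def)
  have "(\<Sum>\<^sub>\<infinity>p. case p of (i::nat, j, k::nat) \<Rightarrow> if i = 0 \<and> k = 0 then a j else 0)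
     = (\<Sum>\<^sub>\<infinity>p\<in>range (\<lambda>j::nat. (0::nat, j, 0::nat)). case p of (i, j, k) \<Rightarrow> if i = 0 \<and> k = 0 then a j else 0)"
    by (rule infsum_cong_neutral) (auto split: prod.splits)
  also have "\<dots> = (\<Sum>\<^sub>\<infinity>j. a j)" by (subst infsum_reindex[OF inj]) (simp add: o_def)
  finally show ?thesis .
qed

text \<open>Integrating out \<open>x\<^sub>3\<close> leaves the terms with \<open>i = k = 0\<close>, which form the Poisson--Mehler series.\<close>

lemma f3D_marginal12:
  assumes q: "\<bar>q\<bar> < 1" and r: "\<bar>r12\<bar> < 1" "\<bar>r13\<bar> < 1" "\<bar>r23\<bar> < 1"
    and x1: "x1 \<in> qsupp q" and x2: "x2 \<in> qsupp q"
  shows "has_lebesgue_integral_on (\<lambda>x3. f3D q r12 r13 r23 x1 x2 x3) (fCN q r12 x1 x2 * fN q x2) (qsupp q)"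
proof -
  have q1: "q < 1" using q by simp
  define H where "H = qHermite q"
  define w where "w = qweight q"
  define c where "c = tri_coeff q r12 r13 r23"
  define N where "N = fN q x1 * fN q x2"
  define \<delta> :: "nat \<Rightarrow> real" where "\<delta> a = (if a = 0 then 1 else 0)" for a
  define v where "v = (\<lambda>(i, j, k). c (i, j, k) * H (i + j) x1 * H (j + k) x2 * N * \<delta> (i + k))"
  have wH: "has_bochner_integral lborel (\<lambda>x. w x * H a x) (\<delta> a)" for a
    using qHermite_orthogonal[OF q, of a 0] by (simp add: w_def H_def \<delta>_def if_distrib cong: if_cong)
  have "has_bochner_integral lborel (\<lambda>x. (\<Sum>\<^sub>\<infinity>p. c p * tri_poly q p x1 x2 x) * (w x * N)) (\<Sum>\<^sub>\<infinity>p. v p)"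
    unfolding c_def
  proof (rule has_bochner_integral_tri_series[OF q r])
    show "integrable lborel (\<lambda>x. w x * N)"
      using wH[of 0] by (simp add: has_bochner_integral_iff H_def)
    show "x1 \<in> qsupp q \<and> x2 \<in> qsupp q \<and> x \<in> qsupp q" if "w x * N \<noteq> 0" for x
      using that x1 x2 by (auto simp: w_def qweight_def indicator_def split: if_splits)
    fix i j k
    have "has_bochner_integral lborel (\<lambda>x. c (i, j, k) * H (i + j) x1 * H (j + k) x2 * N * (w x * H (i + k) x)) (v (i, j, k))"
      unfolding v_def prod.case by (intro has_bochner_integral_mult_right wH)
    then show "has_bochner_integral lborel (\<lambda>x. tri_coeff q r12 r13 r23 (i, j, k) *
        tri_poly q (i, j, k) x1 x2 x * (w x * N)) (v (i, j, k))"
      by (simp add: c_def tri_poly_def H_def mult_ac)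
  qed
  moreover have "(\<Sum>\<^sub>\<infinity>p. c p * tri_poly q p x1 x2 x) * (w x * N) = indicator (qsupp q) x * f3D q r12 r13 r23 x1 x2 x" for x
    by (simp add: f3D_series[OF q1] c_def w_def qweight_def N_def mult_ac)
  moreover have "(\<Sum>\<^sub>\<infinity>p. v p) = fCN q r12 x1 x2 * fN q x2"
  proof -
    have "v p = (case p of (i, j, k) \<Rightarrow> if i = 0 \<and> k = 0 then r12 ^ j / qfact q j * (H j x1 * H j x2) * N else 0)" for p
      by (auto simp: v_def \<delta>_def c_def tri_coeff_def split: prod.split)
    then have "(\<Sum>\<^sub>\<infinity>p. v p) = (\<Sum>\<^sub>\<infinity>j. r12 ^ j / qfact q j * (H j x1 * H j x2) * N)"
      by (simp only: infsum_tri_diagonal)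
    also have "\<dots> = fCN q r12 x1 x2 * fN q x2"
      unfolding fCN_series[OF q r(1) x1 x2, symmetric]
      by (simp only: infsum_cmult_left' N_def H_def) (simp only: mult_ac)
    finally show ?thesis .
  qed
  ultimately show ?thesis unfolding has_lebesgue_integral_on_iff by simp
qed

lemma f3D_independent3:
  assumes q: "\<bar>q\<bar> < 1" and r: "\<bar>\<rho>\<bar> < 1" and x1: "x1 \<in> qsupp q" and x2: "x2 \<in> qsupp q"
  shows "f3D q \<rho> 0 0 x1 x2 x3 = fCN q \<rho> x1 x2 * fN q x2 * fN q x3"
proof -
  have q1: "q < 1" using q by simp
  have "tri_coeff q \<rho> 0 0 p * tri_poly q p x1 x2 x3 =
     (case p of (i, j, k) \<Rightarrow> if i = 0 \<and> k = 0 then \<rho> ^ j / qfact q j * (qHermite q j x1 * qHermite q j x2) else 0)" for p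
    by (auto simp: tri_coeff_def tri_poly_def split: prod.split)
  then show ?thesis
    unfolding f3D_series[OF q1] fCN_series[OF q r x1 x2, symmetric]
    by (simp only: infsum_tri_diagonal mult_ac)
qed

section \<open>Hermite polynomials and the bivariate normal density\<close>

lemma normal_density_affine_iff:
  fixes f :: "real \<Rightarrow> 'a::{banach, second_countable_topology}"
  assumes "\<sigma> > 0"
  shows "has_bochner_integral lborel (\<lambda>y. normal_density m \<sigma> y *\<^sub>R f y) v
    \<longleftrightarrow> has_bochner_integral lborel (\<lambda>z. std_normal_density z *\<^sub>R f (m + \<sigma> * z)) v"
proof -
  have d: "normal_density m \<sigma> (m + \<sigma> * z) = std_normal_density z / \<sigma>" for z
    using assms by (simp add: normal_density_def power_mult_distrib real_sqrt_mult)
  have "has_bochner_integral lborel (\<lambda>y. normal_density m \<sigma> y *\<^sub>R f y) v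
    \<longleftrightarrow> has_bochner_integral lborel (\<lambda>z. (1 / \<sigma>) *\<^sub>R (std_normal_density z *\<^sub>R f (m + \<sigma> * z))) ((1 / \<sigma>) *\<^sub>R v)"
    using assms by (subst lborel_has_bochner_integral_real_affine_iff[of \<sigma> _ _ m])
      (simp_all add: d divideR_right inverse_eq_divide)
  also have "\<dots> \<longleftrightarrow> has_bochner_integral lborel (\<lambda>z. std_normal_density z *\<^sub>R f (m + \<sigma> * z)) v"
    using has_bochner_integral_scaleR_right[of "1 / \<sigma>" lborel "\<lambda>z. std_normal_density z *\<^sub>R f (m + \<sigma> * z)" v]
      has_bochner_integral_scaleR_right[of \<sigma> lborel "\<lambda>z. (1 / \<sigma>) *\<^sub>R (std_normal_density z *\<^sub>R f (m + \<sigma> * z))" "(1 / \<sigma>) *\<^sub>R v"]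
      assms by auto
  finally show ?thesis .
qed

lemma integrable_normal_poly:
  "integrable lborel (\<lambda>x. std_normal_density x * poly p x)"
proof -
  have "integrable lborel (\<lambda>x. \<Sum>i\<le>degree p. coeff p i * (std_normal_density x * x ^ i))"
    by (intro Bochner_Integration.integrable_sum integrable_mult_right integrable_std_normal_moment)
  then show ?thesis by (simp add: poly_altdef sum_distrib_left mult_ac)
qed

lemma normal_moment_rec:
  "(LINT x|lborel. std_normal_density x * x ^ Suc n) = real n * (LINT x|lborel. std_normal_density x * x ^ (n - 1))"
proof (cases "even n")
  case True
  then obtain k where n: "n = 2 * k" by (elim evenE)
  have "(LINT x|lborel. std_normal_density x * x ^ (2 * k + 1)) = 0"
    by (rule integral_std_normal_moment_odd)
  moreover have "(LINT x|lborel. std_normal_density x * x ^ (n - 1)) = 0" if "n \<noteq> 0"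
  proof -
    obtain j where "k = Suc j" using \<open>n \<noteq> 0\<close> n by (cases k) auto
    then have "n - 1 = 2 * j + 1" using n by simp
    then show ?thesis using integral_std_normal_moment_odd[of j] by simp
  qed
  ultimately show ?thesis using n by (cases "n = 0") simp_all
next
  case False
  then obtain k where n: "n = 2 * k + 1" by (elim oddE)
  have e: "Suc n = 2 * Suc k" "n - 1 = 2 * k" using n by simp_all
  have f: "(fact (2 * Suc k) :: real) = (2 * (real k + 1)) * (2 * real k + 1) * fact (2 * k)"
    by (simp add: algebra_simps)
  have g: "(2 * (a + 1)) * (2 * a + 1) * F / ((2 * P) * ((a + 1) * G)) = (2 * a + 1) * (F / (P * G))"
    if "P > 0" "G > 0" "a \<ge> 0" for a F P G :: real
    using that by (simp add: divide_simps)
  have "(fact (Suc k) :: real) = (real k + 1) * fact k" by simp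
  then show ?thesis unfolding e integral_std_normal_moment_even f power_Suc
    using g[of "2 ^ k" "fact k" "real k" "fact (2 * k)"] n by (simp add: add.commute)
qed

lemma pderiv_sum: "pderiv (\<Sum>i\<in>A. f i) = (\<Sum>i\<in>A. pderiv (f i))"
  by (induction A rule: infinite_finite_induct) (simp_all add: pderiv_add)

text \<open>Gaussian integration by parts, checked on monomials.\<close>

lemma stein_identity:
  "(LINT x|lborel. std_normal_density x * (x * poly p x)) = (LINT x|lborel. std_normal_density x * poly (pderiv p) x)"
proof -
  note i = integrable_mult_right[OF integrable_std_normal_moment]
  have "(LINT x|lborel. std_normal_density x * (x * poly p x)) =
     (LINT x|lborel. (\<Sum>i\<le>degree p. coeff p i * (std_normal_density x * x ^ Suc i)))"
    by (simp add: poly_altdef sum_distrib_left mult_ac)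
  also have "\<dots> = (\<Sum>i\<le>degree p. coeff p i * (LINT x|lborel. std_normal_density x * x ^ Suc i))"
    by (subst Bochner_Integration.integral_sum[OF i]) (simp only: Bochner_Integration.integral_mult_right_zero)
  also have "\<dots> = (\<Sum>i\<le>degree p. coeff p i * (real i * (LINT x|lborel. std_normal_density x * x ^ (i - 1))))"
    unfolding normal_moment_rec ..
  also have "\<dots> = (LINT x|lborel. (\<Sum>i\<le>degree p. (coeff p i * real i) * (std_normal_density x * x ^ (i - 1))))"
    by (subst Bochner_Integration.integral_sum[OF i]) (simp only: Bochner_Integration.integral_mult_right_zero mult.assoc)
  also have "\<dots> = (LINT x|lborel. std_normal_density x * poly (pderiv p) x)"
  proof (rule Bochner_Integration.integral_cong[OF refl])
    fix x :: real
    have "poly (pderiv p) x = poly (pderiv (\<Sum>i\<le>degree p. monom (coeff p i) i)) x"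
      by (simp only: poly_as_sum_of_monoms)
    also have "\<dots> = (\<Sum>i\<le>degree p. coeff p i * real i * x ^ (i - 1))"
      by (simp add: pderiv_sum pderiv_monom poly_sum poly_monom mult_ac)
    finally show "(\<Sum>i\<le>degree p. (coeff p i * real i) * (std_normal_density x * x ^ (i - 1))) = std_normal_density x * poly (pderiv p) x"
      by (simp add: sum_distrib_left mult_ac)
  qed
  finally show ?thesis .
qed

fun hermite_poly :: "nat \<Rightarrow> real poly" where
  "hermite_poly 0 = 1"
| "hermite_poly (Suc 0) = [:0, 1:]"
| "hermite_poly (Suc (Suc n)) = [:0, 1:] * hermite_poly (Suc n) - smult (real (Suc n)) (hermite_poly n)"

lemma qnum_1: "qnum 1 n = real n"
  by (simp add: qnum_def)

lemma poly_hermite_poly: "poly (hermite_poly n) x = qHermite 1 n x"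
  by (induction n rule: induct_nat_012) (simp_all add: qnum_1)

lemma pderiv_hermite_poly: "pderiv (hermite_poly (Suc n)) = smult (real (Suc n)) (hermite_poly n)"
proof (induction n rule: less_induct)
  case (less n)
  consider "n = 0" | "n = 1" | m where "n = Suc (Suc m)" by (metis One_nat_def not0_implies_Suc)
  then show ?case
  proof cases
    case 3
    have "pderiv (hermite_poly (Suc n)) = hermite_poly n + [:0, 1:] * pderiv (hermite_poly (Suc (Suc m)))
        - smult (real n) (pderiv (hermite_poly (Suc m)))"
      by (simp add: 3 pderiv_diff pderiv_mult pderiv_smult pderiv_pCons one_pCons[symmetric])
    also have "\<dots> = hermite_poly n + smult (real n) ([:0, 1:] * hermite_poly (Suc m) - smult (real (Suc m)) (hermite_poly m))"
      using less[of "Suc m"] less[of m] by (simp add: 3 algebra_simps smult_diff_right del: hermite_poly.simps)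
    also have "[:0, 1:] * hermite_poly (Suc m) - smult (real (Suc m)) (hermite_poly m) = hermite_poly n"
      by (simp add: 3)
    finally show ?thesis by (simp add: smult_add_left algebra_simps)
  qed (simp_all add: pderiv_pCons pderiv_diff pderiv_mult one_pCons)
qed

text \<open>The Hermite polynomials are eigenfunctions of the Ornstein--Uhlenbeck averages: by Stein's identity both sides
  satisfy the same recurrence in \<open>n\<close>.\<close>

lemma normal_hermite_mean:
  assumes "\<sigma>\<^sup>2 = 1 - \<rho>\<^sup>2"
  shows "(LINT z|lborel. std_normal_density z * qHermite 1 n (\<rho> * x + \<sigma> * z)) = \<rho> ^ n * qHermite 1 n x"
proof -
  define p where "p n = pcompose (hermite_poly n) [:\<rho> * x, \<sigma>:]" for n
  have p: "qHermite 1 n (\<rho> * x + \<sigma> * z) = poly (p n) z" for n z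
    by (simp add: p_def poly_pcompose poly_hermite_poly mult.commute)
  define T where "T n = (LINT z|lborel. std_normal_density z * poly (p n) z)" for n
  have "T n = \<rho> ^ n * qHermite 1 n x" for n
  proof (induction n rule: induct_nat_012)
    case 0
    show ?case by (simp add: T_def p_def one_pCons pcompose_pCons)
  next
    case 1
    have "(LINT z|lborel. std_normal_density z * (z * poly 1 z)) = 0"
      unfolding stein_identity by simp
    then have z: "(LINT z|lborel. std_normal_density z * z) = 0" by simp
    have "T (Suc 0) = (LINT z|lborel. \<rho> * x * std_normal_density z + \<sigma> * (std_normal_density z * z))"
      unfolding T_def by (rule Bochner_Integration.integral_cong) (simp_all add: p_def pcompose_pCons algebra_simps)
    also have "\<dots> = \<rho> * x"
      using integrable_std_normal_moment[of 1] z by simp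
    finally show ?case by simp
  next
    case (ge2 n)
    have dp: "pderiv (p (Suc n)) = smult (\<sigma> * real (Suc n)) (p n)"
      by (simp add: p_def pderiv_pcompose pderiv_hermite_poly pderiv_pCons pcompose_smult mult_ac del: hermite_poly.simps)
    have pr: "poly (p (Suc (Suc n))) z = (\<rho> * x + \<sigma> * z) * poly (p (Suc n)) z - real (Suc n) * poly (p n) z" for z
      by (simp add: p[symmetric] qnum_1)
    note i = integrable_normal_poly
    have iz: "integrable lborel (\<lambda>z. std_normal_density z * (z * poly p z))" for p
      using i[of "[:0, 1:] * p"] by simp
    have "T (Suc (Suc n)) = (LINT z|lborel. \<rho> * x * (std_normal_density z * poly (p (Suc n)) z)
       + \<sigma> * (std_normal_density z * (z * poly (p (Suc n)) z)) - real (Suc n) * (std_normal_density z * poly (p n) z))"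
      unfolding T_def pr by (simp add: algebra_simps)
    also have "\<dots> = \<rho> * x * T (Suc n) + \<sigma> * (LINT z|lborel. std_normal_density z * (z * poly (p (Suc n)) z)) - real (Suc n) * T n"
      unfolding T_def using i[of "p (Suc n)"] i[of "p n"] iz[of "p (Suc n)"] by simp
    also have "(LINT z|lborel. std_normal_density z * (z * poly (p (Suc n)) z)) = \<sigma> * real (Suc n) * T n"
      unfolding stein_identity dp T_def by (simp add: mult.left_commute[of "std_normal_density _"])
    also have "\<rho> * x * T (Suc n) + \<sigma> * (\<sigma> * real (Suc n) * T n) - real (Suc n) * T n =
       \<rho> * x * T (Suc n) - (1 - \<sigma>\<^sup>2) * real (Suc n) * T n" by (simp add: power2_eq_square algebra_simps)
    also have "\<dots> = \<rho> ^ Suc (Suc n) * qHermite 1 (Suc (Suc n)) x"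
      unfolding ge2 assms by (simp add: qnum_1 power2_eq_square algebra_simps)
    finally show ?case .
  qed
  then show ?thesis by (simp add: T_def p)
qed

lemma integrable_normal_hermite:
  "integrable lborel (\<lambda>x. std_normal_density x * (qHermite 1 n x * qHermite 1 m x))"
  using integrable_normal_poly[of "hermite_poly n * hermite_poly m"] by (simp add: poly_hermite_poly)

lemma hermite_orthogonal:
  "has_bochner_integral lborel (\<lambda>x. std_normal_density x * (qHermite 1 n x * qHermite 1 m x))
    (if n = m then qfact 1 n else 0)"
proof (rule qHermite_orthogonalI[OF integrable_normal_hermite])
  show "(LINT x|lborel. std_normal_density x * qHermite 1 n x) = (if n = 0 then 1 else 0)" for n
    using normal_hermite_mean[of 1 0 n 0] by (cases n) simp_all
qed

lemma has_bochner_integral_normal_hermite: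
  assumes "\<bar>\<rho>\<bar> < 1"
  shows "has_bochner_integral lborel (\<lambda>y. normal_density (\<rho> * x) (sqrt (1 - \<rho>\<^sup>2)) y * qHermite 1 n y) (\<rho> ^ n * qHermite 1 n x)"
proof -
  define \<sigma> where "\<sigma> = sqrt (1 - \<rho>\<^sup>2)"
  have "\<rho>\<^sup>2 < 1" using assms by (simp add: abs_square_less_1)
  then have \<sigma>: "\<sigma> > 0" "\<sigma>\<^sup>2 = 1 - \<rho>\<^sup>2" by (simp_all add: \<sigma>_def)
  have "integrable lborel (\<lambda>z. std_normal_density z * qHermite 1 n (\<rho> * x + \<sigma> * z))"
    using integrable_normal_poly[of "pcompose (hermite_poly n) [:\<rho> * x, \<sigma>:]"]
    by (simp add: poly_pcompose poly_hermite_poly mult.commute)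
  then have "has_bochner_integral lborel (\<lambda>z. std_normal_density z *\<^sub>R qHermite 1 n (\<rho> * x + \<sigma> * z)) (\<rho> ^ n * qHermite 1 n x)"
    using normal_hermite_mean[OF \<sigma>(2)] by (simp add: has_bochner_integral_iff)
  then show ?thesis
    unfolding \<sigma>_def[symmetric] by (subst (asm) normal_density_affine_iff[OF \<sigma>(1), symmetric]) simp
qed

definition bivariate_normal :: "real \<Rightarrow> real \<Rightarrow> real \<Rightarrow> real" where
  "bivariate_normal \<rho> x y = fCN 1 \<rho> x y * fN 1 y"

lemma bivariate_normal_sym:
  assumes "\<bar>\<rho>\<bar> < 1"
  shows "bivariate_normal \<rho> x y = bivariate_normal \<rho> y x"
proof -
  have u: "1 - \<rho>\<^sup>2 > 0" using assms by (simp add: abs_square_less_1)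
  have "- (x - \<rho> * y)\<^sup>2 / (2 * (1 - \<rho>\<^sup>2)) + - y\<^sup>2 / 2 = - (y - \<rho> * x)\<^sup>2 / (2 * (1 - \<rho>\<^sup>2)) + - x\<^sup>2 / 2"
    using u by (simp add: divide_simps) (simp add: power2_eq_square algebra_simps)
  then show ?thesis using u
    by (simp add: bivariate_normal_def fCN_def fN_def normal_density_def exp_add[symmetric] mult_exp_exp)
qed

lemma bivariate_normal_factor:
  assumes "\<bar>\<rho>\<bar> < 1"
  shows "bivariate_normal \<rho> x y = std_normal_density x * normal_density (\<rho> * x) (sqrt (1 - \<rho>\<^sup>2)) y"
  by (subst bivariate_normal_sym[OF assms]) (simp add: bivariate_normal_def fCN_def fN_def)

lemma bivariate_normal_nonneg: "0 \<le> bivariate_normal \<rho> x y"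
  by (simp add: bivariate_normal_def fCN_def fN_def)

lemma measurable_normal_density_joint [measurable]:
  assumes [measurable]: "m \<in> borel_measurable M" "f \<in> borel_measurable M"
  shows "(\<lambda>p. normal_density (m p) \<sigma> (f p)) \<in> borel_measurable M"
  unfolding normal_density_def by measurable

lemma borel_measurable_bivariate_normal [measurable]:
  assumes [measurable]: "f \<in> borel_measurable M" "g \<in> borel_measurable M"
  shows "(\<lambda>p. bivariate_normal \<rho> (f p) (g p)) \<in> borel_measurable M"
  unfolding bivariate_normal_def fCN_def fN_def by simp

text \<open>Each \<open>k x\<close> is a probability density, so integrability of the product is inherited from \<open>f\<close>.\<close>

lemma has_bochner_integral_kernel:
  fixes f :: "'a::euclidean_space \<Rightarrow> real" and k :: "'a \<Rightarrow> 'b::euclidean_space \<Rightarrow> real"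
  assumes f: "has_bochner_integral lborel f v"
    and k: "\<And>x. has_bochner_integral lborel (k x) 1" "\<And>x y. 0 \<le> k x y"
    and meas: "(\<lambda>(x, y). k x y) \<in> borel_measurable (lborel \<Otimes>\<^sub>M lborel)"
  shows "has_bochner_integral lborel (\<lambda>(x, y). f x * k x y) v"
proof -
  have [measurable]: "f \<in> borel_measurable lborel"
    using f by (auto simp: has_bochner_integral_iff)
  note [measurable] = meas
  have int: "integrable (lborel \<Otimes>\<^sub>M lborel) (\<lambda>(x, y). f x * k x y)"
    by (rule lborel_pair.Fubini_integrable)
       (use f k in \<open>auto simp: has_bochner_integral_iff abs_mult\<close>)
  moreover have "(\<integral>x. \<integral>y. f x * k x y \<partial>lborel \<partial>lborel) = v"
    using f k by (simp add: has_bochner_integral_iff)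
  ultimately show ?thesis
    using lborel_pair.integral_fst'[OF int] unfolding lborel_prod by (simp add: has_bochner_integral_iff)
qed

lemma has_bochner_integral_normal_density:
  "\<sigma> > 0 \<Longrightarrow> has_bochner_integral lborel (normal_density m \<sigma>) 1"
  by (simp add: has_bochner_integral_iff)

lemma sqrt_one_minus_pos: "\<bar>\<rho>\<bar> < 1 \<Longrightarrow> 0 < sqrt (1 - \<rho>\<^sup>2)"
  by (simp add: abs_square_less_1)

lemma bivariate_normal_marginal1:
  assumes \<rho>: "\<bar>\<rho>\<bar> < 1" and f: "has_bochner_integral lborel (\<lambda>x. std_normal_density x * f x) v"
  shows "has_bochner_integral lborel (\<lambda>(x, y). f x * bivariate_normal \<rho> x y) v"
  using has_bochner_integral_kernel[OF f has_bochner_integral_normal_density[OF sqrt_one_minus_pos[OF \<rho>]], of "\<lambda>x. \<rho> * x"]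
  by (simp add: bivariate_normal_factor[OF \<rho>] mult_ac)

lemma has_bochner_integral_swap:
  fixes f :: "'a::euclidean_space \<times> 'b::euclidean_space \<Rightarrow> real"
  assumes "has_bochner_integral lborel f v"
  shows "has_bochner_integral lborel (\<lambda>(x, y). f (y, x)) v"
proof -
  have i: "integrable (lborel \<Otimes>\<^sub>M lborel) f" "integral\<^sup>L (lborel \<Otimes>\<^sub>M lborel) f = v"
    using assms by (simp_all add: lborel_prod has_bochner_integral_iff)
  have "integrable (lborel \<Otimes>\<^sub>M lborel) (\<lambda>(x, y). f (y, x))"
    using lborel_pair.integrable_product_swap[OF i(1)] .
  moreover have "integral\<^sup>L (lborel \<Otimes>\<^sub>M lborel) (\<lambda>(x, y). f (y, x)) = v"
    using lborel_pair.integral_product_swap[of f] i by auto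
  ultimately show ?thesis by (simp add: lborel_prod has_bochner_integral_iff)
qed

text \<open>Integrability comes from \<open>|a b| \<le> a\<^sup>2 + b\<^sup>2\<close>, which reduces it to the one-dimensional marginals.\<close>

lemma bivariate_normal_hermite:
  assumes \<rho>: "\<bar>\<rho>\<bar> < 1"
  shows "has_bochner_integral lborel (\<lambda>(x, y). qHermite 1 n x * qHermite 1 m y * bivariate_normal \<rho> x y)
    (if n = m then \<rho> ^ n * qfact 1 n else 0)"
proof -
  define H where "H = qHermite 1"
  have [measurable]: "H n \<in> borel_measurable borel" for n
    unfolding H_def by (intro borel_measurable_continuous_onI continuous_intros)
  have sq: "integrable lborel (\<lambda>(x, y). (H n x * H n x) * bivariate_normal \<rho> x y)" for n
    using bivariate_normal_marginal1[OF \<rho> hermite_orthogonal[of n n]]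
    by (simp add: has_bochner_integral_iff H_def)
  have sq': "integrable lborel (\<lambda>(x, y). (H n y * H n y) * bivariate_normal \<rho> x y)" for n
    using has_bochner_integral_swap[OF bivariate_normal_marginal1[OF \<rho> hermite_orthogonal[of n n]]]
    by (simp add: has_bochner_integral_iff H_def bivariate_normal_sym[OF \<rho>])
  have int: "integrable lborel (\<lambda>(x, y). H n x * H m y * bivariate_normal \<rho> x y)"
  proof (rule Bochner_Integration.integrable_bound[OF Bochner_Integration.integrable_add[OF sq[of n] sq'[of m]]])
    show "(\<lambda>(x, y). H n x * H m y * bivariate_normal \<rho> x y) \<in> borel_measurable lborel"
      unfolding lborel_prod[symmetric] by measurable
    show "AE p in lborel. norm (case p of (x, y) \<Rightarrow> H n x * H m y * bivariate_normal \<rho> x y)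
      \<le> norm ((case p of (x, y) \<Rightarrow> H n x * H n x * bivariate_normal \<rho> x y) + (case p of (x, y) \<Rightarrow> H m y * H m y * bivariate_normal \<rho> x y))"
    proof (intro AE_I2, clarify)
      fix x y
      have "\<bar>a * b\<bar> \<le> a * a + b * b" for a b :: real
      proof -
        have "2 * \<bar>a\<bar> * \<bar>b\<bar> \<le> a * a + b * b"
          using sum_squares_bound[of "\<bar>a\<bar>" "\<bar>b\<bar>"] by (simp add: power2_eq_square)
        moreover have "0 \<le> \<bar>a\<bar> * \<bar>b\<bar>" by simp
        ultimately show ?thesis unfolding abs_mult by linarith
      qed
      then have "\<bar>H n x * H m y\<bar> * bivariate_normal \<rho> x y \<le> (H n x * H n x + H m y * H m y) * bivariate_normal \<rho> x y"
        by (intro mult_right_mono bivariate_normal_nonneg)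
      then show "norm (H n x * H m y * bivariate_normal \<rho> x y)
        \<le> norm (H n x * H n x * bivariate_normal \<rho> x y + H m y * H m y * bivariate_normal \<rho> x y)"
        using bivariate_normal_nonneg[of \<rho> x y] by (simp add: abs_mult distrib_right)
    qed
  qed
  have "integral\<^sup>L lborel (\<lambda>(x, y). H n x * H m y * bivariate_normal \<rho> x y) =
    (\<integral>x. \<integral>y. H n x * H m y * bivariate_normal \<rho> x y \<partial>lborel \<partial>lborel)"
    using lborel_pair.integral_fst'[of "\<lambda>(x, y). H n x * H m y * bivariate_normal \<rho> x y"] int by (simp add: lborel_prod)
  also have "\<dots> = (\<integral>x. std_normal_density x * H n x * (\<rho> ^ m * H m x) \<partial>lborel)"
  proof (rule Bochner_Integration.integral_cong[OF refl])
    fix x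
    have "has_bochner_integral lborel (\<lambda>y. std_normal_density x * H n x * (normal_density (\<rho> * x) (sqrt (1 - \<rho>\<^sup>2)) y * H m y))
       (std_normal_density x * H n x * (\<rho> ^ m * H m x))"
      unfolding H_def by (intro has_bochner_integral_mult_right has_bochner_integral_normal_hermite \<rho>)
    then show "(\<integral>y. H n x * H m y * bivariate_normal \<rho> x y \<partial>lborel) = std_normal_density x * H n x * (\<rho> ^ m * H m x)"
      unfolding bivariate_normal_factor[OF \<rho>] by (simp add: has_bochner_integral_iff mult_ac)
  qed
  also have "\<dots> = \<rho> ^ m * (\<integral>x. std_normal_density x * (H n x * H m x) \<partial>lborel)"
    by (subst Bochner_Integration.integral_mult_right_zero[symmetric]) (simp only: mult_ac)
  also have "\<dots> = (if n = m then \<rho> ^ n * qfact 1 n else 0)"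
    using hermite_orthogonal[of n m] by (simp add: has_bochner_integral_iff H_def)
  finally show ?thesis using int by (simp add: has_bochner_integral_iff H_def)
qed

section \<open>The Gaussian density in three variables\<close>

lemma has_bochner_integral_distr_iff:
  fixes f :: "'b \<Rightarrow> real"
  assumes "T \<in> measurable M N" "f \<in> borel_measurable N"
  shows "has_bochner_integral (distr M N T) f v \<longleftrightarrow> has_bochner_integral M (\<lambda>x. f (T x)) v"
  using assms by (simp add: has_bochner_integral_iff integrable_distr_eq integral_distr)

lemma has_bochner_integral_distr_imp:
  fixes f :: "'b \<Rightarrow> real"
  assumes T: "T \<in> measurable M N" and f: "has_bochner_integral (distr M N T) f v"
  shows "has_bochner_integral M (\<lambda>x. f (T x)) v"
proof -
  have "f \<in> borel_measurable N" using f by (auto simp: has_bochner_integral_iff)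
  from has_bochner_integral_distr_iff[OF T this] f show ?thesis by (rule iffD1)
qed

lemma distr_lborelI:
  fixes T :: "'a::euclidean_space \<Rightarrow> 'b::euclidean_space"
  assumes T: "T \<in> borel_measurable borel"
    and "\<And>f. f \<in> borel_measurable borel \<Longrightarrow> (\<integral>\<^sup>+p. f (T p) \<partial>lborel) = (\<integral>\<^sup>+p. f p \<partial>lborel)"
  shows "distr lborel borel T = lborel"
proof (rule measure_eqI)
  fix A assume "A \<in> sets (distr lborel borel T)"
  then have A: "A \<in> sets borel" by simp
  have "emeasure (distr lborel borel T) A = (\<integral>\<^sup>+p. indicator A p \<partial>distr lborel borel T)"
    using A by simp
  also have "\<dots> = (\<integral>\<^sup>+p. indicator A (T p) \<partial>lborel)"
    using T A by (subst nn_integral_distr) auto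
  also have "\<dots> = (\<integral>\<^sup>+p. indicator A p \<partial>lborel)" using A by (intro assms) auto
  finally show "emeasure (distr lborel borel T) A = emeasure lborel A" using A by simp
qed simp

lemma nn_integral_lborel_pair:
  fixes f :: "'a::euclidean_space \<times> 'b::euclidean_space \<Rightarrow> ennreal"
  assumes "f \<in> borel_measurable borel"
  shows "(\<integral>\<^sup>+p. f p \<partial>lborel) = (\<integral>\<^sup>+x. \<integral>\<^sup>+y. f (x, y) \<partial>lborel \<partial>lborel)"
proof -
  have "f \<in> borel_measurable (lborel \<Otimes>\<^sub>M lborel)" using assms by (simp add: lborel_prod)
  from lborel.nn_integral_fst[OF this] show ?thesis by (simp add: lborel_prod)
qed

lemma nn_integral_lborel_triple:
  fixes f :: "real \<times> real \<times> real \<Rightarrow> ennreal"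
  assumes f [measurable]: "f \<in> borel_measurable borel"
  shows "(\<integral>\<^sup>+p. f p \<partial>lborel) = (\<integral>\<^sup>+x. \<integral>\<^sup>+y. \<integral>\<^sup>+z. f (x, y, z) \<partial>lborel \<partial>lborel \<partial>lborel)"
proof -
  have "(\<integral>\<^sup>+q. f (x, q) \<partial>lborel) = (\<integral>\<^sup>+y. \<integral>\<^sup>+z. f (x, y, z) \<partial>lborel \<partial>lborel)" for x
    by (rule nn_integral_lborel_pair) measurable
  then show ?thesis by (simp add: nn_integral_lborel_pair)
qed

text \<open>Transpositions of coordinates preserve Lebesgue measure, so that a claim about one pair of indices yields
  the claims about the others.\<close>

lemma lborel_swap23: "distr lborel borel (\<lambda>(x::real, y::real, z::real). (x, z, y)) = lborel"
proof (rule distr_lborelI)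
  show T [measurable]: "(\<lambda>(x::real, y::real, z::real). (x, z, y)) \<in> borel_measurable borel"
    by (simp add: borel_prod[symmetric])
  fix f :: "real \<times> real \<times> real \<Rightarrow> ennreal" assume f [measurable]: "f \<in> borel_measurable borel"
  have [measurable]: "f \<in> borel_measurable (borel \<Otimes>\<^sub>M (borel \<Otimes>\<^sub>M borel))" by (simp add: borel_prod)
  have "(\<integral>\<^sup>+p. f (case p of (x, y, z) \<Rightarrow> (x, z, y)) \<partial>lborel) = (\<integral>\<^sup>+x. \<integral>\<^sup>+y. \<integral>\<^sup>+z. f (x, z, y) \<partial>lborel \<partial>lborel \<partial>lborel)"
    by (subst nn_integral_lborel_triple) auto
  also have "\<dots> = (\<integral>\<^sup>+x. \<integral>\<^sup>+z. \<integral>\<^sup>+y. f (x, z, y) \<partial>lborel \<partial>lborel \<partial>lborel)"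
    by (intro nn_integral_cong lborel_pair.Fubini') measurable
  finally show "(\<integral>\<^sup>+p. f (case p of (x, y, z) \<Rightarrow> (x, z, y)) \<partial>lborel) = (\<integral>\<^sup>+p. f p \<partial>lborel)"
    by (simp add: nn_integral_lborel_triple)
qed

lemma lborel_swap12: "distr lborel borel (\<lambda>(x::real, y::real, z::real). (y, x, z)) = lborel"
proof (rule distr_lborelI)
  show T [measurable]: "(\<lambda>(x::real, y::real, z::real). (y, x, z)) \<in> borel_measurable borel"
    by (simp add: borel_prod[symmetric])
  fix f :: "real \<times> real \<times> real \<Rightarrow> ennreal" assume f [measurable]: "f \<in> borel_measurable borel"
  have [measurable]: "f \<in> borel_measurable (borel \<Otimes>\<^sub>M (borel \<Otimes>\<^sub>M borel))" by (simp add: borel_prod)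
  have "(\<integral>\<^sup>+p. f (case p of (x, y, z) \<Rightarrow> (y, x, z)) \<partial>lborel) = (\<integral>\<^sup>+x. \<integral>\<^sup>+y. \<integral>\<^sup>+z. f (y, x, z) \<partial>lborel \<partial>lborel \<partial>lborel)"
    by (subst nn_integral_lborel_triple) auto
  also have "\<dots> = (\<integral>\<^sup>+y. \<integral>\<^sup>+x. \<integral>\<^sup>+z. f (y, x, z) \<partial>lborel \<partial>lborel \<partial>lborel)"
    by (intro lborel_pair.Fubini') measurable
  finally show "(\<integral>\<^sup>+p. f (case p of (x, y, z) \<Rightarrow> (y, x, z)) \<partial>lborel) = (\<integral>\<^sup>+p. f p \<partial>lborel)"
    by (simp add: nn_integral_lborel_triple)
qed

lemma measurable_assoc [measurable]:
  "(\<lambda>((x::real, y::real), z::real). (x, y, z)) \<in> borel_measurable borel"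
  by (simp add: borel_prod[symmetric] case_prod_unfold)

lemma lborel_assoc: "distr lborel borel (\<lambda>((x::real, y::real), z::real). (x, y, z)) = lborel"
proof (rule distr_lborelI)
  show "(\<lambda>((x::real, y::real), z::real). (x, y, z)) \<in> borel_measurable borel"
    by (rule measurable_assoc)
  fix f :: "real \<times> real \<times> real \<Rightarrow> ennreal" assume f [measurable]: "f \<in> borel_measurable borel"
  have [measurable]: "f \<in> borel_measurable (borel \<Otimes>\<^sub>M (borel \<Otimes>\<^sub>M borel))" by (simp add: borel_prod)
  have "(\<integral>\<^sup>+p. f ((\<lambda>((x, y), z). (x, y, z)) p) \<partial>lborel) = (\<integral>\<^sup>+q. \<integral>\<^sup>+z. f (fst q, snd q, z) \<partial>lborel \<partial>lborel)"
    using measurable_compose[OF measurable_assoc f]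
    by (subst nn_integral_lborel_pair) (auto simp: case_prod_unfold)
  also have "\<dots> = (\<integral>\<^sup>+x. \<integral>\<^sup>+y. \<integral>\<^sup>+z. f (x, y, z) \<partial>lborel \<partial>lborel \<partial>lborel)"
    by (subst nn_integral_lborel_pair) (simp_all add: borel_prod[symmetric])
  finally show "(\<integral>\<^sup>+p. f ((\<lambda>((x, y), z). (x, y, z)) p) \<partial>lborel) = (\<integral>\<^sup>+p. f p \<partial>lborel)"
    by (simp add: nn_integral_lborel_triple)
qed

lemma has_bochner_integral_swap12:
  fixes f :: "real \<times> real \<times> real \<Rightarrow> real"
  assumes "has_bochner_integral lborel f v"
  shows "has_bochner_integral lborel (\<lambda>(x, y, z). f (y, x, z)) v"
proof -
  have "(\<lambda>(x::real, y::real, z::real). (y, x, z)) \<in> borel_measurable borel"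
    by (simp add: borel_prod[symmetric])
  then have "(\<lambda>(x::real, y::real, z::real). (y, x, z)) \<in> borel_measurable lborel" by simp
  from has_bochner_integral_distr_imp[OF this, unfolded lborel_swap12, OF assms]
  show ?thesis by (simp add: case_prod_unfold)
qed

lemma has_bochner_integral_swap23:
  fixes f :: "real \<times> real \<times> real \<Rightarrow> real"
  assumes "has_bochner_integral lborel f v"
  shows "has_bochner_integral lborel (\<lambda>(x, y, z). f (x, z, y)) v"
proof -
  have "(\<lambda>(x::real, y::real, z::real). (x, z, y)) \<in> borel_measurable borel"
    by (simp add: borel_prod[symmetric])
  then have "(\<lambda>(x::real, y::real, z::real). (x, z, y)) \<in> borel_measurable lborel" by simp
  from has_bochner_integral_distr_imp[OF this, unfolded lborel_swap23, OF assms]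
  show ?thesis by (simp add: case_prod_unfold)
qed

lemma has_bochner_integral_assoc:
  fixes f :: "real \<times> real \<times> real \<Rightarrow> real"
  assumes "has_bochner_integral lborel (\<lambda>((x, y), z). f (x, y, z)) v" and f: "f \<in> borel_measurable borel"
  shows "has_bochner_integral lborel f v"
proof -
  note measurable_assoc
  moreover have "has_bochner_integral lborel (\<lambda>p. f ((\<lambda>((x, y), z). (x, y, z)) p)) v"
    using assms by (simp add: case_prod_unfold)
  ultimately show ?thesis
    using f by (subst (asm) has_bochner_integral_distr_iff[of _ _ borel f, symmetric]) (simp_all add: lborel_assoc)
qed

lemma matrix_inv_eqI:
  fixes A B :: "real ^ 'n ^ 'n"
  assumes "A ** B = mat 1" "B ** A = mat 1"
  shows "matrix_inv A = B"
proof -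
  have "A ** matrix_inv A = mat 1 \<and> matrix_inv A ** A = mat 1"
    (is ?inv) unfolding matrix_inv_def by (rule someI[of _ B]) (use assms in simp)
  have "matrix_inv A = B ** (A ** matrix_inv A)"
    using assms by (simp only: matrix_mul_assoc matrix_mul_lid)
  also have "\<dots> = B"
    using \<open>?inv\<close> by (simp only: matrix_mul_rid)
  finally show ?thesis .
qed

definition corr_det :: "real \<Rightarrow> real \<Rightarrow> real \<Rightarrow> real" where
  "corr_det a b c = 1 + 2 * a * b * c - a\<^sup>2 - b\<^sup>2 - c\<^sup>2"

lemma det_corr_matrix3: "det (corr_matrix3 a b c) = corr_det a b c"
  by (simp add: det_3 corr_matrix3_def corr_det_def power2_eq_square algebra_simps)

lemma f3D_gaussian:
  assumes D: "corr_det a b c > 0"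
  shows "f3D 1 a b c x y z =
    exp (- (((1 - c\<^sup>2) * x\<^sup>2 + (1 - b\<^sup>2) * y\<^sup>2 + (1 - a\<^sup>2) * z\<^sup>2
       + 2 * (b * c - a) * x * y + 2 * (a * c - b) * x * z + 2 * (a * b - c) * y * z) / corr_det a b c) / 2)
      / sqrt ((2 * pi) ^ 3 * corr_det a b c)"
proof -
  define D where "D = corr_det a b c"
  define B :: "real ^ 3 ^ 3" where
    "B = vector [vector [(1 - c\<^sup>2) / D, (b * c - a) / D, (a * c - b) / D],
                 vector [(b * c - a) / D, (1 - b\<^sup>2) / D, (a * b - c) / D],
                 vector [(a * c - b) / D, (a * b - c) / D, (1 - a\<^sup>2) / D]]"
  have D0: "D \<noteq> 0" using D by (simp add: D_def)
  have "corr_matrix3 a b c ** B = mat 1" "B ** corr_matrix3 a b c = mat 1"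
    unfolding B_def corr_matrix3_def using D0
    by (auto simp: vec_eq_iff forall_3 matrix_matrix_mult_def sum_3 mat_def field_simps)
       (auto simp: D_def corr_det_def power2_eq_square algebra_simps)
  then have inv: "matrix_inv (corr_matrix3 a b c) = B" by (rule matrix_inv_eqI)
  have q: "vector [x, y, z] \<bullet> (B *v vector [x, y, z]) =
     ((1 - c\<^sup>2) * x\<^sup>2 + (1 - b\<^sup>2) * y\<^sup>2 + (1 - a\<^sup>2) * z\<^sup>2
       + 2 * (b * c - a) * x * y + 2 * (a * c - b) * x * z + 2 * (a * b - c) * y * z) / D"
    using D0 by (simp add: B_def inner_vec_def sum_3 matrix_vector_mult_def field_simps)
       (simp add: power2_eq_square algebra_simps)
  show ?thesis
    unfolding f3D_def centered_gaussian_density_def inv det_corr_matrix3 q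
    by (simp add: D_def)
qed

lemma corr_det_sym12: "corr_det a b c = corr_det a c b"
  by (simp add: corr_det_def algebra_simps)

lemma corr_det_sym23: "corr_det a b c = corr_det b a c"
  by (simp add: corr_det_def algebra_simps)

text \<open>The last factor is the conditional density of \<open>z\<close>: its mean is the regression of \<open>z\<close> on \<open>x\<close> and \<open>y\<close>, and its
  variance the quotient of the determinants.\<close>

lemma f3D_gaussian_factor:
  assumes D: "corr_det a b c > 0" and a: "\<bar>a\<bar> < 1"
  shows "f3D 1 a b c x y z = bivariate_normal a x y *
    normal_density (((b - a * c) * x + (c - a * b) * y) / (1 - a\<^sup>2)) (sqrt (corr_det a b c / (1 - a\<^sup>2))) z"
proof -
  define u where "u = 1 - a\<^sup>2"
  define D where "D = corr_det a b c"
  have u: "u > 0" using a by (simp add: u_def abs_square_less_1)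
  have D0: "D > 0" using D by (simp add: D_def)
  define Q where "Q = (1 - c\<^sup>2) * x\<^sup>2 + (1 - b\<^sup>2) * y\<^sup>2 + (1 - a\<^sup>2) * z\<^sup>2
       + 2 * (b * c - a) * x * y + 2 * (a * c - b) * x * z + 2 * (a * b - c) * y * z"
  define L where "L = (b - a * c) * x + (c - a * b) * y"
  have key: "u * Q = D * (x - a * y)\<^sup>2 + u * D * y\<^sup>2 + (u * z - L)\<^sup>2"
    unfolding Q_def L_def D_def u_def corr_det_def by algebra
  have z: "(z - L / u)\<^sup>2 = (u * z - L)\<^sup>2 / u\<^sup>2"
    using u by (simp add: power_divide[symmetric] diff_divide_distrib)
  have "Q / D = (u * Q) / (u * D)" using u by simp
  also have "\<dots> = (x - a * y)\<^sup>2 / u + y\<^sup>2 + (z - L / u)\<^sup>2 / (D / u)"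
    unfolding key z using u D0 by (simp add: add_divide_distrib power2_eq_square)
  finally have e: "- (Q / D) / 2 = - (x - a * y)\<^sup>2 / (2 * u) + (- y\<^sup>2 / 2 + - (z - L / u)\<^sup>2 / (2 * (D / u)))"
    by (simp add: field_simps)
  have s: "sqrt ((2 * pi) ^ 3 * D) = sqrt (2 * pi * u) * (sqrt (2 * pi) * sqrt (2 * pi * (D / u)))"
    using u by (simp add: real_sqrt_mult[symmetric] power3_eq_cube mult_ac)
  have su: "(sqrt u)\<^sup>2 = u" "(sqrt (D / u))\<^sup>2 = D / u" using u D0 by simp_all
  have "f3D 1 a b c x y z = exp (- (Q / D) / 2) / sqrt ((2 * pi) ^ 3 * D)"
    unfolding f3D_gaussian[OF D] Q_def D_def ..
  also have "\<dots> = (1 / sqrt (2 * pi * u) * exp (- (x - a * y)\<^sup>2 / (2 * u))) * (1 / sqrt (2 * pi) * exp (- y\<^sup>2 / 2))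
      * (1 / sqrt (2 * pi * (D / u)) * exp (- (z - L / u)\<^sup>2 / (2 * (D / u))))"
    unfolding e s exp_add by (simp only: divide_inverse inverse_mult_distrib mult_ac mult_1)
  also have "\<dots> = bivariate_normal a x y * normal_density (L / u) (sqrt (D / u)) z"
    unfolding bivariate_normal_def fCN_def fN_def normal_density_def u_def[symmetric] su
    by simp
  finally show ?thesis unfolding L_def u_def D_def .
qed

lemma normal_kernel_sd_pos:
  assumes "corr_det a b c > 0" "\<bar>a\<bar> < 1"
  shows "0 < sqrt (corr_det a b c / (1 - a\<^sup>2))"
  using assms by (simp add: abs_square_less_1)

lemma borel_measurable_f3D_gaussian [measurable]:
  assumes "corr_det a b c > 0" "\<bar>a\<bar> < 1"
    and [measurable]: "f \<in> borel_measurable M" "g \<in> borel_measurable M" "h \<in> borel_measurable M"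
  shows "(\<lambda>p. f3D 1 a b c (f p) (g p) (h p)) \<in> borel_measurable M"
  unfolding f3D_gaussian_factor[OF assms(1,2)] by measurable

lemma f3D_gaussian_moment12:
  assumes D: "corr_det a b c > 0" and a: "\<bar>a\<bar> < 1"
  shows "has_bochner_integral lborel (\<lambda>(x, y, z). qHermite 1 n x * qHermite 1 m y * f3D 1 a b c x y z)
    (if n = m then a ^ n * qfact 1 n else 0)"
proof (rule has_bochner_integral_assoc)
  have [measurable]: "qHermite 1 n \<in> borel_measurable borel" for n
    by (intro borel_measurable_continuous_onI continuous_intros)
  have "has_bochner_integral lborel (\<lambda>(p, z). (case p of (x, y) \<Rightarrow> qHermite 1 n x * qHermite 1 m y * bivariate_normal a x y) *
     normal_density (((b - a * c) * fst p + (c - a * b) * snd p) / (1 - a\<^sup>2)) (sqrt (corr_det a b c / (1 - a\<^sup>2))) z)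
     (if n = m then a ^ n * qfact 1 n else 0)"
    by (rule has_bochner_integral_kernel[OF bivariate_normal_hermite[OF a] has_bochner_integral_normal_density[OF normal_kernel_sd_pos[OF D a]]])
       (simp_all add: lborel_prod[symmetric])
  then show "has_bochner_integral lborel (\<lambda>((x, y), z). case (x, y, z) of (x, y, z) \<Rightarrow> qHermite 1 n x * qHermite 1 m y * f3D 1 a b c x y z)
     (if n = m then a ^ n * qfact 1 n else 0)"
    unfolding f3D_gaussian_factor[OF D a] by (simp add: case_prod_unfold mult_ac)
  have "(\<lambda>(x, y, z). qHermite 1 n x * qHermite 1 m y * f3D 1 a b c x y z) \<in> borel_measurable (borel \<Otimes>\<^sub>M (borel \<Otimes>\<^sub>M borel))"
    using D a by measurable
  then show "(\<lambda>(x, y, z). qHermite 1 n x * qHermite 1 m y * f3D 1 a b c x y z) \<in> borel_measurable borel"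
    by (simp add: borel_prod)
qed

lemma f3D_gaussian_marginal12:
  assumes D: "corr_det a b c > 0" and a: "\<bar>a\<bar> < 1"
  shows "has_bochner_integral lborel (\<lambda>z. f3D 1 a b c x y z) (fCN 1 a x y * fN 1 y)"
  unfolding f3D_gaussian_factor[OF D a]
  using has_bochner_integral_mult_right[OF has_bochner_integral_normal_density[OF normal_kernel_sd_pos[OF D a]], of "bivariate_normal a x y"]
  by (simp add: bivariate_normal_def)

lemma f3D_sym12_less: 
  assumes "q < 1"
  shows "f3D q a b c x y z = f3D q a c b y x z"
proof -
  have "bij (\<lambda>(i::nat, j::nat, k::nat). (k, j, i))"
    by (rule o_bij[of "\<lambda>(i, j, k). (k, j, i)"]) (auto simp: fun_eq_iff)
  from infsum_reindex_bij_betw[OF this, of "\<lambda>p. tri_coeff q a c b p * tri_poly q p y x z"]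
  have "(\<Sum>\<^sub>\<infinity>p. tri_coeff q a c b p * tri_poly q p y x z) = (\<Sum>\<^sub>\<infinity>p. tri_coeff q a b c p * tri_poly q p x y z)"
    by (simp add: tri_coeff_def tri_poly_def case_prod_unfold add.commute mult_ac)
  then show ?thesis unfolding f3D_series[OF assms] by simp
qed

lemma f3D_sym23_less:
  assumes "q < 1"
  shows "f3D q a b c x y z = f3D q b a c x z y"
proof -
  have "bij (\<lambda>(i::nat, j::nat, k::nat). (j, i, k))"
    by (rule o_bij[of "\<lambda>(i, j, k). (j, i, k)"]) (auto simp: fun_eq_iff)
  from infsum_reindex_bij_betw[OF this, of "\<lambda>p. tri_coeff q b a c p * tri_poly q p x z y"]
  have "(\<Sum>\<^sub>\<infinity>p. tri_coeff q b a c p * tri_poly q p x z y) = (\<Sum>\<^sub>\<infinity>p. tri_coeff q a b c p * tri_poly q p x y z)"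
    by (simp add: tri_coeff_def tri_poly_def case_prod_unfold add.commute mult_ac)
  then show ?thesis unfolding f3D_series[OF assms] by simp
qed

lemma f3D_sym12:
  assumes "q \<le> 1" "q < 1 \<or> corr_det a b c > 0"
  shows "f3D q a b c x y z = f3D q a c b y x z"
proof (cases "q < 1")
  case False
  then have "q = 1" "corr_det a b c > 0" "corr_det a c b > 0" using assms by (simp_all add: corr_det_sym12[of a c b])
  then show ?thesis by (simp add: f3D_gaussian corr_det_sym12[of a b c] algebra_simps)
qed (rule f3D_sym12_less)

lemma f3D_sym23:
  assumes "q \<le> 1" "q < 1 \<or> corr_det a b c > 0"
  shows "f3D q a b c x y z = f3D q b a c x z y"
proof (cases "q < 1")
  case False
  then have "q = 1" "corr_det a b c > 0" "corr_det b a c > 0" using assms by (simp_all add: corr_det_sym23[of b a c])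
  then show ?thesis by (simp add: f3D_gaussian corr_det_sym23[of a b c] algebra_simps)
qed (rule f3D_sym23_less)

lemma f3D_gaussian_marginal3:
  assumes D: "corr_det a b c > 0" and a: "\<bar>a\<bar> < 1" and b: "\<bar>b\<bar> < 1"
  shows "has_bochner_integral lborel (\<lambda>(x, y). f3D 1 a b c x y z) (fN 1 z)"
proof -
  have D': "corr_det b a c > 0" using D corr_det_sym23[of a b c] by simp
  have sym: "f3D 1 a b c x y z = f3D 1 b a c x z y" for x y
    using f3D_sym23[of 1 a b c x y z] D by simp
  have f: "has_bochner_integral lborel (\<lambda>x. bivariate_normal b x z) (fN 1 z)"
    using has_bochner_integral_mult_left[OF has_bochner_integral_normal_density[OF sqrt_one_minus_pos[OF b], of "b * z"], of "fN 1 z"]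
    by (simp add: bivariate_normal_def fCN_def)
  show ?thesis unfolding sym f3D_gaussian_factor[OF D' b]
    by (rule has_bochner_integral_kernel[OF f has_bochner_integral_normal_density[OF normal_kernel_sd_pos[OF D' b]]])
       simp_all
qed

section \<open>The degenerate Gaussian law\<close>

definition bivariate_normal_law :: "real \<Rightarrow> (real \<times> real) measure" where
  "bivariate_normal_law \<rho> = density lborel (\<lambda>(x, y). ennreal (bivariate_normal \<rho> x y))"

lemma sets_bivariate_normal_law [measurable_cong, simp]: "sets (bivariate_normal_law \<rho>) = sets borel"
  by (simp add: bivariate_normal_law_def)

lemma space_bivariate_normal_law [simp]: "space (bivariate_normal_law \<rho>) = UNIV"
  by (simp add: bivariate_normal_law_def)

lemma borel_measurable_bivariate_normal_pair [measurable]: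
  "(\<lambda>(x, y). bivariate_normal \<rho> x y) \<in> borel_measurable borel"
  by (simp add: borel_prod[symmetric] case_prod_unfold)

lemma borel_measurable_bivariate_normal_fst_snd [measurable]:
  "(\<lambda>p. bivariate_normal \<rho> (fst p) (snd p)) \<in> borel_measurable borel"
  using borel_measurable_bivariate_normal_pair by (simp add: case_prod_unfold)

lemma nn_integral_bivariate_normal_law:
  assumes [measurable]: "f \<in> borel_measurable borel"
  shows "(\<integral>\<^sup>+p. f p \<partial>bivariate_normal_law \<rho>) = (\<integral>\<^sup>+x. \<integral>\<^sup>+y. ennreal (bivariate_normal \<rho> x y) * f (x, y) \<partial>lborel \<partial>lborel)"
proof -
  have "(\<lambda>p. ennreal (case p of (x, y) \<Rightarrow> bivariate_normal \<rho> x y)) \<in> borel_measurable borel"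
    by measurable
  then have "(\<lambda>p. (case p of (x, y) \<Rightarrow> ennreal (bivariate_normal \<rho> x y)) * f p) \<in> borel_measurable borel"
    "(\<lambda>(x, y). ennreal (bivariate_normal \<rho> x y)) \<in> borel_measurable lborel"
    by (simp_all add: case_prod_unfold)
  then show ?thesis
    unfolding bivariate_normal_law_def by (simp add: nn_integral_density nn_integral_lborel_pair)
qed

lemma has_bochner_integral_bivariate_normal_law:
  fixes f :: "real \<times> real \<Rightarrow> real"
  assumes f: "f \<in> borel_measurable borel"
    and "has_bochner_integral lborel (\<lambda>(x, y). f (x, y) * bivariate_normal \<rho> x y) v"
  shows "has_bochner_integral (bivariate_normal_law \<rho>) f v"
proof -
  have "has_bochner_integral (density lborel (\<lambda>p. ennreal (case p of (x, y) \<Rightarrow> bivariate_normal \<rho> x y))) f v"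
    by (rule has_bochner_integral_density)
       (use assms borel_measurable_bivariate_normal_fst_snd in \<open>auto simp: bivariate_normal_nonneg case_prod_unfold mult.commute\<close>)
  then show ?thesis by (simp add: bivariate_normal_law_def case_prod_unfold)
qed

lemma measure_eq_nn_integralI:
  assumes sets: "sets M = sets N"
    and "\<And>A. A \<in> sets M \<Longrightarrow> (\<integral>\<^sup>+x. indicator A x \<partial>M) = (\<integral>\<^sup>+x. indicator A x \<partial>N)"
  shows "M = N"
  using assms by (intro measure_eqI) auto

text \<open>The hypotheses say that \<open>\<alpha> x + \<beta> y\<close> has variance one and correlation \<open>r\<close> with \<open>x\<close>.  They force \<open>\<beta> \<noteq> 0\<close>, so
  the map is a change of variables in \<open>y\<close> for each fixed \<open>x\<close>.\<close>

lemma distr_bivariate_normal_law_affine: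
  assumes \<rho>: "\<bar>\<rho>\<bar> < 1" and r: "\<bar>r\<bar> < 1"
    and cov: "r = \<alpha> + \<rho> * \<beta>" and var: "\<alpha>\<^sup>2 + 2 * \<rho> * \<alpha> * \<beta> + \<beta>\<^sup>2 = 1"
  shows "distr (bivariate_normal_law \<rho>) borel (\<lambda>(x, y). (x, \<alpha> * x + \<beta> * y)) = bivariate_normal_law r"
proof (rule measure_eq_nn_integralI)
  define T :: "real \<times> real \<Rightarrow> real \<times> real" where "T = (\<lambda>(x, y). (x, \<alpha> * x + \<beta> * y))"
  have T [measurable]: "T \<in> borel_measurable borel"
    by (simp add: T_def borel_prod[symmetric] case_prod_unfold)
  have sq: "1 - r\<^sup>2 = \<beta>\<^sup>2 * (1 - \<rho>\<^sup>2)"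
    unfolding cov using var by (simp add: power2_eq_square algebra_simps)
  have r2: "1 - r\<^sup>2 > 0" using r by (simp add: abs_square_less_1)
  then have \<beta>: "\<beta> \<noteq> 0" using sq by auto
  have dens: "\<bar>\<beta>\<bar> * bivariate_normal r x (\<alpha> * x + \<beta> * y) = bivariate_normal \<rho> x y" for x y
  proof -
    have e: "\<alpha> * x + \<beta> * y - r * x = \<beta> * (y - \<rho> * x)" by (simp add: cov algebra_simps)
    have p: "1 - \<rho>\<^sup>2 > 0" using \<rho> by (simp add: abs_square_less_1)
    have "normal_density (r * x) (sqrt (1 - r\<^sup>2)) (\<alpha> * x + \<beta> * y) * \<bar>\<beta>\<bar> = normal_density (\<rho> * x) (sqrt (1 - \<rho>\<^sup>2)) y"
    proof -
      have "sqrt (2 * pi * (\<beta>\<^sup>2 * (1 - \<rho>\<^sup>2))) = \<bar>\<beta>\<bar> * sqrt (2 * pi * (1 - \<rho>\<^sup>2))"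
        by (simp add: real_sqrt_mult)
      then show ?thesis using p r2 \<beta>
        by (simp add: normal_density_def e sq power_mult_distrib)
    qed
    then show ?thesis
      unfolding bivariate_normal_factor[OF r] bivariate_normal_factor[OF \<rho>] by (simp add: mult_ac)
  qed
  fix A assume "A \<in> sets (distr (bivariate_normal_law \<rho>) borel (\<lambda>(x, y). (x, \<alpha> * x + \<beta> * y)))"
  then have A [measurable]: "A \<in> sets borel" by simp
  have A' [measurable]: "A \<in> sets (borel \<Otimes>\<^sub>M borel)" unfolding borel_prod by (rule A)
  have "(\<integral>\<^sup>+p. indicator A p \<partial>distr (bivariate_normal_law \<rho>) borel T) = (\<integral>\<^sup>+p. indicator A (T p) \<partial>bivariate_normal_law \<rho>)"
    by (subst nn_integral_distr) simp_all
  also have "\<dots> = (\<integral>\<^sup>+x. \<integral>\<^sup>+y. ennreal (bivariate_normal \<rho> x y) * indicator A (T (x, y)) \<partial>lborel \<partial>lborel)"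
    by (rule nn_integral_bivariate_normal_law) simp
  also have "\<dots> = (\<integral>\<^sup>+x. \<integral>\<^sup>+y. ennreal (bivariate_normal r x y) * indicator A (x, y) \<partial>lborel \<partial>lborel)"
  proof (rule nn_integral_cong)
    fix x :: real
    have "(\<lambda>y. ennreal (bivariate_normal r x y) * indicator A (x, y)) \<in> borel_measurable borel"
      by measurable
    from nn_integral_real_affine[OF this \<beta>, of "\<alpha> * x"]
    have "(\<integral>\<^sup>+y. ennreal (bivariate_normal r x y) * indicator A (x, y) \<partial>lborel) =
       (\<integral>\<^sup>+y. ennreal \<bar>\<beta>\<bar> * (ennreal (bivariate_normal r x (\<alpha> * x + \<beta> * y)) * indicator A (x, \<alpha> * x + \<beta> * y)) \<partial>lborel)"
      by (subst nn_integral_cmult) simp_all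
    also have "\<dots> = (\<integral>\<^sup>+y. ennreal (bivariate_normal \<rho> x y) * indicator A (T (x, y)) \<partial>lborel)"
      unfolding dens[symmetric] by (simp add: ennreal_mult' bivariate_normal_nonneg mult.assoc T_def)
    finally show "(\<integral>\<^sup>+y. ennreal (bivariate_normal \<rho> x y) * indicator A (T (x, y)) \<partial>lborel)
       = (\<integral>\<^sup>+y. ennreal (bivariate_normal r x y) * indicator A (x, y) \<partial>lborel)" ..
  qed
  also have "\<dots> = (\<integral>\<^sup>+p. indicator A p \<partial>bivariate_normal_law r)"
    by (rule nn_integral_bivariate_normal_law[symmetric]) simp
  finally show "(\<integral>\<^sup>+p. indicator A p \<partial>distr (bivariate_normal_law \<rho>) borel (\<lambda>(x, y). (x, \<alpha> * x + \<beta> * y)))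
     = (\<integral>\<^sup>+p. indicator A p \<partial>bivariate_normal_law r)" by (simp add: T_def)
qed simp

lemma distr_bivariate_normal_law_swap:
  assumes \<rho>: "\<bar>\<rho>\<bar> < 1"
  shows "distr (bivariate_normal_law \<rho>) borel (\<lambda>(x, y). (y, x)) = bivariate_normal_law \<rho>"
proof (rule measure_eq_nn_integralI)
  let ?M = "distr (bivariate_normal_law \<rho>) borel (\<lambda>(x, y). (y, x))"
  fix A assume "A \<in> sets (?M)"
  then have A [measurable]: "A \<in> sets borel" by simp
  have A' [measurable]: "A \<in> sets (borel \<Otimes>\<^sub>M borel)" unfolding borel_prod by (rule A)
  have T [measurable]: "(\<lambda>(x::real, y::real). (y, x)) \<in> borel_measurable borel"
    by (simp add: borel_prod[symmetric])
  have "(\<integral>\<^sup>+p. indicator A p \<partial>?M) = (\<integral>\<^sup>+p. indicator A ((\<lambda>(x, y). (y, x)) p) \<partial>bivariate_normal_law \<rho>)"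
    by (subst nn_integral_distr) simp_all
  also have "\<dots> = (\<integral>\<^sup>+x. \<integral>\<^sup>+y. ennreal (bivariate_normal \<rho> x y) * indicator A (y, x) \<partial>lborel \<partial>lborel)"
    by (subst nn_integral_bivariate_normal_law) (simp_all del: split_paired_All)
  also have "\<dots> = (\<integral>\<^sup>+y. \<integral>\<^sup>+x. ennreal (bivariate_normal \<rho> x y) * indicator A (y, x) \<partial>lborel \<partial>lborel)"
    by (rule lborel_pair.Fubini') measurable
  also have "\<dots> = (\<integral>\<^sup>+p. indicator A p \<partial>bivariate_normal_law \<rho>)"
    by (subst nn_integral_bivariate_normal_law) (simp_all add: bivariate_normal_sym[OF \<rho>])
  finally show "(\<integral>\<^sup>+p. indicator A p \<partial>?M) = (\<integral>\<^sup>+p. indicator A p \<partial>bivariate_normal_law \<rho>)" .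
qed simp

lemma distr_bivariate_normal_law_fst:
  assumes \<rho>: "\<bar>\<rho>\<bar> < 1"
  shows "distr (bivariate_normal_law \<rho>) borel fst = density lborel (\<lambda>x. ennreal (fN 1 x))"
proof (rule measure_eq_nn_integralI)
  let ?M = "distr (bivariate_normal_law \<rho>) borel fst" and ?N = "density lborel (\<lambda>x. ennreal (fN 1 x))"
  fix A assume "A \<in> sets (?M)"
  then have A [measurable]: "A \<in> sets borel" by simp
  have f [measurable]: "(fst :: real \<times> real \<Rightarrow> real) \<in> borel_measurable borel" "fN 1 \<in> borel_measurable borel"
    by (simp_all add: borel_prod[symmetric] fN_def[abs_def])
  have n: "(\<integral>\<^sup>+y. ennreal (normal_density m (sqrt (1 - \<rho>\<^sup>2)) y) \<partial>lborel) = 1" for m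
    using has_bochner_integral_normal_density[OF sqrt_one_minus_pos[OF \<rho>], of m]
    by (subst nn_integral_eq_integral) (auto simp: has_bochner_integral_iff)
  have "(\<integral>\<^sup>+p. indicator A p \<partial>?M) = (\<integral>\<^sup>+p. indicator A (fst p) \<partial>bivariate_normal_law \<rho>)"
    by (subst nn_integral_distr) simp_all
  also have "\<dots> = (\<integral>\<^sup>+x. \<integral>\<^sup>+y. ennreal (fN 1 x) * indicator A x * ennreal (normal_density (\<rho> * x) (sqrt (1 - \<rho>\<^sup>2)) y) \<partial>lborel \<partial>lborel)"
    by (subst nn_integral_bivariate_normal_law)
       (simp_all add: bivariate_normal_factor[OF \<rho>] ennreal_mult' fN_def mult_ac)
  also have "\<dots> = (\<integral>\<^sup>+x. ennreal (fN 1 x) * indicator A x \<partial>lborel)"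
    by (subst nn_integral_cmult) (simp_all add: n)
  also have "\<dots> = (\<integral>\<^sup>+p. indicator A p \<partial>?N)"
    by (subst nn_integral_density) simp_all
  finally show "(\<integral>\<^sup>+p. indicator A p \<partial>?M) = (\<integral>\<^sup>+p. indicator A p \<partial>?N)" .
qed simp

lemma distr_bivariate_normal_law_snd:
  assumes \<rho>: "\<bar>\<rho>\<bar> < 1"
  shows "distr (bivariate_normal_law \<rho>) borel snd = density lborel (\<lambda>x. ennreal (fN 1 x))"
proof -
  have T: "(\<lambda>(x::real, y::real). (y, x)) \<in> borel_measurable borel" "(fst :: real \<times> real \<Rightarrow> real) \<in> borel_measurable borel"
    by (simp_all add: borel_prod[symmetric])
  have "distr (distr (bivariate_normal_law \<rho>) borel (\<lambda>(x, y). (y, x))) borel fst = distr (bivariate_normal_law \<rho>) borel (fst \<circ> (\<lambda>(x, y). (y, x)))"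
    by (rule distr_distr) (use T in auto)
  moreover have "fst \<circ> (\<lambda>(x::real, y::real). (y, x)) = snd" by (auto simp: fun_eq_iff)
  ultimately show ?thesis
    unfolding distr_bivariate_normal_law_swap[OF \<rho>] distr_bivariate_normal_law_fst[OF \<rho>] by simp
qed

lemma bivariate_normal_law_hermite:
  assumes "\<bar>\<rho>\<bar> < 1"
  shows "has_bochner_integral (bivariate_normal_law \<rho>) (\<lambda>p. qHermite 1 n (fst p) * qHermite 1 m (snd p))
    (if n = m then \<rho> ^ n * qfact 1 n else 0)"
proof (rule has_bochner_integral_bivariate_normal_law)
  have [measurable]: "qHermite 1 n \<in> borel_measurable borel" for n
    by (intro borel_measurable_continuous_onI continuous_intros)
  show "(\<lambda>p. qHermite 1 n (fst p) * qHermite 1 m (snd p)) \<in> borel_measurable borel"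
    by (simp add: borel_prod[symmetric])
  show "has_bochner_integral lborel (\<lambda>(x, y). qHermite 1 n (fst (x, y)) * qHermite 1 m (snd (x, y)) * bivariate_normal \<rho> x y)
    (if n = m then \<rho> ^ n * qfact 1 n else 0)"
    using bivariate_normal_hermite[OF assms, of n m] by simp
qed

lemma prob_space_bivariate_normal_law:
  assumes "\<bar>\<rho>\<bar> < 1"
  shows "prob_space (bivariate_normal_law \<rho>)"
proof -
  have "(\<integral>\<^sup>+p. ennreal 1 \<partial>bivariate_normal_law \<rho>) = 1"
    using bivariate_normal_law_hermite[OF assms, of 0 0]
    by (subst nn_integral_eq_integral) (auto simp: has_bochner_integral_iff)
  then show ?thesis by (intro prob_spaceI) simp
qed

lemma normal_density_cis:
  assumes "\<sigma> > 0"
  shows "has_bochner_integral lborel (\<lambda>y. normal_density m \<sigma> y *\<^sub>R cis (t * y))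
     (cis (t * m) * complex_of_real (exp (- (t * \<sigma>)\<^sup>2 / 2)))"
proof -
  define s where "s = t * \<sigma>"
  have "integrable lborel (\<lambda>z. std_normal_density z *\<^sub>R cis (s * z))"
  proof (rule Bochner_Integration.integrable_bound[OF integrable_normal_density[of 1 0, OF zero_less_one]])
    have [measurable]: "(\<lambda>z. cis (s * z)) \<in> borel_measurable borel"
      by (intro borel_measurable_continuous_onI continuous_intros)
    show "(\<lambda>z. std_normal_density z *\<^sub>R cis (s * z)) \<in> borel_measurable lborel" by measurable
    show "AE z in lborel. norm (std_normal_density z *\<^sub>R cis (s * z)) \<le> norm (std_normal_density z)"
      by (intro AE_I2) simp
  qed
  moreover have "(LINT z|lborel. std_normal_density z *\<^sub>R cis (s * z)) = complex_of_real (exp (- s\<^sup>2 / 2))"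
  proof -
    have "char std_normal_distribution s = (LINT z|lborel. std_normal_density z *\<^sub>R iexp (s * z))"
      unfolding char_def by (subst integral_density) auto
    then show ?thesis by (simp add: char_std_normal_distribution cis_conv_exp)
  qed
  ultimately have "has_bochner_integral lborel (\<lambda>z. std_normal_density z *\<^sub>R cis (s * z)) (complex_of_real (exp (- s\<^sup>2 / 2)))"
    by (simp add: has_bochner_integral_iff)
  from has_bochner_integral_mult_right[OF this, of "cis (t * m)"]
  have "has_bochner_integral lborel (\<lambda>z. std_normal_density z *\<^sub>R cis (t * (m + \<sigma> * z))) (cis (t * m) * complex_of_real (exp (- (t * \<sigma>)\<^sup>2 / 2)))"
    by (simp add: s_def cis_mult distrib_left mult_ac)
  then show ?thesis by (simp only: normal_density_affine_iff[OF assms])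
qed

lemma bivariate_normal_law_cis:
  assumes \<rho>: "\<bar>\<rho>\<bar> < 1"
  shows "(CLINT p|bivariate_normal_law \<rho>. cis (a * fst p + b * snd p)) =
    complex_of_real (exp (- (a\<^sup>2 + 2 * \<rho> * a * b + b\<^sup>2) / 2))"
proof -
  define \<sigma> where "\<sigma> = sqrt (1 - \<rho>\<^sup>2)"
  have \<sigma>: "\<sigma> > 0" using sqrt_one_minus_pos[OF \<rho>] by (simp add: \<sigma>_def)
  have \<sigma>2: "\<sigma>\<^sup>2 = 1 - \<rho>\<^sup>2" using \<sigma> by (simp add: \<sigma>_def)
  define F where "F = (\<lambda>(x, y). bivariate_normal \<rho> x y *\<^sub>R cis (a * x + b * y))"
  have c: "continuous_on UNIV (\<lambda>p::real \<times> real. cis (a * fst p + b * snd p))"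
    by (intro continuous_intros)
  have m: "(\<lambda>p::real \<times> real. cis (a * fst p + b * snd p)) \<in> borel_measurable borel"
    using borel_measurable_continuous_onI[OF c] .
  have "integrable lborel (\<lambda>(x, y). bivariate_normal \<rho> x y)"
    using bivariate_normal_hermite[OF \<rho>, of 0 0] by (simp add: has_bochner_integral_iff)
  then have int: "integrable lborel F"
    by (rule Bochner_Integration.integrable_bound)
       (use borel_measurable_scaleR[OF borel_measurable_bivariate_normal_fst_snd m] in \<open>auto simp: F_def case_prod_unfold\<close>)
  have "(CLINT p|bivariate_normal_law \<rho>. cis (a * fst p + b * snd p)) = integral\<^sup>L lborel F"
    unfolding bivariate_normal_law_def F_def case_prod_unfold
    by (subst integral_density) (use m borel_measurable_bivariate_normal_fst_snd in \<open>auto simp: bivariate_normal_nonneg case_prod_unfold\<close>)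
  also have "\<dots> = (\<integral>x. \<integral>y. F (x, y) \<partial>lborel \<partial>lborel)"
    using lborel_pair.integral_fst'[of F] int by (simp add: lborel_prod)
  also have "\<dots> = (\<integral>x. (std_normal_density x *\<^sub>R cis ((a + b * \<rho>) * x)) * complex_of_real (exp (- (b * \<sigma>)\<^sup>2 / 2)) \<partial>lborel)"
  proof (rule Bochner_Integration.integral_cong[OF refl])
    fix x
    have F: "F (x, y) = (std_normal_density x *\<^sub>R cis (a * x)) * (normal_density (\<rho> * x) \<sigma> y *\<^sub>R cis (b * y))" for y
      unfolding F_def bivariate_normal_factor[OF \<rho>] \<sigma>_def[symmetric]
      by (simp add: cis_mult[symmetric] scaleR_conv_of_real mult_ac)
    have "has_bochner_integral lborel (\<lambda>y. F (x, y)) ((std_normal_density x *\<^sub>R cis (a * x)) * (cis (b * (\<rho> * x)) * complex_of_real (exp (- (b * \<sigma>)\<^sup>2 / 2))))"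
      unfolding F by (rule has_bochner_integral_mult_right[OF normal_density_cis[OF \<sigma>]])
    moreover have "(std_normal_density x *\<^sub>R cis (a * x)) * (cis (b * (\<rho> * x)) * complex_of_real (exp (- (b * \<sigma>)\<^sup>2 / 2)))
       = (std_normal_density x *\<^sub>R cis ((a + b * \<rho>) * x)) * complex_of_real (exp (- (b * \<sigma>)\<^sup>2 / 2))"
      by (simp add: cis_mult mult.assoc[symmetric] distrib_right)
    ultimately show "(\<integral>y. F (x, y) \<partial>lborel) = (std_normal_density x *\<^sub>R cis ((a + b * \<rho>) * x)) * complex_of_real (exp (- (b * \<sigma>)\<^sup>2 / 2))"
      by (simp only: has_bochner_integral_iff)
  qed
  also have "\<dots> = complex_of_real (exp (- (a + b * \<rho>)\<^sup>2 / 2)) * complex_of_real (exp (- (b * \<sigma>)\<^sup>2 / 2))"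
  proof -
    have "has_bochner_integral lborel (\<lambda>x. std_normal_density x *\<^sub>R cis ((a + b * \<rho>) * x)) (complex_of_real (exp (- (a + b * \<rho>)\<^sup>2 / 2)))"
      using normal_density_cis[of 1 0 "a + b * \<rho>"] by simp
    from has_bochner_integral_mult_left[OF this] show ?thesis
      by (simp only: has_bochner_integral_iff)
  qed
  also have "\<dots> = complex_of_real (exp (- (a + b * \<rho>)\<^sup>2 / 2 + - (b * \<sigma>)\<^sup>2 / 2))"
    by (simp only: of_real_mult[symmetric] exp_add[symmetric])
  also have "- (a + b * \<rho>)\<^sup>2 / 2 + - (b * \<sigma>)\<^sup>2 / 2 = - (a\<^sup>2 + 2 * \<rho> * a * b + b\<^sup>2) / 2"
    by (simp add: power_mult_distrib \<sigma>2) (simp add: power2_eq_square algebra_simps)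
  finally show ?thesis .
qed

text \<open>If the determinant vanishes, the conditional variance of the third coordinate is zero, so this coordinate equals
  its regression \<open>\<alpha> x + \<beta> y\<close> on the other two.\<close>

theorem singular_gaussian_law:
  assumes a: "\<bar>a\<bar> < 1" and b: "\<bar>b\<bar> < 1" and c: "\<bar>c\<bar> < 1" and D: "corr_det a b c = 0"
  obtains M where "centered_gaussian_law (corr_matrix3 a b c) M"
    and "distr M borel (\<lambda>x. (x $ 1, x $ 2)) = bivariate_normal_law a"
    and "distr M borel (\<lambda>x. (x $ 1, x $ 3)) = bivariate_normal_law b"
    and "distr M borel (\<lambda>x. (x $ 2, x $ 3)) = bivariate_normal_law c"
proof -
  define \<alpha> where "\<alpha> = (b - a * c) / (1 - a\<^sup>2)"
  define \<beta> where "\<beta> = (c - a * b) / (1 - a\<^sup>2)"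
  have u: "1 - a\<^sup>2 > 0" using a by (simp add: abs_square_less_1)
  have u\<alpha>: "(1 - a\<^sup>2) * \<alpha> = b - a * c" and u\<beta>: "(1 - a\<^sup>2) * \<beta> = c - a * b" using u by (simp_all add: \<alpha>_def \<beta>_def)
  have cancel: "x = y" if "(1 - a\<^sup>2) * x = (1 - a\<^sup>2) * y" for x y using that u by simp
  have cov13: "b = \<alpha> + a * \<beta>"
  proof (rule cancel)
    have "(1 - a\<^sup>2) * (\<alpha> + a * \<beta>) = (1 - a\<^sup>2) * \<alpha> + a * ((1 - a\<^sup>2) * \<beta>)" by (simp only: ring_distribs mult_ac)
    then show "(1 - a\<^sup>2) * b = (1 - a\<^sup>2) * (\<alpha> + a * \<beta>)"
      unfolding u\<alpha> u\<beta> by (simp add: power2_eq_square algebra_simps)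
  qed
  have cov23: "c = \<beta> + a * \<alpha>"
  proof (rule cancel)
    have "(1 - a\<^sup>2) * (\<beta> + a * \<alpha>) = (1 - a\<^sup>2) * \<beta> + a * ((1 - a\<^sup>2) * \<alpha>)" by (simp only: ring_distribs mult_ac)
    then show "(1 - a\<^sup>2) * c = (1 - a\<^sup>2) * (\<beta> + a * \<alpha>)"
      unfolding u\<alpha> u\<beta> by (simp add: power2_eq_square algebra_simps)
  qed
  have var: "\<alpha>\<^sup>2 + 2 * a * \<alpha> * \<beta> + \<beta>\<^sup>2 = 1"
  proof (rule cancel)
    have "(1 - a\<^sup>2) * (\<alpha>\<^sup>2 + 2 * a * \<alpha> * \<beta> + \<beta>\<^sup>2) = ((1 - a\<^sup>2) * \<alpha>) * (\<alpha> + a * \<beta>) + ((1 - a\<^sup>2) * \<beta>) * (\<beta> + a * \<alpha>)"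
      by (simp add: power2_eq_square algebra_simps)
    also have "\<dots> = (b - a * c) * b + (c - a * b) * c"
      unfolding u\<alpha> u\<beta> cov13[symmetric] cov23[symmetric] ..
    also have "\<dots> = (1 - a\<^sup>2) * 1 - corr_det a b c" by (simp add: corr_det_def power2_eq_square algebra_simps)
    finally show "(1 - a\<^sup>2) * (\<alpha>\<^sup>2 + 2 * a * \<alpha> * \<beta> + \<beta>\<^sup>2) = (1 - a\<^sup>2) * 1" using D by simp
  qed
  define \<mu> where "\<mu> = bivariate_normal_law a"
  define V :: "real \<times> real \<Rightarrow> real ^ 3" where
    "V p = vector [fst p, snd p, \<alpha> * fst p + \<beta> * snd p]" for p
  have "V = (\<lambda>p. \<chi> i. if i = 1 then fst p else if i = 2 then snd p else \<alpha> * fst p + \<beta> * snd p)"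
    by (simp add: V_def fun_eq_iff vec_eq_iff forall_3)
  moreover have "continuous_on UNIV (\<lambda>p. if i = 1 then fst p else if i = 2 then snd p else \<alpha> * fst p + \<beta> * snd p)" for i :: 3
    by (cases "i = 1"; cases "i = 2") (auto intro!: continuous_intros)
  ultimately have "continuous_on UNIV V"
    by (simp add: continuous_on_vec_lambda)
  then have V [measurable]: "V \<in> borel_measurable borel" by (rule borel_measurable_continuous_onI)
  then have V\<mu>: "V \<in> measurable \<mu> borel" by (simp add: \<mu>_def cong: measurable_cong_sets)
  have V_nth: "V p $ 1 = fst p" "V p $ 2 = snd p" "V p $ 3 = \<alpha> * fst p + \<beta> * snd p" for p
    by (simp_all add: V_def)
  define M where "M = distr \<mu> borel V"
  have comp: "distr M borel g = distr \<mu> borel (\<lambda>p. g (V p))" if "g \<in> borel_measurable borel" for g :: "real ^ 3 \<Rightarrow> real \<times> real"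
    unfolding M_def using that V\<mu> by (subst distr_distr) (auto simp: o_def)
  have nth: "(\<lambda>x::real^3. (x $ i, x $ j)) \<in> borel_measurable borel" for i j
    by (intro borel_measurable_continuous_onI continuous_intros)
  have "prob_space M"
    unfolding M_def \<mu>_def
    by (rule prob_space.prob_space_distr[OF prob_space_bivariate_normal_law[OF a] V\<mu>[unfolded \<mu>_def]])
  moreover have "(CLINT x|M. cis (t \<bullet> x)) = complex_of_real (exp (- (t \<bullet> (corr_matrix3 a b c *v t)) / 2))" for t
  proof -
    have cm: "(\<lambda>x::real^3. cis (t \<bullet> x)) \<in> borel_measurable borel"
      by (intro borel_measurable_continuous_onI continuous_intros)
    have "(CLINT x|M. cis (t \<bullet> x)) = (CLINT p|\<mu>. cis (t \<bullet> V p))"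
      unfolding M_def by (rule integral_distr[OF V\<mu> cm])
    moreover have "t \<bullet> V p = (t $ 1 + \<alpha> * t $ 3) * fst p + (t $ 2 + \<beta> * t $ 3) * snd p" for p
      by (simp add: inner_vec_def sum_3 V_nth algebra_simps)
    moreover have "(CLINT p|\<mu>. cis ((t $ 1 + \<alpha> * t $ 3) * fst p + (t $ 2 + \<beta> * t $ 3) * snd p)) =
       complex_of_real (exp (- ((t $ 1 + \<alpha> * t $ 3)\<^sup>2 + 2 * a * (t $ 1 + \<alpha> * t $ 3) * (t $ 2 + \<beta> * t $ 3) + (t $ 2 + \<beta> * t $ 3)\<^sup>2) / 2))"
      unfolding \<mu>_def by (rule bivariate_normal_law_cis[OF a])
    moreover have "(t $ 1 + \<alpha> * t $ 3)\<^sup>2 + 2 * a * (t $ 1 + \<alpha> * t $ 3) * (t $ 2 + \<beta> * t $ 3) + (t $ 2 + \<beta> * t $ 3)\<^sup>2 =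
       t \<bullet> (corr_matrix3 a b c *v t)"
    proof -
      have "(t $ 1 + \<alpha> * t $ 3)\<^sup>2 + 2 * a * (t $ 1 + \<alpha> * t $ 3) * (t $ 2 + \<beta> * t $ 3) + (t $ 2 + \<beta> * t $ 3)\<^sup>2 =
       (t $ 1)\<^sup>2 + (t $ 2)\<^sup>2 + (\<alpha>\<^sup>2 + 2 * a * \<alpha> * \<beta> + \<beta>\<^sup>2) * (t $ 3)\<^sup>2
        + 2 * a * t $ 1 * t $ 2 + 2 * (\<alpha> + a * \<beta>) * t $ 1 * t $ 3 + 2 * (\<beta> + a * \<alpha>) * t $ 2 * t $ 3"
      by (simp add: power2_eq_square algebra_simps)
    also have "\<dots> = t \<bullet> (corr_matrix3 a b c *v t)"
      unfolding var cov13[symmetric] cov23[symmetric]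
      by (simp add: inner_vec_def sum_3 matrix_vector_mult_def corr_matrix3_def power2_eq_square algebra_simps)
      finally show ?thesis .
    qed
    ultimately show ?thesis by (simp only:)
  qed
  ultimately have law: "centered_gaussian_law (corr_matrix3 a b c) M"
    by (simp add: centered_gaussian_law_def M_def)
  have 12: "distr M borel (\<lambda>x. (x $ 1, x $ 2)) = bivariate_normal_law a"
    unfolding comp[OF nth] V_nth prod.collapse \<mu>_def by (rule distr_id2) simp
  have 13: "distr M borel (\<lambda>x. (x $ 1, x $ 3)) = bivariate_normal_law b"
    unfolding comp[OF nth] V_nth \<mu>_def
    using distr_bivariate_normal_law_affine[OF a b cov13 var] by (simp add: case_prod_unfold)
  have 23: "distr M borel (\<lambda>x. (x $ 2, x $ 3)) = bivariate_normal_law c"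
  proof -
    have T: "(\<lambda>(x::real, y::real). (y, x)) \<in> borel_measurable borel"
      "(\<lambda>(x::real, y::real). (x, \<beta> * x + \<alpha> * y)) \<in> borel_measurable borel"
      by (simp_all add: borel_prod[symmetric] case_prod_unfold)
    have "\<beta>\<^sup>2 + 2 * a * \<beta> * \<alpha> + \<alpha>\<^sup>2 = 1" using var by (simp add: algebra_simps)
    from distr_bivariate_normal_law_affine[OF a c cov23 this]
    have "bivariate_normal_law c = distr (distr (bivariate_normal_law a) borel (\<lambda>(x, y). (y, x))) borel (\<lambda>(x, y). (x, \<beta> * x + \<alpha> * y))"
      unfolding distr_bivariate_normal_law_swap[OF a] ..
    also have "\<dots> = distr (bivariate_normal_law a) borel ((\<lambda>(x, y). (x, \<beta> * x + \<alpha> * y)) \<circ> (\<lambda>(x, y). (y, x)))"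
      by (rule distr_distr) (use T in auto)
    also have "(\<lambda>(x, y). (x, \<beta> * x + \<alpha> * y)) \<circ> (\<lambda>(x, y). (y, x)) = (\<lambda>p. (snd p, \<alpha> * fst p + \<beta> * snd p))"
      by (auto simp: fun_eq_iff)
    finally show ?thesis unfolding comp[OF nth] V_nth \<mu>_def ..
  qed
  show ?thesis by (rule that[OF law 12 13 23])
qed

section \<open>The claims for all parameters\<close>

lemma has_lebesgue_integral_on_swap12:
  assumes "has_lebesgue_integral_on (\<lambda>(x, y, z). F x y z) v (A \<times> A \<times> A)"
  shows "has_lebesgue_integral_on (\<lambda>(x, y, z). F y x z) v (A \<times> A \<times> (A :: real set))"
  using has_bochner_integral_swap12[OF assms[unfolded has_lebesgue_integral_on_iff]]
  unfolding has_lebesgue_integral_on_iff by (simp add: indicator_times case_prod_unfold mult_ac)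

lemma has_lebesgue_integral_on_swap23:
  assumes "has_lebesgue_integral_on (\<lambda>(x, y, z). F x y z) v (A \<times> A \<times> A)"
  shows "has_lebesgue_integral_on (\<lambda>(x, y, z). F x z y) v (A \<times> A \<times> (A :: real set))"
  using has_bochner_integral_swap23[OF assms[unfolded has_lebesgue_integral_on_iff]]
  unfolding has_lebesgue_integral_on_iff by (simp add: indicator_times case_prod_unfold mult_ac)

lemma has_lebesgue_integral_on_add:
  "has_lebesgue_integral_on f u A \<Longrightarrow> has_lebesgue_integral_on g v A \<Longrightarrow>
    has_lebesgue_integral_on (\<lambda>x. f x + g x) (u + v) A"
  unfolding has_lebesgue_integral_on_iff distrib_left by (rule has_bochner_integral_add)

text \<open>For \<open>q = 1\<close> the correlation matrix must be nonsingular, since otherwise the Gaussian law has no density.\<close>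

definition admissible :: "real \<Rightarrow> real \<Rightarrow> real \<Rightarrow> real \<Rightarrow> bool" where
  "admissible q a b c \<longleftrightarrow> -1 < q \<and> q \<le> 1 \<and> \<bar>a\<bar> < 1 \<and> \<bar>b\<bar> < 1 \<and> \<bar>c\<bar> < 1 \<and> (q < 1 \<or> corr_det a b c > 0)"

lemma admissible_swap12: "admissible q a b c \<Longrightarrow> admissible q a c b"
  and admissible_swap23: "admissible q a b c \<Longrightarrow> admissible q b a c"
  using corr_det_sym12[of a b c] corr_det_sym23[of a b c] by (auto simp: admissible_def)

lemma f3D_swap12: "admissible q a b c \<Longrightarrow> f3D q a b c x y z = f3D q a c b y x z"
  by (rule f3D_sym12) (simp_all add: admissible_def)

lemma f3D_swap23: "admissible q a b c \<Longrightarrow> f3D q a b c x y z = f3D q b a c x z y"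
  by (rule f3D_sym23) (simp_all add: admissible_def)

lemma f3D_rotate: "admissible q a b c \<Longrightarrow> f3D q a b c x y z = f3D q c a b y z x"
  using f3D_swap12[of q a b c x y z] f3D_swap23[OF admissible_swap12, of q a b c y x z] by simp

lemma admissible_rotate: "admissible q a b c \<Longrightarrow> admissible q c a b"
  by (drule admissible_swap12, drule admissible_swap23)

lemma admissible_cases:
  assumes "admissible q a b c"
  obtains "\<bar>q\<bar> < 1" "\<bar>a\<bar> < 1" "\<bar>b\<bar> < 1" "\<bar>c\<bar> < 1"
    | "q = 1" "corr_det a b c > 0" "\<bar>a\<bar> < 1" "\<bar>b\<bar> < 1" "\<bar>c\<bar> < 1"
  using assms by (cases "q = 1") (auto simp: admissible_def)

lemma qsupp_1 [simp]: "qsupp 1 = UNIV"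
  by (simp add: qsupp_def)

lemma moment12:
  assumes "admissible q a b c"
  shows "has_lebesgue_integral_on (\<lambda>(x, y, z). qHermite q n x * qHermite q m y * f3D q a b c x y z)
    (if n = m then a ^ n * qfact q n else 0) (qsupp q \<times> qsupp q \<times> qsupp q)"
  using assms
proof (cases rule: admissible_cases)
  case 1
  then show ?thesis by (rule f3D_moment12)
next
  case 2
  show ?thesis
    unfolding has_lebesgue_integral_on_iff \<open>q = 1\<close>
    using f3D_gaussian_moment12[OF 2(2,3), of n m] by (simp split del: if_split)
qed

lemma moment13:
  assumes "admissible q a b c"
  shows "has_lebesgue_integral_on (\<lambda>(x, y, z). qHermite q n x * qHermite q m z * f3D q a b c x y z)
    (if n = m then b ^ n * qfact q n else 0) (qsupp q \<times> qsupp q \<times> qsupp q)"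
  using has_lebesgue_integral_on_swap23[OF moment12[OF admissible_swap23[OF assms], of n m]]
  by (simp add: f3D_swap23[OF assms])

lemma moment23:
  assumes "admissible q a b c"
  shows "has_lebesgue_integral_on (\<lambda>(x, y, z). qHermite q n y * qHermite q m z * f3D q a b c x y z)
    (if n = m then c ^ n * qfact q n else 0) (qsupp q \<times> qsupp q \<times> qsupp q)"
  using has_lebesgue_integral_on_swap12[OF has_lebesgue_integral_on_swap23[OF moment12[OF admissible_rotate[OF assms], of n m]]]
  by (simp add: f3D_rotate[OF assms])

lemma marginal3:
  assumes "admissible q a b c" "z \<in> qsupp q"
  shows "has_lebesgue_integral_on (\<lambda>(x, y). f3D q a b c x y z) (fN q z) (qsupp q \<times> qsupp q)"
  using assms(1)
proof (cases rule: admissible_cases)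
  case 1
  then show ?thesis using assms(2) by (rule f3D_marginal3)
next
  case 2
  then show ?thesis
    using f3D_gaussian_marginal3[of a b c z] by (simp add: has_lebesgue_integral_on_iff)
qed

lemma marginal12:
  assumes "admissible q a b c" "x \<in> qsupp q" "y \<in> qsupp q"
  shows "has_lebesgue_integral_on (\<lambda>z. f3D q a b c x y z) (fCN q a x y * fN q y) (qsupp q)"
  using assms(1)
proof (cases rule: admissible_cases)
  case 1
  then show ?thesis using assms(2,3) by (rule f3D_marginal12)
next
  case 2
  then show ?thesis
    using f3D_gaussian_marginal12[of a b c x y] by (simp add: has_lebesgue_integral_on_iff)
qed

lemma admissible_independent:
  assumes "-1 < q" "q \<le> 1" "\<bar>a\<bar> < 1"
  shows "admissible q a 0 0" "admissible q 0 a 0" "admissible q 0 0 a"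
  using assms by (auto simp: admissible_def corr_det_def abs_square_less_1)

lemma independent3:
  assumes "admissible q a 0 0" "x \<in> qsupp q" "y \<in> qsupp q"
  shows "f3D q a 0 0 x y z = fCN q a x y * fN q y * fN q z"
  using assms(1)
proof (cases rule: admissible_cases)
  case 1
  then show ?thesis using assms(2,3) by (intro f3D_independent3)
next
  case 2
  have u: "1 - a\<^sup>2 > 0" using 2 by (simp add: abs_square_less_1)
  have "corr_det a 0 0 = 1 - a\<^sup>2" by (simp add: corr_det_def)
  then have sd: "sqrt (corr_det a 0 0 / (1 - a\<^sup>2)) = 1" using u by simp
  have "f3D 1 a 0 0 x y z = bivariate_normal a x y * normal_density 0 1 z"
    unfolding f3D_gaussian_factor[OF 2(2,3)] sd by simp
  then show ?thesis unfolding \<open>q = 1\<close> by (simp add: bivariate_normal_def fN_def)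
qed

lemma second_moment_from_hermite:
  assumes "has_lebesgue_integral_on (\<lambda>(x, y, z). qHermite q 2 (g x y z) * F x y z) 0 A"
    and "has_lebesgue_integral_on (\<lambda>(x, y, z). F x y z) 1 A"
  shows "has_lebesgue_integral_on (\<lambda>(x, y, z). (g x y z)\<^sup>2 * F x y (z::real)) 1 (A :: (real \<times> real \<times> real) set)"
proof -
  have "qHermite q 2 t * u + u = t\<^sup>2 * u" for t u
    by (simp add: eval_nat_numeral qnum_def algebra_simps)
  then have "(\<lambda>p. (case p of (x, y, z) \<Rightarrow> qHermite q 2 (g x y z) * F x y z) + (case p of (x, y, z) \<Rightarrow> F x y z))
     = (\<lambda>(x, y, z). (g x y z)\<^sup>2 * F x y z)"
    by (simp only: case_prod_unfold)
  with has_lebesgue_integral_on_add[OF assms] show ?thesis by (simp only: add_0)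
qed

lemma singular_gaussian_case:
  assumes q: "q = 1" and r: "\<bar>a\<bar> < 1" "\<bar>b\<bar> < 1" "\<bar>c\<bar> < 1" and D0: "corr_det a b c = 0"
  shows "\<exists>M. centered_gaussian_law (corr_matrix3 a b c) M \<and>
        has_bochner_integral M (\<lambda>x. 1) (1::real) \<and>
        distr M borel (\<lambda>x. x $ 3) = density lborel (\<lambda>x3. ennreal (fN q x3)) \<and>
        distr M borel (\<lambda>x. x $ 2) = density lborel (\<lambda>x2. ennreal (fN q x2)) \<and>
        distr M borel (\<lambda>x. x $ 1) = density lborel (\<lambda>x1. ennreal (fN q x1)) \<and>
        (\<forall>n m.
          has_bochner_integral M (\<lambda>x. qHermite q n (x $ 1) * qHermite q m (x $ 2))
            (if n = m then a ^ n * qfact q n else 0) \<and>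
          has_bochner_integral M (\<lambda>x. qHermite q n (x $ 1) * qHermite q m (x $ 3))
            (if n = m then b ^ n * qfact q n else 0) \<and>
          has_bochner_integral M (\<lambda>x. qHermite q n (x $ 2) * qHermite q m (x $ 3))
            (if n = m then c ^ n * qfact q n else 0)) \<and>
        (\<forall>i. has_bochner_integral M (\<lambda>x. x $ i) 0 \<and>
             has_bochner_integral M (\<lambda>x. (x $ i)\<^sup>2) 1) \<and>
        distr M borel (\<lambda>x. (x $ 1, x $ 2)) =
          density lborel (\<lambda>(x1, x2). ennreal (fCN q a x1 x2 * fN q x2))"
proof -
  obtain M where law: "centered_gaussian_law (corr_matrix3 a b c) M"
    and d12: "distr M borel (\<lambda>x. (x $ 1, x $ 2)) = bivariate_normal_law a"
    and d13: "distr M borel (\<lambda>x. (x $ 1, x $ 3)) = bivariate_normal_law b"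
    and d23: "distr M borel (\<lambda>x. (x $ 2, x $ 3)) = bivariate_normal_law c"
    using singular_gaussian_law[OF r D0] by blast
  have M: "sets M = sets borel" "prob_space M" using law by (simp_all add: centered_gaussian_law_def)
  have pair: "(\<lambda>x. (x $ i, x $ j)) \<in> borel_measurable M" for i j
  proof -
    have "(\<lambda>x::real^3. (x $ i, x $ j)) \<in> borel_measurable borel"
      by (intro borel_measurable_continuous_onI continuous_intros)
    then show ?thesis by (simp cong: measurable_cong_sets add: M(1))
  qed
  have fs: "(fst :: real \<times> real \<Rightarrow> real) \<in> borel_measurable borel" "(snd :: real \<times> real \<Rightarrow> real) \<in> borel_measurable borel"
    by (simp_all add: borel_prod[symmetric])
  have comp: "distr M borel (\<lambda>x. g (x $ i, x $ j)) = distr (distr M borel (\<lambda>x. (x $ i, x $ j))) borel g"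
    if "g \<in> borel_measurable borel" for g :: "real \<times> real \<Rightarrow> real" and i j
    using that pair[of i j] by (subst distr_distr) (auto simp: o_def)
  have h: "has_bochner_integral M (\<lambda>x. qHermite 1 n (x $ i) * qHermite 1 m (x $ j)) (if n = m then \<rho> ^ n * qfact 1 n else 0)"
    if "distr M borel (\<lambda>x. (x $ i, x $ j)) = bivariate_normal_law \<rho>" "\<bar>\<rho>\<bar> < 1" for i j \<rho> n m
    using has_bochner_integral_distr_imp[OF pair[of i j]] bivariate_normal_law_hermite[OF that(2), of n m]
    unfolding that(1) by fastforce
  have one: "has_bochner_integral M (\<lambda>x. 1) (1::real)" using h[OF d12 r(1), of 0 0] by simp
  have mean: "has_bochner_integral M (\<lambda>x. x $ i) 0" and square: "has_bochner_integral M (\<lambda>x. (x $ i)\<^sup>2) 1" for i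
  proof -
    have m: "has_bochner_integral M (\<lambda>x. qHermite 1 n (x $ i)) (if n = 0 then 1 else 0)" for n
    proof -
      consider "i = 1" | "i = 2" | "i = 3" using exhaust_3[of i] by blast
      then show ?thesis
      proof cases
        case 1
        then show ?thesis using h[OF d12 r(1), of n 0] by (cases n) simp_all
      next
        case 2
        then show ?thesis using h[OF d12 r(1), of 0 n] by (cases n) simp_all
      next
        case 3
        then show ?thesis using h[OF d13 r(2), of 0 n] by (cases n) simp_all
      qed
    qed
    show "has_bochner_integral M (\<lambda>x. x $ i) 0" using m[of 1] by simp
    have "qHermite 1 2 t + 1 = t\<^sup>2" for t by (simp add: eval_nat_numeral qnum_def)
    then show "has_bochner_integral M (\<lambda>x. (x $ i)\<^sup>2) 1"
      using has_bochner_integral_add[OF m[of 2] one] by simp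
  qed
  have marg1: "distr M borel (\<lambda>x. x $ 1) = density lborel (\<lambda>x. ennreal (fN 1 x))"
    using comp[OF fs(1), of 1 2] unfolding d12 distr_bivariate_normal_law_fst[OF r(1)] fst_conv .
  have marg2: "distr M borel (\<lambda>x. x $ 2) = density lborel (\<lambda>x. ennreal (fN 1 x))"
    using comp[OF fs(2), of 1 2] unfolding d12 distr_bivariate_normal_law_snd[OF r(1)] snd_conv .
  have marg3: "distr M borel (\<lambda>x. x $ 3) = density lborel (\<lambda>x. ennreal (fN 1 x))"
    using comp[OF fs(2), of 1 3] unfolding d13 distr_bivariate_normal_law_snd[OF r(2)] snd_conv .
  have joint: "distr M borel (\<lambda>x. (x $ 1, x $ 2)) = density lborel (\<lambda>(x1, x2). ennreal (fCN 1 a x1 x2 * fN 1 x2))"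
    unfolding d12 bivariate_normal_law_def bivariate_normal_def ..
  show ?thesis
    using law one marg1 marg2 marg3 h[OF d12 r(1)] h[OF d13 r(2)] h[OF d23 r(3)] mean square joint
    unfolding q by blast
qed

theorem mainTheorem6:
  fixes q \<rho>12 \<rho>13 \<rho>23 :: real
  defines "S \<equiv> qsupp q"
    and "f \<equiv> f3D q \<rho>12 \<rho>13 \<rho>23"
    and "D \<equiv> 1 + 2 * \<rho>12 * \<rho>13 * \<rho>23 - \<rho>12\<^sup>2 - \<rho>13\<^sup>2 - \<rho>23\<^sup>2"
  assumes "-1 < q" and "q \<le> 1"
    and "\<rho>12 \<in> {-1<..<1}" and "\<rho>13 \<in> {-1<..<1}" and "\<rho>23 \<in> {-1<..<1}"
    and "D \<ge> 0"
  shows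
   "\<comment> \<open>all cases in which \<open>f\<close> exists as a function\<close>
    (q < 1 \<or> D > 0 \<longrightarrow>
      \<comment> \<open>i)\<close>
      has_lebesgue_integral_on (\<lambda>(x1, x2, x3). f x1 x2 x3) 1 (S \<times> S \<times> S) \<and>
      \<comment> \<open>ii)\<close>
      (\<forall>x3\<in>S. has_lebesgue_integral_on (\<lambda>(x1, x2). f x1 x2 x3) (fN q x3) (S \<times> S)) \<and>
      (\<forall>x2\<in>S. has_lebesgue_integral_on (\<lambda>(x1, x3). f x1 x2 x3) (fN q x2) (S \<times> S)) \<and>
      (\<forall>x1\<in>S. has_lebesgue_integral_on (\<lambda>(x2, x3). f x1 x2 x3) (fN q x1) (S \<times> S)) \<and>
      (\<forall>n m.
        has_lebesgue_integral_on (\<lambda>(x1, x2, x3). qHermite q n x1 * qHermite q m x2 * f x1 x2 x3)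
          (if n = m then \<rho>12 ^ n * qfact q n else 0) (S \<times> S \<times> S) \<and>
        has_lebesgue_integral_on (\<lambda>(x1, x2, x3). qHermite q n x1 * qHermite q m x3 * f x1 x2 x3)
          (if n = m then \<rho>13 ^ n * qfact q n else 0) (S \<times> S \<times> S) \<and>
        has_lebesgue_integral_on (\<lambda>(x1, x2, x3). qHermite q n x2 * qHermite q m x3 * f x1 x2 x3)
          (if n = m then \<rho>23 ^ n * qfact q n else 0) (S \<times> S \<times> S)) \<and>
      has_lebesgue_integral_on (\<lambda>(x1, x2, x3). x1 * f x1 x2 x3) 0 (S \<times> S \<times> S) \<and>
      has_lebesgue_integral_on (\<lambda>(x1, x2, x3). x2 * f x1 x2 x3) 0 (S \<times> S \<times> S) \<and>
      has_lebesgue_integral_on (\<lambda>(x1, x2, x3). x3 * f x1 x2 x3) 0 (S \<times> S \<times> S) \<and>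
      has_lebesgue_integral_on (\<lambda>(x1, x2, x3). x1\<^sup>2 * f x1 x2 x3) 1 (S \<times> S \<times> S) \<and>
      has_lebesgue_integral_on (\<lambda>(x1, x2, x3). x2\<^sup>2 * f x1 x2 x3) 1 (S \<times> S \<times> S) \<and>
      has_lebesgue_integral_on (\<lambda>(x1, x2, x3). x3\<^sup>2 * f x1 x2 x3) 1 (S \<times> S \<times> S) \<and>
      \<comment> \<open>iii)\<close>
      (\<forall>x1\<in>S. \<forall>x2\<in>S.
        has_lebesgue_integral_on (\<lambda>x3. f x1 x2 x3) (fCN q \<rho>12 x1 x2 * fN q x2) S))
    \<and>
    \<comment> \<open>iv)\<close>
    (\<forall>x1\<in>S. \<forall>x2\<in>S. \<forall>x3\<in>S.
      (\<rho>13 = 0 \<and> \<rho>23 = 0 \<longrightarrow> f x1 x2 x3 = fCN q \<rho>12 x1 x2 * fN q x2 * fN q x3) \<and>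
      (\<rho>12 = 0 \<and> \<rho>23 = 0 \<longrightarrow> f x1 x2 x3 = fCN q \<rho>13 x1 x3 * fN q x3 * fN q x2) \<and>
      (\<rho>12 = 0 \<and> \<rho>13 = 0 \<longrightarrow> f x1 x2 x3 = fCN q \<rho>23 x2 x3 * fN q x3 * fN q x1))
    \<and>
    \<comment> \<open>singular Gaussian case: there is no density, and i)--iii) are read for the law itself\<close>
    (q = 1 \<and> D = 0 \<longrightarrow>
      (\<exists>M. centered_gaussian_law (corr_matrix3 \<rho>12 \<rho>13 \<rho>23) M \<and>
        has_bochner_integral M (\<lambda>x. 1) (1::real) \<and>
        distr M borel (\<lambda>x. x $ 3) = density lborel (\<lambda>x3. ennreal (fN q x3)) \<and>
        distr M borel (\<lambda>x. x $ 2) = density lborel (\<lambda>x2. ennreal (fN q x2)) \<and>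
        distr M borel (\<lambda>x. x $ 1) = density lborel (\<lambda>x1. ennreal (fN q x1)) \<and>
        (\<forall>n m.
          has_bochner_integral M (\<lambda>x. qHermite q n (x $ 1) * qHermite q m (x $ 2))
            (if n = m then \<rho>12 ^ n * qfact q n else 0) \<and>
          has_bochner_integral M (\<lambda>x. qHermite q n (x $ 1) * qHermite q m (x $ 3))
            (if n = m then \<rho>13 ^ n * qfact q n else 0) \<and>
          has_bochner_integral M (\<lambda>x. qHermite q n (x $ 2) * qHermite q m (x $ 3))
            (if n = m then \<rho>23 ^ n * qfact q n else 0)) \<and>
        (\<forall>i. has_bochner_integral M (\<lambda>x. x $ i) 0 \<and>
             has_bochner_integral M (\<lambda>x. (x $ i)\<^sup>2) 1) \<and>
        distr M borel (\<lambda>x. (x $ 1, x $ 2)) =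
          density lborel (\<lambda>(x1, x2). ennreal (fCN q \<rho>12 x1 x2 * fN q x2))))"
proof -
  have q: "-1 < q" "q \<le> 1" and r: "\<bar>\<rho>12\<bar> < 1" "\<bar>\<rho>13\<bar> < 1" "\<bar>\<rho>23\<bar> < 1"
    using assms by auto
  have D: "D = corr_det \<rho>12 \<rho>13 \<rho>23" by (simp add: D_def corr_det_def)
  have adm: "admissible q \<rho>12 \<rho>13 \<rho>23" if "q < 1 \<or> D > 0"
    using that q r by (simp add: admissible_def D)
  note m12 = moment12[OF adm] and m13 = moment13[OF adm] and m23 = moment23[OF adm]
  have norm: "has_lebesgue_integral_on (\<lambda>(x1, x2, x3). f x1 x2 x3) 1 (S \<times> S \<times> S)" if "q < 1 \<or> D > 0"
    using m12[OF that, of 0 0] by (simp add: f_def S_def)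
  show ?thesis
  proof (intro conjI impI allI ballI)
    assume qD: "q < 1 \<or> D > 0"
    show "has_lebesgue_integral_on (\<lambda>(x1, x2, x3). f x1 x2 x3) 1 (S \<times> S \<times> S)"
      by (rule norm[OF qD])
    show "has_lebesgue_integral_on (\<lambda>(x1, x2). f x1 x2 x3) (fN q x3) (S \<times> S)" if "x3 \<in> S" for x3
      using marginal3[OF adm[OF qD], of x3] that by (simp add: f_def S_def)
    show "has_lebesgue_integral_on (\<lambda>(x1, x3). f x1 x2 x3) (fN q x2) (S \<times> S)" if "x2 \<in> S" for x2
      using marginal3[OF admissible_swap23[OF adm[OF qD]], of x2] that
      by (simp add: f_def S_def f3D_swap23[OF adm[OF qD]])
    show "has_lebesgue_integral_on (\<lambda>(x2, x3). f x1 x2 x3) (fN q x1) (S \<times> S)" if "x1 \<in> S" for x1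
      using marginal3[OF admissible_rotate[OF adm[OF qD]], of x1] that
      by (simp add: f_def S_def f3D_rotate[OF adm[OF qD]])
    fix n m
    show "has_lebesgue_integral_on (\<lambda>(x1, x2, x3). qHermite q n x1 * qHermite q m x2 * f x1 x2 x3)
          (if n = m then \<rho>12 ^ n * qfact q n else 0) (S \<times> S \<times> S)"
      unfolding f_def S_def by (rule m12[OF qD])
    show "has_lebesgue_integral_on (\<lambda>(x1, x2, x3). qHermite q n x1 * qHermite q m x3 * f x1 x2 x3)
          (if n = m then \<rho>13 ^ n * qfact q n else 0) (S \<times> S \<times> S)"
      unfolding f_def S_def by (rule m13[OF qD])
    show "has_lebesgue_integral_on (\<lambda>(x1, x2, x3). qHermite q n x2 * qHermite q m x3 * f x1 x2 x3)
          (if n = m then \<rho>23 ^ n * qfact q n else 0) (S \<times> S \<times> S)"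
      unfolding f_def S_def by (rule m23[OF qD])
  next
    assume qD: "q < 1 \<or> D > 0"
    note sq = second_moment_from_hermite[where F = f and A = "S \<times> S \<times> S" and q = q, OF _ norm[OF qD]]
    show "has_lebesgue_integral_on (\<lambda>(x1, x2, x3). x1 * f x1 x2 x3) 0 (S \<times> S \<times> S)"
      using m12[OF qD, of 1 0] by (simp add: f_def S_def)
    show "has_lebesgue_integral_on (\<lambda>(x1, x2, x3). x2 * f x1 x2 x3) 0 (S \<times> S \<times> S)"
      using m12[OF qD, of 0 1] by (simp add: f_def S_def)
    show "has_lebesgue_integral_on (\<lambda>(x1, x2, x3). x3 * f x1 x2 x3) 0 (S \<times> S \<times> S)"
      using m13[OF qD, of 0 1] by (simp add: f_def S_def)
    show "has_lebesgue_integral_on (\<lambda>(x1, x2, x3). x1\<^sup>2 * f x1 x2 x3) 1 (S \<times> S \<times> S)"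
      by (rule sq[where g = "\<lambda>x y z. x"]) (use m12[OF qD, of 2 0] in \<open>simp add: f_def S_def\<close>)
    show "has_lebesgue_integral_on (\<lambda>(x1, x2, x3). x2\<^sup>2 * f x1 x2 x3) 1 (S \<times> S \<times> S)"
      by (rule sq[where g = "\<lambda>x y z. y"]) (use m12[OF qD, of 0 2] in \<open>simp add: f_def S_def\<close>)
    show "has_lebesgue_integral_on (\<lambda>(x1, x2, x3). x3\<^sup>2 * f x1 x2 x3) 1 (S \<times> S \<times> S)"
      by (rule sq[where g = "\<lambda>x y z. z"]) (use m13[OF qD, of 0 2] in \<open>simp add: f_def S_def\<close>)
    show "has_lebesgue_integral_on (\<lambda>x3. f x1 x2 x3) (fCN q \<rho>12 x1 x2 * fN q x2) S" if "x1 \<in> S" "x2 \<in> S" for x1 x2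
      using that unfolding f_def S_def by (intro marginal12 adm[OF qD])
  next
    fix x1 x2 x3 assume x: "x1 \<in> S" "x2 \<in> S" "x3 \<in> S"
    show "f x1 x2 x3 = fCN q \<rho>12 x1 x2 * fN q x2 * fN q x3" if "\<rho>13 = 0 \<and> \<rho>23 = 0"
      using independent3[OF admissible_independent(1)[OF q r(1)]] x that by (simp add: f_def S_def)
    show "f x1 x2 x3 = fCN q \<rho>13 x1 x3 * fN q x3 * fN q x2" if "\<rho>12 = 0 \<and> \<rho>23 = 0"
      using independent3[OF admissible_independent(1)[OF q r(2)]] x that
        f3D_swap23[OF admissible_independent(2)[OF q r(2)]] by (simp add: f_def S_def)
    show "f x1 x2 x3 = fCN q \<rho>23 x2 x3 * fN q x3 * fN q x1" if "\<rho>12 = 0 \<and> \<rho>13 = 0"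
      using independent3[OF admissible_independent(1)[OF q r(3)]] x that
        f3D_rotate[OF admissible_independent(3)[OF q r(3)]] by (simp add: f_def S_def)
  qed (rule singular_gaussian_case[OF _ r], simp_all add: D)
qed

end
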